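(* Assume $\mathbb{E}[K^2]<\infty$ and $\mathbb{E}K>1$. Fix $\varepsilon\in(0,q)$. Then, as $n\to\infty$ with $p\in(0,1]$ and the law of $K$ fixed, conditionally on the event $\{\bar\tau_n^{er}>n\varepsilon\}$, we have convergence in law $$\frac{\bar\tau_n^{er}-nq}{\sqrt n}\longrightarrow \mathcal N(0,\sigma_q^2),$$ where $\mathcal N(0,\sigma^2)$ denotes the centered Gaussian law with variance $\sigma^2$.
   Context: Second mode of transmission. Let $\mathcal N=\{1,\dots,n\}$ be the set of servers, let $p\in(0,1]$ be fixed, and let $K$ be a random variable with values in $\{0,1,2,\dots\}$ whose law does not depend on $n$. The Erdős–Rényi graph $G(n,p)$ is sampled on the vertex set $\mathcal N$: each unoriented edge is kept independently with probability $p$. Independently of the graph, each server $i$ has a resource $K_i$, where $(K_i)_{i\in\mathcal N}$ are i.i.d. copies of $K$, and one vertex, chosen uniformly at random, is the first informed server (at time $0$). At each integer time, an informed server which is not yet exhausted is selected (by any rule depending only on the past; the choice does not affect the law of the final outcome) and emits its $K_i$ attempts in a burst, each attempt being towards a random target chosen uniformly among the neighbors of the emitter in the graph, independently of the other attempts. (If a server has no neighbors, it wastes its resource without result, and the process continues.) If the target is already informed the attempt is lost; otherwise the target becomes informed. After all its attempts, the emitter is exhausted and time increases by one unit. The transmission ends at $\bar\tau_n^{er}$, the first time when all informed servers are exhausted. Thus $\bar\tau_n^{er}$ equals the final number of informed servers. For $\mathbb{E}K>1$, $q\in(0,1)$ is the largest (i.e. the positive) root of $q\,\mathbb{E}K+\ln(1-q)=0$.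 With $\sigma_K^2$ the variance of $K$, $$\sigma_q^2=\frac{q\,\sigma_K^2(1-q)^2+q(1-q)+(1-q)^2\ln(1-q)}{[(1-q)\mathbb{E}K-1]^2}.$$ *)

theory Defs
  imports "HOL-Probability.Probability"
begin

text \<open>A graph on the servers \<open>{1..n}\<close> is given by its set of edges, each edge being a
  two-element set of servers.\<close>

definition all_edges :: "nat \<Rightarrow> nat set set" where
  "all_edges n = {e. e \<subseteq> {1..n} \<and> card e = 2}"

definition erdos_renyi :: "nat \<Rightarrow> real \<Rightarrow> nat set set pmf" where
  "erdos_renyi n p =
     map_pmf (\<lambda>kept. {e \<in> all_edges n. kept e})
       (Pi_pmf (all_edges n) False (\<lambda>_. bernoulli_pmf p))"

definition neighbours :: "nat set set \<Rightarrow> nat \<Rightarrow> nat set" where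
  "neighbours E i = {j. {i, j} \<in> E}"

text \<open>A history lists, in chronological order, one pair per unit of time: the emitter and the
  targets of its successive attempts. So \<open>take t h\<close> is the history at time \<open>t\<close>. In what follows
  \<open>v\<close> is the first informed server.\<close>

type_synonym history = "(nat \<times> nat list) list"

definition informed :: "nat \<Rightarrow> history \<Rightarrow> nat set" where
  "informed v h = insert v (\<Union>(i, ts) \<in> set h. set ts)"

definition exhausted :: "history \<Rightarrow> nat set" where
  "exhausted h = fst ` set h"

definition active :: "nat \<Rightarrow> history \<Rightarrow> nat set" where
  "active v h = informed v h - exhausted h"

text \<open>The next emitter is selected, possibly at random, on the basis of everything that has been
  drawn so far: the graph, the resources, the first informed server and the history of the
  bursts. The targets of the bursts to come are not available to the rule.\<close>

type_synonym selection_rule =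
  "nat set set \<Rightarrow> (nat \<Rightarrow> nat) \<Rightarrow> nat \<Rightarrow> history \<Rightarrow> nat pmf"

definition admissible_rule :: "selection_rule \<Rightarrow> bool" where
  "admissible_rule rule \<longleftrightarrow>
     (\<forall>E \<kappa> v h. active v h \<noteq> {} \<longrightarrow> set_pmf (rule E \<kappa> v h) \<subseteq> active v h)"

definition burst :: "nat set set \<Rightarrow> nat \<Rightarrow> nat \<Rightarrow> nat list pmf" where
  "burst E i k =
     (if neighbours E i = {} then return_pmf []
      else replicate_pmf k (pmf_of_set (neighbours E i)))"

definition transmission_step ::
  "selection_rule \<Rightarrow> nat set set \<Rightarrow> (nat \<Rightarrow> nat) \<Rightarrow> nat \<Rightarrow> history \<Rightarrow> history pmf" where
  "transmission_step rule E \<kappa> v h =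
     (if active v h = {} then return_pmf h
      else do {
        i \<leftarrow> rule E \<kappa> v h;
        ts \<leftarrow> burst E i (\<kappa> i);
        return_pmf (h @ [(i, ts)])
      })"

fun transmission ::
  "selection_rule \<Rightarrow> nat set set \<Rightarrow> (nat \<Rightarrow> nat) \<Rightarrow> nat \<Rightarrow> nat \<Rightarrow> history pmf" where
  "transmission rule E \<kappa> v 0 = return_pmf []"
| "transmission rule E \<kappa> v (Suc t) =
     transmission rule E \<kappa> v t \<bind> transmission_step rule E \<kappa> v"

definition end_time :: "nat \<Rightarrow> history \<Rightarrow> nat" where
  "end_time v h = (LEAST t. active v (take t h) = {})"

text \<open>The law of the end of the transmission. Running the process up to time \<open>n\<close> is
  enough, since each of the \<open>n\<close> servers emits at most one burst. For \<open>n = 0\<close> there is no server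
  and the value is meaningless.\<close>

definition end_time_law :: "nat \<Rightarrow> real \<Rightarrow> nat pmf \<Rightarrow> selection_rule \<Rightarrow> nat pmf" where
  "end_time_law n p K rule = do {
     E \<leftarrow> erdos_renyi n p;
     \<kappa> \<leftarrow> Pi_pmf {1..n} 0 (\<lambda>_. K);
     v \<leftarrow> pmf_of_set {1..n};
     h \<leftarrow> transmission rule E \<kappa> v n;
     return_pmf (end_time v h)
   }"

text \<open>The bound \<open>x < 1\<close> confines \<open>x\<close> to the domain of \<open>ln (1 - x)\<close>, as \<open>ln\<close> is
  a total function here.\<close>

definition limit_fraction :: "nat pmf \<Rightarrow> real" where
  "limit_fraction K =
     (GREATEST x. x < 1 \<and> x * measure_pmf.expectation K real + ln (1 - x) = 0)"

definition limit_variance :: "nat pmf \<Rightarrow> real" where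
  "limit_variance K =
     (let q = limit_fraction K;
          m = measure_pmf.expectation K real;
          s = measure_pmf.variance K real
      in (q * s * (1 - q)\<^sup>2 + q * (1 - q) + (1 - q)\<^sup>2 * ln (1 - q)) / ((1 - q) * m - 1)\<^sup>2)"

end

theory Submission
  imports Defs "HOL-Real_Asymp.Real_Asymp"
begin

text \<open>The end of the transmission is the number of servers that are ever informed. The proof
  compares it with the first time at which a random walk with independent increments becomes
  negative, and this time fluctuates around \<open>n q\<close> on the scale \<open>sqrt n\<close>.

  Two active emitters can be exchanged without changing the law of what follows
  (\<open>explore_any_emitter\<close>). So the law of the end does not depend on the selection rule, and the
  least active server may emit first. The graph is then revealed along with the transmission: a
  uniform neighbour of the emitter is found by drawing uniform servers until one of them is a
  neighbour, and each draw reveals a single edge (\<open>annealed_attempt\<close>). As long as the draws of an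
  attempt meet edges that are still unrevealed, its target is uniform, exactly as in the complete
  graph. The expected number of other attempts is bounded uniformly in \<open>n\<close>, and it is of order
  \<open>1 / n\<close> for a fixed number \<open>L\<close> of initial bursts, because an explicit function of the revealed
  edges is a supermartingale (\<open>potential_attempt\<close>, \<open>potential_next_emitter\<close>). The theorem
  \<open>comparison\<close> turns this into a tool: a function of the time and of the number of informed
  servers that is superharmonic for the ideal process on the complete graph, with some tolerance
  after time \<open>L\<close>, bounds the law of the end of the transmission on the random graph, up to an
  error that vanishes when \<open>n\<close> and then the tolerance tend to infinity.

  The ideal process is a coupon collector. The number of attempts made while \<open>r\<close> servers are
  informed is geometric with success probability \<open>(n - r) / n\<close>, so that more than \<open>y\<close> servers are
  informed after \<open>T\<close> bursts if and only if the sum of \<open>T\<close> resources is at least the sum of the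
  waiting times up to \<open>y\<close> (\<open>ideal_bursts_eq_walk\<close>). The mean of the difference of these sums is
  close to \<open>n (x E K + ln (1 - x))\<close> for \<open>T = y = n x\<close>, which vanishes at \<open>x = q\<close>. A central limit
  theorem for arrays of independent variables (\<open>walk_clt\<close>) shows that the ideal process is above
  the diagonal at time \<open>n q + x sqrt n\<close> with probability close to that of \<open>{x<..}\<close> under the limit law;
  the variance is the variance of the difference divided by the square of
  the slope of its mean at \<open>q\<close>.

  The conditioning is harmless because extinction before the time \<open>n q - O (sqrt n)\<close> is decided,
  up to a small probability, by finitely many bursts, which have no influence on the fluctuations. A branching estimate
  (\<open>attempts_power_le\<close>) excludes extinction between a large time \<open>L\<close> and a small multiple of \<open>n\<close>.
  Later on, the convexity of \<open>x \<mapsto> - ln (1 - x)\<close> shows that a process that comes down to the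
  diagonal before time \<open>n q + x sqrt n\<close> would stay below it (\<open>reach_from_diagonal\<close>), so that this
  event is governed by the position of the process at a slightly later time. Hence
  \<open>P (\<tau> > n q + x sqrt n)\<close> is close to \<open>a tail x\<close> and \<open>P (\<tau> > n \<epsilon>)\<close> is close to \<open>a\<close>, where \<open>a\<close> is the
  probability that the ideal process survives \<open>L\<close> bursts. The probability \<open>a\<close> is bounded away
  from \<open>0\<close>, and the quotient converges to \<open>tail x\<close>.\<close>

section \<open>The selection rule does not matter\<close>

text \<open>The transmission in which the least active server always emits first, from a state with exhausted
  servers \<open>X\<close> and informed servers \<open>I\<close>. The number of further bursts is limited to make the
  recursion terminate; a limit of \<open>n - card X\<close> has no effect.\<close>

fun explore :: "nat set set \<Rightarrow> (nat \<Rightarrow> nat) \<Rightarrow> nat \<Rightarrow> nat set \<Rightarrow> nat set \<Rightarrow> nat pmf" where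
  "explore E \<kappa> 0 X I = return_pmf (card X)"
| "explore E \<kappa> (Suc m) X I =
     (if I - X = {} then return_pmf (card X)
      else let i = Min (I - X) in
        burst E i (\<kappa> i) \<bind> (\<lambda>ts. explore E \<kappa> m (insert i X) (I \<union> set ts)))"

lemma neighbours_subset:
  assumes "E \<subseteq> all_edges n"
  shows "neighbours E i \<subseteq> {1..n} - {i}"
proof
  fix j assume "j \<in> neighbours E i"
  then have "{i, j} \<in> all_edges n" using assms by (auto simp: neighbours_def)
  then have "{i, j} \<subseteq> {1..n}" "card {i, j} = 2" by (auto simp: all_edges_def)
  then show "j \<in> {1..n} - {i}" by (cases "i = j") auto
qed

lemma finite_neighbours: "E \<subseteq> all_edges n \<Longrightarrow> finite (neighbours E i)"
  using neighbours_subset finite_subset by (metis finite_Diff finite_atLeastAtMost)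

lemma set_burst_subset:
  assumes "E \<subseteq> all_edges n" "ts \<in> set_pmf (burst E i k)"
  shows "set ts \<subseteq> {1..n}"
  using assms neighbours_subset[OF assms(1), of i] finite_neighbours[OF assms(1), of i]
  by (auto simp: burst_def set_replicate_pmf set_pmf_of_set split: if_splits)

text \<open>If \<open>i\<close> and \<open>j\<close> are both active, each of them is still active after the burst of the other, and the
  two bursts are independent. So emitting with \<open>i\<close> and then \<open>j\<close> has the same effect as emitting with
  \<open>j\<close> and then \<open>i\<close>; by induction the first emitter can be any active server.\<close>

lemma explore_any_emitter:
  assumes E: "E \<subseteq> all_edges n"
  shows "\<lbrakk>X \<subseteq> I; I \<subseteq> {1..n}; n \<le> card X + Suc m; i \<in> I - X\<rbrakk> \<Longrightarrow>
    explore E \<kappa> (Suc m) X I =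
      burst E i (\<kappa> i) \<bind> (\<lambda>ts. explore E \<kappa> m (insert i X) (I \<union> set ts))"
proof (induction m arbitrary: X I i)
  case (0 X I i)
  have fin: "finite I" using 0 finite_subset by blast
  have "card (I - X) \<le> 1"
  proof -
    have "card (I - X) = card I - card X" using 0 fin by (simp add: card_Diff_subset finite_subset)
    moreover have "card I \<le> n" using card_mono[of "{1..n}" I] 0 by auto
    ultimately show ?thesis using 0 by linarith
  qed
  then have "I - X = {i}" using 0 fin
    by (metis card_1_singletonE card_0_eq empty_iff finite_Diff le_Suc_eq le_zero_eq One_nat_def singletonD)
  then show ?case by (simp add: Let_def)
next
  case (Suc m X I i)
  have fin: "finite I" using Suc finite_subset by blast
  define j where "j = Min (I - X)"
  have j: "j \<in> I - X" unfolding j_def using Suc fin by (intro Min_in) auto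
  have step: "explore E \<kappa> (Suc (Suc m)) X I =
      burst E j (\<kappa> j) \<bind> (\<lambda>ts. explore E \<kappa> (Suc m) (insert j X) (I \<union> set ts))"
    using Suc.prems by (subst explore.simps) (auto simp: Let_def j_def)
  show ?case
  proof (cases "i = j")
    case True
    then show ?thesis using step by simp
  next
    case False
    have card: "card (insert x X) = Suc (card X)" if "x \<in> I - X" for x
      using that fin Suc.prems(1) finite_subset by (metis DiffD2 card_insert_disjoint)
    have sub: "X \<subseteq> I \<Longrightarrow> x \<in> I - X \<Longrightarrow> ts \<in> set_pmf (burst E x (\<kappa> x)) \<Longrightarrow>
       insert x X \<subseteq> I \<union> set ts \<and> I \<union> set ts \<subseteq> {1..n}" for x ts
      using set_burst_subset[OF E, of ts] Suc.prems by blast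
    \<comment> \<open>the two emitters are exchanged by applying the induction hypothesis on both sides\<close>
    have "explore E \<kappa> (Suc (Suc m)) X I =
      burst E j (\<kappa> j) \<bind> (\<lambda>tj. burst E i (\<kappa> i) \<bind> (\<lambda>ti.
        explore E \<kappa> m (insert i (insert j X)) (I \<union> set tj \<union> set ti)))"
      unfolding step
    proof (intro bind_pmf_cong refl)
      fix tj assume "tj \<in> set_pmf (burst E j (\<kappa> j))"
      then show "explore E \<kappa> (Suc m) (insert j X) (I \<union> set tj) =
        burst E i (\<kappa> i) \<bind> (\<lambda>ti. explore E \<kappa> m (insert i (insert j X)) (I \<union> set tj \<union> set ti))"
        using sub[of j tj] Suc.prems j False card[OF j]
        by (intro Suc.IH) auto
    qed
    also have "\<dots> = burst E i (\<kappa> i) \<bind> (\<lambda>ti. burst E j (\<kappa> j) \<bind> (\<lambda>tj.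
        explore E \<kappa> m (insert j (insert i X)) (I \<union> set ti \<union> set tj)))"
      by (subst bind_commute_pmf) (simp add: insert_commute Un_ac)
    also have "\<dots> = burst E i (\<kappa> i) \<bind> (\<lambda>ti. explore E \<kappa> (Suc m) (insert i X) (I \<union> set ti))"
    proof (intro bind_pmf_cong refl)
      fix ti assume "ti \<in> set_pmf (burst E i (\<kappa> i))"
      then show "burst E j (\<kappa> j) \<bind> (\<lambda>tj. explore E \<kappa> m (insert j (insert i X)) (I \<union> set ti \<union> set tj))
        = explore E \<kappa> (Suc m) (insert i X) (I \<union> set ti)"
        using sub[of i ti] Suc.prems j False card[of i]
        by (intro Suc.IH[symmetric]) auto
    qed
    finally show ?thesis .
  qed
qed

text \<open>The invariants shared by all histories that a transmission can produce.\<close>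

definition orderly :: "nat \<Rightarrow> nat \<Rightarrow> history \<Rightarrow> bool" where
  "orderly n v h \<longleftrightarrow> exhausted h \<subseteq> informed v h \<and> informed v h \<subseteq> {1..n} \<and>
     card (exhausted h) = length h \<and> (\<forall>t<length h. active v (take t h) \<noteq> {})"

lemma exhausted_snoc: "exhausted (h @ [(i, ts)]) = insert i (exhausted h)"
  by (auto simp: exhausted_def)

lemma informed_snoc: "informed v (h @ [(i, ts)]) = informed v h \<union> set ts"
  by (auto simp: informed_def)

lemma finite_exhausted: "finite (exhausted h)"
  by (simp add: exhausted_def)

lemma transmission_step_orderly:
  assumes "E \<subseteq> all_edges n" "admissible_rule rule" "orderly n v h" "active v h \<noteq> {}"
    and "h' \<in> set_pmf (transmission_step rule E \<kappa> v h)"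
  shows "orderly n v h'" and "length h' = Suc (length h)"
proof -
  obtain i ts where i': "i \<in> set_pmf (rule E \<kappa> v h)" and ts: "ts \<in> set_pmf (burst E i (\<kappa> i))"
    and h': "h' = h @ [(i, ts)]"
    using assms(4,5) by (auto simp: transmission_step_def)
  have i: "i \<in> active v h"
    using assms(2,4) i' unfolding admissible_rule_def by blast
  have "set ts \<subseteq> {1..n}" using set_burst_subset[OF assms(1) ts] .
  moreover have "active v (take t h') \<noteq> {}" if "t < length h'" for t
  proof (cases "t = length h")
    case True
    then show ?thesis using assms(4) by (simp add: h')
  next
    case False
    then have "t < length h" using that by (simp add: h')
    then show ?thesis using assms(3) by (simp add: h' orderly_def)
  qed
  moreover have "card (exhausted h') = length h'"
    using assms(3) i by (simp add: h' exhausted_snoc orderly_def active_def finite_exhausted)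
  moreover have "exhausted h' \<subseteq> informed v h'" "informed v h \<subseteq> {1..n}"
    using assms(3) i unfolding h' exhausted_snoc informed_snoc orderly_def active_def by blast+
  ultimately show "orderly n v h'"
    unfolding orderly_def by (simp add: h' informed_snoc)
  show "length h' = Suc (length h)" by (simp add: h')
qed

lemma transmission_orderly:
  assumes E: "E \<subseteq> all_edges n" and adm: "admissible_rule rule" and v: "v \<in> {1..n}"
    and "h \<in> set_pmf (transmission rule E \<kappa> v t)"
  shows "orderly n v h \<and> (length h = t \<or> active v h = {} \<and> length h < t)"
  using assms(4)
proof (induction t arbitrary: h)
  case 0
  then show ?case using v by (auto simp: orderly_def exhausted_def informed_def)
next
  case (Suc t)
  then obtain h0 where h0: "h0 \<in> set_pmf (transmission rule E \<kappa> v t)"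
    "h \<in> set_pmf (transmission_step rule E \<kappa> v h0)" by auto
  note IH = Suc.IH[OF h0(1)]
  show ?case
  proof (cases "active v h0 = {}")
    case True
    then show ?thesis using h0(2) IH by (auto simp: transmission_step_def)
  next
    case False
    then show ?thesis using transmission_step_orderly[OF E adm _ False h0(2)] IH by auto
  qed
qed

text \<open>The law of the end of a transmission whose history so far is \<open>h\<close> is a martingale under
  every rule, because it does not depend on the next emitter.\<close>

lemma transmission_step_explore:
  assumes E: "E \<subseteq> all_edges n" and adm: "admissible_rule rule"
    and h: "orderly n v h"
  shows "transmission_step rule E \<kappa> v h \<bind>
      (\<lambda>h. explore E \<kappa> (n - length h) (exhausted h) (informed v h)) =
    explore E \<kappa> (n - length h) (exhausted h) (informed v h)"
proof (cases "active v h = {}")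
  case True
  then show ?thesis by (simp add: transmission_step_def bind_return_pmf)
next
  case False
  have "card (exhausted h) < card {1..n}"
    using h False by (intro psubset_card_mono) (auto simp: orderly_def active_def)
  then have lt: "length h < n" using h by (simp add: orderly_def)
  then obtain m where m: "n - length h = Suc m" by (metis Suc_diff_Suc)
  have m': "n - Suc (length h) = m" using m by simp
  have "transmission_step rule E \<kappa> v h \<bind>
      (\<lambda>h. explore E \<kappa> (n - length h) (exhausted h) (informed v h)) =
    rule E \<kappa> v h \<bind> (\<lambda>i. burst E i (\<kappa> i) \<bind> (\<lambda>ts.
      explore E \<kappa> m (insert i (exhausted h)) (informed v h \<union> set ts)))"
    using False by (simp add: transmission_step_def bind_assoc_pmf bind_return_pmf
        exhausted_snoc informed_snoc m')
  also have "\<dots> = rule E \<kappa> v h \<bind> (\<lambda>i. explore E \<kappa> (Suc m) (exhausted h) (informed v h))"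
  proof (intro bind_pmf_cong refl)
    fix i assume "i \<in> set_pmf (rule E \<kappa> v h)"
    then have "i \<in> informed v h - exhausted h"
      using adm False unfolding admissible_rule_def active_def by blast
    then show "burst E i (\<kappa> i) \<bind> (\<lambda>ts.
        explore E \<kappa> m (insert i (exhausted h)) (informed v h \<union> set ts)) =
      explore E \<kappa> (Suc m) (exhausted h) (informed v h)"
      using h m lt by (intro explore_any_emitter[OF E, symmetric]) (auto simp: orderly_def)
  qed
  finally show ?thesis by (simp add: m)
qed

text \<open>A history of length \<open>t\<close> whose last state has no active server ends at time \<open>t\<close>, because each unit
  of time exhausts exactly one server.\<close>

lemma end_time_transmission:
  assumes E: "E \<subseteq> all_edges n" and adm: "admissible_rule rule" and v: "v \<in> {1..n}"
  shows "map_pmf (end_time v) (transmission rule E \<kappa> v n) = explore E \<kappa> n {} {v}"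
proof -
  let ?R = "\<lambda>h. explore E \<kappa> (n - length h) (exhausted h) (informed v h)"
  have "transmission rule E \<kappa> v t \<bind> ?R = explore E \<kappa> n {} {v}" for t
  proof (induction t)
    case 0
    then show ?case by (simp add: bind_return_pmf exhausted_def informed_def)
  next
    case (Suc t)
    have "transmission rule E \<kappa> v (Suc t) \<bind> ?R =
      transmission rule E \<kappa> v t \<bind> (\<lambda>h. transmission_step rule E \<kappa> v h \<bind> ?R)"
      by (simp add: bind_assoc_pmf)
    also have "\<dots> = transmission rule E \<kappa> v t \<bind> ?R"
      using transmission_orderly[OF E adm v] transmission_step_explore[OF E adm]
      by (intro bind_pmf_cong refl) blast
    finally show ?case using Suc by simp
  qed
  moreover have "transmission rule E \<kappa> v n \<bind> ?R = transmission rule E \<kappa> v n \<bind> (\<lambda>h. return_pmf (end_time v h))"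
  proof (intro bind_pmf_cong refl)
    fix h assume "h \<in> set_pmf (transmission rule E \<kappa> v n)"
    from transmission_orderly[OF E adm v this]
    have h: "orderly n v h" "length h = n \<or> active v h = {} \<and> length h < n" by auto
    have act: "active v h = {}"
    proof (rule ccontr)
      assume "active v h \<noteq> {}"
      then have "card (exhausted h) < card {1..n}"
        using h(1) by (intro psubset_card_mono) (auto simp: orderly_def active_def)
      then show False using h \<open>active v h \<noteq> {}\<close> by (simp add: orderly_def)
    qed
    have "end_time v h = length h"
      unfolding end_time_def using act h(1)
      by (intro Least_equality) (auto simp: orderly_def intro: leI)
    moreover have "?R h = return_pmf (length h)"
      using act h(1) by (cases "n - length h") (auto simp: active_def orderly_def)
    ultimately show "?R h = return_pmf (end_time v h)" by simp
  qed
  ultimately show ?thesis by (metis map_pmf_def)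
qed

section \<open>Deferred decisions\<close>

text \<open>A server without neighbours is made to hit itself. This informs nobody, so that a wasted burst needs
  no separate treatment, and rejection sampling stays valid when there is nothing to accept.\<close>

definition attempt :: "nat set set \<Rightarrow> nat \<Rightarrow> nat pmf" where
  "attempt E i = (if neighbours E i = {} then return_pmf i else pmf_of_set (neighbours E i))"

fun spread :: "nat set set \<Rightarrow> nat \<Rightarrow> nat \<Rightarrow> nat set \<Rightarrow> nat set pmf" where
  "spread E i 0 I = return_pmf I"
| "spread E i (Suc k) I = attempt E i \<bind> (\<lambda>j. spread E i k (insert j I))"

lemma burst_eq_spread:
  assumes "i \<in> I"
  shows "burst E i k \<bind> (\<lambda>ts. F (I \<union> set ts)) = spread E i k I \<bind> F"
proof (cases "neighbours E i = {}")
  case True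
  have "spread E i k I = return_pmf I"
    using True assms by (induction k) (auto simp: attempt_def bind_return_pmf insert_absorb)
  then show ?thesis using True by (simp add: burst_def bind_return_pmf)
next
  case False
  have "replicate_pmf k (pmf_of_set (neighbours E i)) \<bind> (\<lambda>ts. F (I \<union> set ts)) =
      spread E i k I \<bind> F" for I
  proof (induction k arbitrary: I)
    case (Suc k)
    have "I \<union> set (j # ts) = insert j I \<union> set ts" for j ts by simp
    then show ?case
      using False by (simp add: attempt_def bind_return_pmf bind_assoc_pmf Suc.IH[symmetric])
  qed (simp add: bind_return_pmf)
  then show ?thesis using False by (simp add: burst_def)
qed

lemma explore_spread:
  assumes "finite I"
  shows "explore E \<kappa> (Suc m) X I =
     (if I - X = {} then return_pmf (card X)
      else let i = Min (I - X) in spread E i (\<kappa> i) I \<bind> explore E \<kappa> m (insert i X))"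
proof (cases "I - X = {}")
  case False
  then have "Min (I - X) \<in> I" using Min_in[of "I - X"] assms by auto
  then show ?thesis using False burst_eq_spread by (simp add: Let_def)
qed simp

text \<open>Rejection sampling: a candidate is drawn from a larger set and redrawn if it is not a neighbour.
  Testing one candidate reveals the status of a single edge, whereas drawing a neighbour directly would
  involve the whole neighbourhood of the emitter.\<close>

lemma attempt_by_rejection:
  assumes S: "finite S" "S \<noteq> {}" and N: "neighbours E i \<subseteq> S"
  shows "attempt E i =
    pmf_of_set S \<bind> (\<lambda>j. if {i, j} \<in> E then return_pmf j else attempt E i)"
proof (cases "neighbours E i = {}")
  case True
  then have "{i, j} \<notin> E" for j by (auto simp: neighbours_def)
  then show ?thesis by simp
next
  case False
  let ?N = "neighbours E i"
  have fN: "finite ?N" using N S finite_subset by auto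
  have N0: "card ?N > 0" using False fN by auto
  have S0: "card S > 0" using S by auto
  have mem: "{i, j} \<in> E \<longleftrightarrow> j \<in> ?N" for j by (auto simp: neighbours_def)
  show ?thesis
  proof (rule pmf_eqI)
    fix x
    have att: "attempt E i = pmf_of_set ?N" using False by (simp add: attempt_def)
    have val: "pmf (if j \<in> ?N then return_pmf j else pmf_of_set ?N) x =
        (if j \<in> ?N then indicator ?N x * indicator {x} j else indicator ?N x / card ?N)" for j
      using False fN by (cases "j \<in> ?N") (auto simp: indicator_def)
    have "pmf (pmf_of_set S \<bind> (\<lambda>j. if {i, j} \<in> E then return_pmf j else attempt E i)) x =
      (\<Sum>j\<in>S. if j \<in> ?N then indicator ?N x * indicator {x} j else indicator ?N x / card ?N) / card S"
      unfolding mem att using S by (simp add: pmf_bind_pmf_of_set val)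
    also have "(\<Sum>j\<in>S. if j \<in> ?N then indicator ?N x * indicator {x} j else indicator ?N x / card ?N) =
      (\<Sum>j\<in>?N. indicator ?N x * indicator {x} j) + (\<Sum>j\<in>S - ?N. indicator ?N x / card ?N :: real)"
    proof -
      have "S = ?N \<union> (S - ?N)" using N by auto
      then have "(\<Sum>j\<in>S. if j \<in> ?N then indicator ?N x * indicator {x} j else indicator ?N x / card ?N) =
        (\<Sum>j\<in>?N \<union> (S - ?N). if j \<in> ?N then indicator ?N x * indicator {x} j else indicator ?N x / card ?N :: real)"
        by simp
      also have "\<dots> = (\<Sum>j\<in>?N. if j \<in> ?N then indicator ?N x * indicator {x} j else indicator ?N x / card ?N) +
        (\<Sum>j\<in>S-?N. if j \<in> ?N then indicator ?N x * indicator {x} j else indicator ?N x / card ?N)"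
        using fN S by (intro sum.union_disjoint) auto
      finally show ?thesis by simp
    qed
    also have "(\<Sum>j\<in>?N. indicator ?N x * indicator {x} j) = (indicator ?N x :: real)"
      using fN by (auto simp: indicator_def)
    also have "(indicator ?N x + (\<Sum>j\<in>S - ?N. indicator ?N x / card ?N)) / card S = (indicator ?N x / card ?N :: real)"
      using N0 S0 card_mono[OF S(1) N]
      by (auto simp: card_Diff_subset[OF fN N] of_nat_diff field_simps)
    also have "\<dots> = pmf (attempt E i) x"
      using False fN by (simp add: attempt_def)
    finally show "pmf (attempt E i) x =
      pmf (pmf_of_set S \<bind> (\<lambda>j. if {i, j} \<in> E then return_pmf j else attempt E i)) x" by simp
  qed
qed

lemma Pi_pmf_reveal:
  assumes "finite A" "x \<in> A"
  shows "Pi_pmf A d f = f x \<bind> (\<lambda>b. Pi_pmf A d (f(x := return_pmf b)))"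
proof -
  have A: "A = insert x (A - {x})" using assms by auto
  have "Pi_pmf (A - {x}) d (f(x := return_pmf b)) = Pi_pmf (A - {x}) d f" for b
    using assms by (intro Pi_pmf_cong) auto
  then have "Pi_pmf (insert x (A - {x})) d (f(x := return_pmf b)) =
     Pi_pmf (A - {x}) d f \<bind> (\<lambda>g. return_pmf (g(x := b)))" for b
    using assms by (subst Pi_pmf_insert') (auto simp: bind_return_pmf)
  then show ?thesis
    using assms A Pi_pmf_insert'[of "A - {x}" x d f] by simp
qed

text \<open>The conditional law of the random graph once the edges in \<open>P\<close> are known to be present and those
  in \<open>Q\<close> to be absent.\<close>

definition partial_graph :: "nat \<Rightarrow> real \<Rightarrow> nat set set \<Rightarrow> nat set set \<Rightarrow> nat set set pmf" where
  "partial_graph n p P Q =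
     map_pmf (\<lambda>kept. {e \<in> all_edges n. kept e})
       (Pi_pmf (all_edges n) False
         (\<lambda>e. if e \<in> P then return_pmf True else if e \<in> Q then return_pmf False else bernoulli_pmf p))"

lemma finite_all_edges: "finite (all_edges n)"
  by (rule finite_subset[of _ "Pow {1..n}"]) (auto simp: all_edges_def)

lemma edge_in_all_edges: "{i, j} \<in> all_edges n \<longleftrightarrow> i \<in> {1..n} \<and> j \<in> {1..n} \<and> i \<noteq> j"
  by (cases "i = j") (auto simp: all_edges_def)

lemma erdos_renyi_eq_partial_graph: "erdos_renyi n p = partial_graph n p {} {}"
  by (simp add: erdos_renyi_def partial_graph_def)

lemma partial_graph_reveal:
  assumes "e \<in> all_edges n" "e \<notin> P" "e \<notin> Q"
  shows "partial_graph n p P Q = bernoulli_pmf p \<bind>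
    (\<lambda>b. if b then partial_graph n p (insert e P) Q else partial_graph n p P (insert e Q))"
proof -
  let ?f = "\<lambda>P Q e. if e \<in> P then return_pmf True else if e \<in> Q then return_pmf False else bernoulli_pmf p"
  have "?f P Q e = bernoulli_pmf p" using assms by simp
  moreover have "(?f P Q)(e := return_pmf b) = (if b then ?f (insert e P) Q else ?f P (insert e Q))" for b
  proof
    fix e'
    show "((?f P Q)(e := return_pmf b)) e' = (if b then ?f (insert e P) Q else ?f P (insert e Q)) e'"
      using assms by (cases "e' = e"; cases b) simp_all
  qed
  ultimately have "Pi_pmf (all_edges n) False (?f P Q) = bernoulli_pmf p \<bind>
    (\<lambda>b. Pi_pmf (all_edges n) False (if b then ?f (insert e P) Q else ?f P (insert e Q)))"
    using Pi_pmf_reveal[OF finite_all_edges assms(1), of False "?f P Q"] by simp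
  then show ?thesis
    unfolding partial_graph_def map_bind_pmf
    by (auto simp: map_bind_pmf intro!: bind_pmf_cong)
qed

lemma set_partial_graph:
  assumes "E \<in> set_pmf (partial_graph n p P Q)" "P \<subseteq> all_edges n" "P \<inter> Q = {}"
  shows "P \<subseteq> E" "E \<inter> Q = {}" "E \<subseteq> all_edges n"
proof -
  let ?f = "\<lambda>e. if e \<in> P then return_pmf True else if e \<in> Q then return_pmf False else bernoulli_pmf p"
  obtain kept where kept: "kept \<in> set_pmf (Pi_pmf (all_edges n) False ?f)"
    and E: "E = {e \<in> all_edges n. kept e}"
    using assms(1) by (auto simp: partial_graph_def)
  have *: "kept e \<in> set_pmf (?f e)" if "e \<in> all_edges n" for e
    using kept that by (auto simp: set_Pi_pmf[OF finite_all_edges] PiE_dflt_def)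
  show "P \<subseteq> E"
  proof
    fix e assume "e \<in> P"
    then show "e \<in> E" using *[of e] assms(2) by (auto simp: E)
  qed
  show "E \<inter> Q = {}"
  proof -
    have "\<not> kept e" if "e \<in> all_edges n" "e \<in> Q" for e
      using *[OF that(1)] that(2) assms(3) by (auto split: if_splits)
    then show ?thesis by (auto simp: E)
  qed
  show "E \<subseteq> all_edges n" by (auto simp: E)
qed

definition partial_resources :: "nat \<Rightarrow> nat pmf \<Rightarrow> (nat \<Rightarrow> nat) \<Rightarrow> nat set \<Rightarrow> (nat \<Rightarrow> nat) pmf" where
  "partial_resources n K c X = Pi_pmf {1..n} 0 (\<lambda>j. if j \<in> X then return_pmf (c j) else K)"

lemma partial_resources_reveal:
  assumes "i \<in> {1..n}" "i \<notin> X"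
  shows "partial_resources n K c X = K \<bind> (\<lambda>k. partial_resources n K (c(i := k)) (insert i X))"
proof -
  have "(\<lambda>j. if j \<in> X then return_pmf (c j) else K)(i := return_pmf k) =
    (\<lambda>j. if j \<in> insert i X then return_pmf ((c(i := k)) j) else K)" for k
    using assms by (auto simp: fun_eq_iff)
  then show ?thesis
    using Pi_pmf_reveal[of "{1..n}" i 0 "\<lambda>j. if j \<in> X then return_pmf (c j) else K"] assms
    by (simp add: partial_resources_def)
qed

lemma set_partial_resources:
  assumes "\<kappa> \<in> set_pmf (partial_resources n K c X)" "i \<in> X" "i \<in> {1..n}"
  shows "\<kappa> i = c i"
proof -
  have "\<kappa> i \<in> set_pmf (if i \<in> X then return_pmf (c i) else K)"
    using assms unfolding partial_resources_def by (auto simp: set_Pi_pmf PiE_dflt_def split: if_splits)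
  then show ?thesis using assms(2) by simp
qed

text \<open>The law of the end of the transmission given only what has been revealed: the edges in \<open>P\<close> and
  \<open>Q\<close> and the resources of the exhausted servers. The emitter \<open>i\<close>, already counted in \<open>X\<close>, has \<open>k\<close>
  attempts left.\<close>

definition annealed :: "nat \<Rightarrow> real \<Rightarrow> nat pmf \<Rightarrow> nat \<Rightarrow> nat \<Rightarrow> nat \<Rightarrow> nat set set \<Rightarrow> nat set set \<Rightarrow>
    (nat \<Rightarrow> nat) \<Rightarrow> nat set \<Rightarrow> nat set \<Rightarrow> nat pmf" where
  "annealed n p K m i k P Q c X I =
     partial_graph n p P Q \<bind> (\<lambda>E. partial_resources n K c X \<bind> (\<lambda>\<kappa>.
       spread E i k I \<bind> explore E \<kappa> m X))"

text \<open>The candidates known not to be neighbours are excluded from the draw, so that every draw either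
  reveals a new edge or ends the attempt. This makes the number of unrevealed edges a termination
  measure.\<close>

lemma annealed_attempt:
  assumes PQ: "P \<subseteq> all_edges n" "P \<inter> Q = {}" and i: "i \<in> {1..n}"
    and S: "S = {j \<in> {1..n}. j \<noteq> i \<and> {i, j} \<notin> Q}" "S \<noteq> {}"
  shows "annealed n p K m i (Suc k) P Q c X I = pmf_of_set S \<bind> (\<lambda>j.
    if {i, j} \<in> P then annealed n p K m i k P Q c X (insert j I)
    else bernoulli_pmf p \<bind> (\<lambda>b.
      if b then annealed n p K m i k (insert {i, j} P) Q c X (insert j I)
      else annealed n p K m i (Suc k) P (insert {i, j} Q) c X I))"
proof -
  define G where "G k E I = partial_resources n K c X \<bind> (\<lambda>\<kappa>. spread E i k I \<bind> explore E \<kappa> m X)" for k E I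
  have ann: "annealed n p K m i k P Q c X I = partial_graph n p P Q \<bind> (\<lambda>E. G k E I)" for k P Q I
    by (simp add: annealed_def G_def)
  have fS: "finite S" using S(1) by auto
  have G_Suc: "G (Suc k) E I = attempt E i \<bind> (\<lambda>j. G k E (insert j I))" for E
    unfolding G_def by (subst bind_commute_pmf) (simp add: bind_assoc_pmf)
  have G_rej: "G (Suc k) E I = pmf_of_set S \<bind> (\<lambda>j. if {i, j} \<in> E then G k E (insert j I) else G (Suc k) E I)"
    if "E \<in> set_pmf (partial_graph n p P Q)" for E
  proof -
    note E = set_partial_graph[OF that PQ]
    have "neighbours E i \<subseteq> S"
      using neighbours_subset[OF E(3), of i] E(2) by (auto simp: S neighbours_def)
    from attempt_by_rejection[OF fS S(2) this]
    have "G (Suc k) E I = pmf_of_set S \<bind> (\<lambda>j. (if {i, j} \<in> E then return_pmf j else attempt E i) \<bind> (\<lambda>j. G k E (insert j I)))"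
      unfolding G_Suc by (metis bind_assoc_pmf)
    also have "\<dots> = pmf_of_set S \<bind> (\<lambda>j. if {i, j} \<in> E then G k E (insert j I) else G (Suc k) E I)"
      by (intro bind_pmf_cong refl) (simp add: bind_return_pmf G_Suc)
    finally show ?thesis .
  qed
  have "annealed n p K m i (Suc k) P Q c X I = partial_graph n p P Q \<bind>
     (\<lambda>E. pmf_of_set S \<bind> (\<lambda>j. if {i, j} \<in> E then G k E (insert j I) else G (Suc k) E I))"
    unfolding ann using G_rej by (intro bind_pmf_cong refl)
  also have "\<dots> = pmf_of_set S \<bind> (\<lambda>j. partial_graph n p P Q \<bind>
     (\<lambda>E. if {i, j} \<in> E then G k E (insert j I) else G (Suc k) E I))"
    by (rule bind_commute_pmf)
  also have "\<dots> = pmf_of_set S \<bind> (\<lambda>j.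
    if {i, j} \<in> P then annealed n p K m i k P Q c X (insert j I)
    else bernoulli_pmf p \<bind> (\<lambda>b.
      if b then annealed n p K m i k (insert {i, j} P) Q c X (insert j I)
      else annealed n p K m i (Suc k) P (insert {i, j} Q) c X I))"
  proof (intro bind_pmf_cong refl)
    fix j assume "j \<in> set_pmf (pmf_of_set S)"
    then have j: "j \<in> {1..n}" "j \<noteq> i" "{i, j} \<notin> Q"
      using fS S by (auto simp: set_pmf_of_set)
    let ?g = "\<lambda>E. if {i, j} \<in> E then G k E (insert j I) else G (Suc k) E I"
    let ?e = "{i, j}"
    have e: "?e \<in> all_edges n" using i j by (auto simp: edge_in_all_edges)
    have present: "partial_graph n p P' Q' \<bind> ?g = annealed n p K m i k P' Q' c X (insert j I)"
      if "?e \<in> P'" "P' \<subseteq> all_edges n" "P' \<inter> Q' = {}" for P' Q'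
      unfolding ann using set_partial_graph(1)[OF _ that(2,3)] that(1)
      by (intro bind_pmf_cong refl) auto
    have absent: "partial_graph n p P' Q' \<bind> ?g = annealed n p K m i (Suc k) P' Q' c X I"
      if "?e \<in> Q'" "P' \<subseteq> all_edges n" "P' \<inter> Q' = {}" for P' Q'
      unfolding ann using set_partial_graph(2)[OF _ that(2,3)] that(1)
      by (intro bind_pmf_cong refl) auto
    show "partial_graph n p P Q \<bind> ?g =
      (if ?e \<in> P then annealed n p K m i k P Q c X (insert j I)
       else bernoulli_pmf p \<bind> (\<lambda>b.
         if b then annealed n p K m i k (insert ?e P) Q c X (insert j I)
         else annealed n p K m i (Suc k) P (insert ?e Q) c X I))"
    proof (cases "?e \<in> P")
      case True
      then show ?thesis using present PQ by simp
    next
      case False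
      have "partial_graph n p P Q \<bind> ?g = bernoulli_pmf p \<bind>
        (\<lambda>b. if b then partial_graph n p (insert ?e P) Q \<bind> ?g else partial_graph n p P (insert ?e Q) \<bind> ?g)"
        unfolding partial_graph_reveal[OF e False j(3)] bind_assoc_pmf
        by (auto intro!: bind_pmf_cong)
      then show ?thesis
        using present[of "insert ?e P" Q] absent[of "insert ?e Q" P] False PQ e j(3) by (simp cong: if_cong)
    qed
  qed
  finally show ?thesis .
qed

lemma annealed_attempt_wasted:
  assumes PQ: "P \<subseteq> all_edges n" "P \<inter> Q = {}" and i: "i \<in> I"
    and S: "{j \<in> {1..n}. j \<noteq> i \<and> {i, j} \<notin> Q} = {}"
  shows "annealed n p K m i (Suc k) P Q c X I = annealed n p K m i k P Q c X I"
  unfolding annealed_def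
proof (rule bind_pmf_cong[OF refl], rule bind_pmf_cong[OF refl])
  fix E \<kappa> assume "E \<in> set_pmf (partial_graph n p P Q)"
  note E = set_partial_graph[OF this PQ]
  have "j \<notin> neighbours E i" for j
  proof
    assume j: "j \<in> neighbours E i"
    then have "j \<in> {1..n}" "j \<noteq> i" using neighbours_subset[OF E(3), of i] by auto
    then have "{i, j} \<in> Q" using S by auto
    then show False using j E(2) by (auto simp: neighbours_def)
  qed
  then have "neighbours E i = {}" by blast
  then show "spread E i (Suc k) I \<bind> explore E \<kappa> m X = spread E i k I \<bind> explore E \<kappa> m X"
    using i by (simp add: attempt_def bind_return_pmf insert_absorb)
qed

lemma annealed_stop:
  assumes "I - X = {}"
  shows "annealed n p K m i 0 P Q c X I = return_pmf (card X)"
proof -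
  have "explore E \<kappa> m X I = return_pmf (card X)" for E \<kappa>
    using assms by (cases m) auto
  then show ?thesis by (simp add: annealed_def bind_return_pmf)
qed

lemma annealed_next_emitter:
  assumes I: "I \<subseteq> {1..n}" "I - X \<noteq> {}" and i': "i' = Min (I - X)"
  shows "annealed n p K (Suc m) i 0 P Q c X I =
    K \<bind> (\<lambda>k. annealed n p K m i' k P Q (c(i' := k)) (insert i' X) I)"
proof -
  have fin: "finite I" using I finite_subset by blast
  have "i' \<in> I - X" unfolding i' using I fin by (intro Min_in) auto
  then have mem: "i' \<in> {1..n}" "i' \<notin> X" using I by auto
  have "annealed n p K (Suc m) i 0 P Q c X I = partial_graph n p P Q \<bind> (\<lambda>E.
    K \<bind> (\<lambda>k. partial_resources n K (c(i' := k)) (insert i' X) \<bind> (\<lambda>\<kappa>.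
      spread E i' (\<kappa> i') I \<bind> explore E \<kappa> m (insert i' X))))"
    using I i' unfolding annealed_def
    by (simp del: explore.simps add: bind_return_pmf explore_spread[OF fin] Let_def bind_assoc_pmf
        partial_resources_reveal[OF mem, of K c])
  also have "\<dots> = partial_graph n p P Q \<bind> (\<lambda>E.
    K \<bind> (\<lambda>k. partial_resources n K (c(i' := k)) (insert i' X) \<bind> (\<lambda>\<kappa>.
      spread E i' k I \<bind> explore E \<kappa> m (insert i' X))))"
  proof (intro bind_pmf_cong refl)
    fix E k \<kappa> assume "\<kappa> \<in> set_pmf (partial_resources n K (c(i' := k)) (insert i' X))"
    from set_partial_resources[OF this] mem have "\<kappa> i' = k" by simp
    then show "spread E i' (\<kappa> i') I = spread E i' k I" by simp
  qed
  also have "\<dots> = K \<bind> (\<lambda>k. annealed n p K m i' k P Q (c(i' := k)) (insert i' X) I)"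
    unfolding annealed_def by (rule bind_commute_pmf)
  finally show ?thesis .
qed

lemma end_time_law_eq_annealed:
  assumes "admissible_rule rule" "n > 0"
  shows "end_time_law n p K rule =
    pmf_of_set {1..n} \<bind> (\<lambda>v. annealed n p K n 0 0 {} {} (\<lambda>_. 0) {} {v})"
proof -
  have "end_time_law n p K rule = erdos_renyi n p \<bind> (\<lambda>E. Pi_pmf {1..n} 0 (\<lambda>_. K) \<bind> (\<lambda>\<kappa>.
     pmf_of_set {1..n} \<bind> (\<lambda>v. explore E \<kappa> n {} {v})))"
    unfolding end_time_law_def
  proof (intro bind_pmf_cong refl)
    fix E \<kappa> v assume "E \<in> set_pmf (erdos_renyi n p)" "v \<in> set_pmf (pmf_of_set {1..n})"
    then have "E \<subseteq> all_edges n" "v \<in> {1..n}"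
      using assms by (auto simp: erdos_renyi_def set_pmf_of_set)
    from end_time_transmission[OF this(1) assms(1) this(2)]
    show "transmission rule E \<kappa> v n \<bind> (\<lambda>h. return_pmf (end_time v h)) = explore E \<kappa> n {} {v}"
      by (simp add: map_pmf_def)
  qed
  also have "\<dots> = pmf_of_set {1..n} \<bind> (\<lambda>v. erdos_renyi n p \<bind> (\<lambda>E. Pi_pmf {1..n} 0 (\<lambda>_. K) \<bind> (\<lambda>\<kappa>.
      explore E \<kappa> n {} {v})))"
    by (subst (2) bind_commute_pmf, subst bind_commute_pmf) (rule refl)
  finally show ?thesis
    by (simp add: annealed_def erdos_renyi_eq_partial_graph partial_resources_def bind_return_pmf)
qed

section \<open>Comparison with the complete graph\<close>

lemma expectation_bind_pmf:
  fixes h :: "'b \<Rightarrow> real"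
  assumes "\<And>x. \<bar>h x\<bar> \<le> B"
  shows "measure_pmf.expectation (p \<bind> g) h =
    measure_pmf.expectation p (\<lambda>x. measure_pmf.expectation (g x) h)"
  unfolding measure_pmf_bind
  by (rule integral_bind[where K="count_space UNIV" and B=B and B'=1])
     (use assms measure_pmf_in_subprob_algebra measure_pmf.finite_measure_axioms in auto)

lemma integrable_bounded_pmf:
  fixes h :: "'b \<Rightarrow> real"
  assumes "\<And>x. \<bar>h x\<bar> \<le> B"
  shows "integrable (measure_pmf p) h"
  by (rule measure_pmf.integrable_const_bound[where B=B]) (use assms in auto)

lemma expectation_between_0_1:
  fixes h :: "'b \<Rightarrow> real"
  assumes "\<And>x. 0 \<le> h x" "\<And>x. h x \<le> 1"
  shows "0 \<le> measure_pmf.expectation p h" "measure_pmf.expectation p h \<le> 1"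
proof -
  have "integrable (measure_pmf p) h"
    using assms by (intro integrable_bounded_pmf[where B=1]) (auto simp: abs_le_iff intro: order_trans[of _ 0])
  then show "measure_pmf.expectation p h \<le> 1"
    using assms(2) by (intro measure_pmf.integral_le_const) auto
qed (use assms in auto)

text \<open>The ideal process lives on the complete graph: an attempt of a process with \<open>c\<close> informed servers is
  successful with the probability below, independently of the past. Targets are drawn among
  all \<open>n\<close> servers, the emitter included, which only changes the probability by a factor \<open>1 - 1 / n\<close>.\<close>

definition hit :: "nat \<Rightarrow> nat \<Rightarrow> real" where
  "hit n c = real (n - c) / real n"

text \<open>The expected value of \<open>\<phi>\<close> at the number of informed servers after \<open>k\<close> attempts of the ideal
  process, as a function of the number \<open>c\<close> of informed servers before them.\<close>

fun attempts :: "nat \<Rightarrow> nat \<Rightarrow> (nat \<Rightarrow> real) \<Rightarrow> nat \<Rightarrow> real" where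
  "attempts n 0 \<phi> c = \<phi> c"
| "attempts n (Suc k) \<phi> c = hit n c * attempts n k \<phi> (Suc c) + (1 - hit n c) * attempts n k \<phi> c"

definition ideal_burst :: "nat \<Rightarrow> nat pmf \<Rightarrow> (nat \<Rightarrow> real) \<Rightarrow> nat \<Rightarrow> real" where
  "ideal_burst n K \<phi> c = measure_pmf.expectation K (\<lambda>k. attempts n k \<phi> c)"

lemma hit_bounds: "0 \<le> hit n c" "hit n c \<le> 1"
  by (auto simp: hit_def divide_le_eq)

lemma hit_antimono: "c \<le> d \<Longrightarrow> hit n d \<le> hit n c"
  by (auto simp: hit_def intro!: divide_right_mono)

lemma attempts_bounds:
  assumes "\<And>c. 0 \<le> \<phi> c" "\<And>c. \<phi> c \<le> B"
  shows "0 \<le> attempts n k \<phi> c" "attempts n k \<phi> c \<le> B"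
proof (induction k arbitrary: c)
  case (Suc k)
  { case 1
    show ?case using Suc(1) hit_bounds[of n c] by auto
  next
    case 2
    show ?case using Suc(2) hit_bounds[of n c]
      by (auto intro!: convex_bound_le)
  }
qed (use assms in auto)

text \<open>One attempt of the actual process, with \<open>c\<close> informed servers, is coupled with one attempt of the
  ideal process, with \<open>c'\<close> informed servers; \<open>x\<close> and \<open>y\<close> are the values of the ideal process after
  a success and after a failure. If \<open>c < c'\<close>, the ideal process may fail when the actual one
  succeeds, which only narrows the gap, and conversely if \<open>c' < c\<close>. So the monotone coupling costs
  nothing, and a price \<open>\<omega>\<close> is paid only on the part \<open>\<bar>\<sigma>s - \<theta> \<pi>\<bar>\<close> of the mass \<open>\<theta> = \<sigma>s + \<sigma>f\<close> in which the
  actual success probability differs from \<open>\<pi>\<close>.\<close>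

lemma coupled_attempt:
  fixes x y \<sigma>s \<sigma>f \<pi> \<pi>' \<omega> :: real and c c' :: nat
  assumes nonneg: "0 \<le> \<sigma>s" "0 \<le> \<sigma>f" "0 \<le> \<omega>"
    and \<pi>': "0 \<le> \<pi>'" "\<pi>' \<le> 1"
    and less: "c < c' \<Longrightarrow> \<pi>' \<le> \<pi>" and gr: "c' < c \<Longrightarrow> \<pi> \<le> \<pi>'" and eq: "c = c' \<Longrightarrow> \<pi> = \<pi>'"
  shows "\<sigma>s * (if c < c' then min x y else min x (y + \<omega>))
       + \<sigma>f * (if c' < c then min x y else min y (x + \<omega>))
     \<le> (\<sigma>s + \<sigma>f) * (\<pi>' * x + (1 - \<pi>') * y) + \<bar>\<sigma>s - (\<sigma>s + \<sigma>f) * \<pi>\<bar> * \<omega>"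
    (is "\<sigma>s * ?bs + \<sigma>f * ?bf \<le> _")
proof -
  define \<theta> where "\<theta> = \<sigma>s + \<sigma>f"
  have th: "0 \<le> \<theta>" using nonneg by (simp add: \<theta>_def)
  have bs: "?bs \<le> x" "?bs \<le> y + \<omega>" "c < c' \<Longrightarrow> ?bs \<le> y" using nonneg by auto
  have bf: "?bf \<le> y" "?bf \<le> x + \<omega>" "c' < c \<Longrightarrow> ?bf \<le> x" using nonneg by auto
  have "\<sigma>s * ?bs + \<sigma>f * ?bf \<le> \<theta> * (\<pi>' * x + (1 - \<pi>') * y) + \<bar>\<sigma>s - \<theta> * \<pi>\<bar> * \<omega>"
  \<comment> \<open>the excess \<open>e\<close> of successes over the ideal process is matched with failures, and conversely\<close>
  proof (cases "\<theta> * \<pi>' \<le> \<sigma>s")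
    case True
    define e where "e = \<sigma>s - \<theta> * \<pi>'"
    have e: "0 \<le> e" using True by (simp add: e_def)
    have "\<sigma>s * ?bs = \<theta> * \<pi>' * ?bs + e * ?bs" by (simp add: e_def algebra_simps)
    moreover have "\<theta> * \<pi>' * ?bs \<le> \<theta> * \<pi>' * x" using th \<pi>' bs by (intro mult_left_mono) auto
    moreover have "\<sigma>f * ?bf \<le> \<sigma>f * y" using nonneg bf by (intro mult_left_mono) auto
    moreover have "\<sigma>f * y = \<theta> * (1 - \<pi>') * y - e * y" by (simp add: e_def \<theta>_def algebra_simps)
    moreover have "e * (?bs - y) \<le> \<bar>\<sigma>s - \<theta> * \<pi>\<bar> * \<omega>"
    proof (cases "c < c'")
      case True
      then have "e * (?bs - y) \<le> 0" using e bs by (intro mult_nonneg_nonpos) auto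
      also have "0 \<le> \<bar>\<sigma>s - \<theta> * \<pi>\<bar> * \<omega>" using nonneg by simp
      finally show ?thesis .
    next
      case False
      then have "\<pi> \<le> \<pi>'" using gr eq by (cases "c = c'") auto
      then have "e \<le> \<sigma>s - \<theta> * \<pi>" using th by (simp add: e_def mult_left_mono)
      moreover have "e * (?bs - y) \<le> e * \<omega>" using e bs by (intro mult_left_mono) auto
      moreover have "e * \<omega> \<le> \<bar>\<sigma>s - \<theta> * \<pi>\<bar> * \<omega>" using calculation nonneg by (intro mult_right_mono) auto
      ultimately show ?thesis by linarith
    qed
    ultimately show ?thesis by (simp add: algebra_simps)
  next
    case False
    define e where "e = \<theta> * \<pi>' - \<sigma>s"
    have e: "0 \<le> e" using False by (simp add: e_def)
    have "\<sigma>f * ?bf = \<theta> * (1 - \<pi>') * ?bf + e * ?bf" by (simp add: e_def \<theta>_def algebra_simps)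
    moreover have "\<theta> * (1 - \<pi>') * ?bf \<le> \<theta> * (1 - \<pi>') * y" using th \<pi>' bf by (intro mult_left_mono) auto
    moreover have "\<sigma>s * ?bs \<le> \<sigma>s * x" using nonneg bs by (intro mult_left_mono) auto
    moreover have "\<sigma>s * x = \<theta> * \<pi>' * x - e * x" by (simp add: e_def \<theta>_def algebra_simps)
    moreover have "e * (?bf - x) \<le> \<bar>\<sigma>s - \<theta> * \<pi>\<bar> * \<omega>"
    proof (cases "c' < c")
      case True
      then have "e * (?bf - x) \<le> 0" using e bf by (intro mult_nonneg_nonpos) auto
      also have "0 \<le> \<bar>\<sigma>s - \<theta> * \<pi>\<bar> * \<omega>" using nonneg by simp
      finally show ?thesis .
    next
      case False
      then have "\<pi>' \<le> \<pi>" using less eq by (cases "c = c'") auto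
      then have "e \<le> \<theta> * \<pi> - \<sigma>s" using th by (simp add: e_def mult_left_mono)
      moreover have "e * (?bf - x) \<le> e * \<omega>" using e bf by (intro mult_left_mono) auto
      moreover have "e * \<omega> \<le> \<bar>\<sigma>s - \<theta> * \<pi>\<bar> * \<omega>" using calculation nonneg by (intro mult_right_mono) auto
      ultimately show ?thesis by linarith
    qed
    ultimately show ?thesis by (simp add: algebra_simps)
  qed
  then show ?thesis by (simp add: \<theta>_def)
qed

text \<open>The candidates of an attempt consist of \<open>a\<close> uninformed and \<open>f\<close> informed servers whose edge to the
  emitter is unrevealed, and of \<open>r\<close> servers whose edge is known to be present; \<open>b\<close> is the number of
  revealed edges at the emitter and \<open>U\<close> the number of uninformed servers. The accepted
  candidate is then uninformed with a probability that differs from \<open>U / n\<close> by \<open>O ((b + 1) / n)\<close>.\<close>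

lemma acceptance_mismatch:
  fixes n p a f r b U S :: real
  assumes "0 \<le> p" "p \<le> 1" "0 \<le> a" "0 \<le> f" "0 \<le> r" "r \<le> b" "0 < S" "0 < n" "0 \<le> U" "U \<le> n"
    and S: "S = a + f + r" and b: "a + f = n - 1 - b" and U: "a \<le> U" "U \<le> a + b"
  shows "\<bar>p * a / S - (p * a / S + (p * f + r) / S) * (U / n)\<bar> \<le> 6 * (b + 1) / n"
proof (cases "n / 2 \<le> S")
  case True
  have "S * (p * a / S - (p * a / S + (p * f + r) / S) * (U / n)) = p * a - (p * (a + f) + r) * (U / n)"
    using assms by (simp add: field_simps)
  also have "\<dots> = p * (a - U) + p * U * ((1 + b) / n) - r * (U / n)"
    unfolding b using assms by (simp add: field_simps)
  finally have eq: "S * (p * a / S - (p * a / S + (p * f + r) / S) * (U / n)) =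
     p * (a - U) + p * U * ((1 + b) / n) - r * (U / n)" .
  have Un: "0 \<le> U / n" "U / n \<le> 1" using assms by auto
  define A B C where "A = p * (U - a)" and "B = p * (U / n) * (1 + b)" and "C = r * (U / n)"
  have "p * (U - a) \<le> 1 * b" using assms by (intro mult_mono) auto
  then have A: "A \<le> b" "0 \<le> A" using assms by (simp_all add: A_def)
  have "p * (U / n) * (1 + b) \<le> 1 * (1 + b)" using assms Un
    by (intro mult_right_mono mult_le_one) auto
  then have B: "B \<le> 1 + b" by (simp add: B_def)
  have B0: "0 \<le> B" unfolding B_def using assms Un by (intro mult_nonneg_nonneg) auto
  have "r * (U / n) \<le> b * 1" using assms Un by (intro mult_mono) auto
  then have C: "C \<le> b" "0 \<le> C" using assms Un by (simp_all add: C_def)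
  have b0: "0 \<le> b" using assms by linarith
  have "p * (a - U) + p * U * ((1 + b) / n) - r * (U / n) = B - A - C"
    by (simp add: A_def B_def C_def algebra_simps)
  then have "\<bar>p * (a - U) + p * U * ((1 + b) / n) - r * (U / n)\<bar> \<le> 3 * b + 1"
    using A B B0 C b0 by simp
  moreover define \<Delta> where "\<Delta> = \<bar>p * a / S - (p * a / S + (p * f + r) / S) * (U / n)\<bar>"
  ultimately have "S * \<Delta> \<le> 3 * b + 1"
    using eq assms by (metis abs_mult abs_of_pos)
  moreover have "n / 2 * \<Delta> \<le> S * \<Delta>"
    using True by (intro mult_right_mono) (auto simp: \<Delta>_def)
  ultimately have "\<Delta> * n \<le> 6 * (b + 1)" using b0 by (simp add: mult.commute)
  then show ?thesis unfolding \<Delta>_def[symmetric] using assms by (simp add: pos_le_divide_eq)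
next
  case False
  have pa: "p * a \<le> a" "p * f \<le> f" using assms by (auto intro: mult_left_le_one_le)
  have 1: "0 \<le> p * a / S" "p * a / S \<le> 1" "0 \<le> (p * a + p * f + r) / S" "(p * a + p * f + r) / S \<le> 1"
    using assms pa by (auto simp: divide_le_eq)
  have Un: "0 \<le> U / n" "U / n \<le> 1" using assms by auto
  have "0 \<le> (p * a + p * f + r) / S * (U / n)" "(p * a + p * f + r) / S * (U / n) \<le> 1"
    by (rule mult_nonneg_nonneg[OF 1(3) Un(1)], rule mult_le_one[OF 1(4) Un])
  then have "\<bar>p * a / S - (p * a + p * f + r) / S * (U / n)\<bar> \<le> 1" using 1 by (auto simp: abs_le_iff)
  moreover have "1 \<le> 6 * (b + 1) / n" using False S b assms by (simp add: field_simps)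
  moreover have "p * a / S + (p * f + r) / S = (p * a + p * f + r) / S" by (simp add: add_divide_distrib)
  ultimately show ?thesis by simp
qed

definition revealed_at :: "nat set set \<Rightarrow> nat \<Rightarrow> nat" where
  "revealed_at R j = card {e \<in> R. j \<in> e}"

lemma revealed_at_insert:
  assumes "finite R" "e \<notin> R"
  shows "revealed_at (insert e R) j = (if j \<in> e then Suc (revealed_at R j) else revealed_at R j)"
proof -
  have "{e' \<in> insert e R. j \<in> e'} = (if j \<in> e then insert e {e \<in> R. j \<in> e} else {e \<in> R. j \<in> e})"
    by auto
  then show ?thesis using assms by (auto simp: revealed_at_def)
qed

lemma revealed_at_le: "finite R \<Longrightarrow> revealed_at R j \<le> card R"
  unfolding revealed_at_def by (rule card_mono) auto

lemma weighted_divide_le: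
  fixes n :: real
  assumes "p * x + (1 - p) * y + c * d \<le> z" "0 \<le> n"
  shows "p * (x / n) + (1 - p) * (y / n) + c / n * d \<le> z / n"
  using divide_right_mono[OF assms] by (simp add: add_divide_distrib)

locale spreading =
  fixes p :: real and K :: "nat pmf"
  assumes p: "0 < p" "p \<le> 1" and K2: "integrable (measure_pmf K) (\<lambda>k. (real k)\<^sup>2)"
begin

definition m :: real where "m = measure_pmf.expectation K real"
definition m2 :: real where "m2 = measure_pmf.expectation K (\<lambda>k. (real k)\<^sup>2)"

lemma K1: "integrable (measure_pmf K) real"
  by (rule measure_pmf.square_integrable_imp_integrable) (use K2 in auto)

lemma m_nonneg: "0 \<le> m" unfolding m_def by simp

lemma m2_ge: "m\<^sup>2 \<le> m2"
proof -
  have "measure_pmf.variance K real = m2 - m\<^sup>2"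
    unfolding m_def m2_def using K1 K2 by (rule measure_pmf.variance_eq)
  moreover have "0 \<le> measure_pmf.variance K real" by (rule measure_pmf.variance_positive)
  ultimately show ?thesis by simp
qed

text \<open>The potential must dominate the expected number of attempts that are not matched with the ideal
  process. A draw of an emitter with \<open>b\<close> revealed edges is not matched with probability at most
  \<open>6 (b + 1) / n\<close>; it adds one revealed edge at the emitter and one at its candidate, and it uses up the
  attempt with probability \<open>p\<close> if the edge was unrevealed. The quadratic form \<open>ecost\<close> solves the
  resulting recursion exactly (\<open>ecost_attempt\<close>), which determines the three constants. Its
  first argument is the number of further bursts whose resources are still to be averaged over.\<close>

definition cx :: real where "cx = 6 / p"
definition cy :: real where "cy = 3 / p\<^sup>2"
definition cz :: real where "cz = cy + cx * m / p"

definition ecost :: "nat \<Rightarrow> real \<Rightarrow> real \<Rightarrow> real" where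
  "ecost d b u = cx * (u + d * m) * b + cy * ((u + d * m)\<^sup>2 + d * (m2 - m\<^sup>2)) + cz * (u + d * m)"

lemma cost_constants: "6 \<le> cx" "3 \<le> cy" "cy \<le> cz"
proof -
  show "6 \<le> cx" using p by (simp add: cx_def field_simps)
  have "p\<^sup>2 \<le> 1" using p by (simp add: power_le_one)
  then show "3 \<le> cy" using p by (simp add: cy_def field_simps)
  show "cy \<le> cz" using p m_nonneg by (simp add: cz_def cx_def)
qed

lemma ecost_nonneg: "0 \<le> b \<Longrightarrow> 0 \<le> u \<Longrightarrow> 0 \<le> ecost d b u"
  unfolding ecost_def using cost_constants m_nonneg m2_ge by auto

lemma ecost_0_0 [simp]: "ecost 0 b 0 = 0"
  by (simp add: ecost_def)

lemma ecost_attempt: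
  "p * ecost d (b + 1) u + (1 - p) * ecost d (b + 1) (u + 1) + 6 * (b + 1) + cx * m = ecost d b (u + 1)"
proof -
  define v where "v = u + d * m"
  have e: "ecost d b' u = cx * v * b' + cy * (v\<^sup>2 + d * (m2 - m\<^sup>2)) + cz * v"
    "ecost d b' (u + 1) = cx * (v + 1) * b' + cy * ((v + 1)\<^sup>2 + d * (m2 - m\<^sup>2)) + cz * (v + 1)" for b'
    by (simp_all add: ecost_def v_def algebra_simps)
  have px: "p * cx = 6" and py: "2 * (p * cy) = cx" and pz: "p * cz = p * cy + cx * m"
    using p by (auto simp: cx_def cy_def cz_def power2_eq_square field_simps)
  have "ecost d b (u + 1) - (p * ecost d (b + 1) u + (1 - p) * ecost d (b + 1) (u + 1)) =
     (2 * (p * cy) - cx) * (v + 1) + (p * cx) * (b + 1) - p * cy + p * cz"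
    unfolding e by (simp add: algebra_simps power2_eq_square)
  also have "\<dots> = 6 * (b + 1) + cx * m" unfolding px py pz by simp
  finally show ?thesis by simp
qed

lemma ecost_waste:
  assumes "0 \<le> b" "0 \<le> u"
  shows "ecost d b u + 6 * (b + 1) \<le> ecost d b (u + 1)"
proof -
  define v where "v = u + d * m"
  have v: "0 \<le> v" using assms m_nonneg by (simp add: v_def)
  have "ecost d b (u + 1) - ecost d b u = cx * b + cy * (2 * v + 1) + cz"
    by (simp add: ecost_def v_def algebra_simps power2_eq_square)
  moreover have "6 * b \<le> cx * b" using cost_constants assms by (intro mult_right_mono) auto
  moreover have "3 * 1 \<le> cy * (2 * v + 1)" using cost_constants v by (intro mult_mono) auto
  ultimately show ?thesis using cost_constants by simp
qed

lemma integrable_ecost: "integrable (measure_pmf K) (\<lambda>k. ecost d b (real k))"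
  unfolding ecost_def using K1 K2 by (simp add: power2_sum algebra_simps)

lemma expectation_ecost: "measure_pmf.expectation K (\<lambda>k. ecost d b (real k)) = ecost (Suc d) b 0"
proof -
  have "ecost d b (real k) = cy * (real k)\<^sup>2 + (cx * b + cz + 2 * cy * (d * m)) * real k + ecost d b 0" for k
    by (simp add: ecost_def algebra_simps power2_sum power2_eq_square)
  then have "measure_pmf.expectation K (\<lambda>k. ecost d b (real k)) =
    cy * m2 + (cx * b + cz + 2 * cy * (d * m)) * m + ecost d b 0"
    using K1 K2 by (simp add: m_def m2_def)
  also have "\<dots> = ecost (Suc d) b 0"
    by (simp add: ecost_def algebra_simps power2_eq_square)
  finally show ?thesis .
qed

text \<open>The first two terms account for the rest of the transmission: the current emitter with its \<open>k\<close>
  remaining attempts, and every server that has not emitted yet. The last one accounts with weight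
  \<open>f\<close> for the first \<open>L\<close> bursts only. It ignores where the revealed edges are and thus
  involves their total number, which is small during these bursts.\<close>

definition potential :: "nat \<Rightarrow> nat \<Rightarrow> nat \<Rightarrow> nat \<Rightarrow> nat \<Rightarrow> nat \<Rightarrow> nat set set \<Rightarrow> nat set \<Rightarrow> real" where
  "potential n L f s k i R X =
     (ecost 0 (revealed_at R i) k + (\<Sum>j\<in>{1..n} - X. ecost 1 (revealed_at R j) 0)
      + (if s \<le> L then f * ecost (L - s) (card R) k else 0)) / n"

lemma potential_nonneg: "0 \<le> potential n L f s k i R X"
  unfolding potential_def using ecost_nonneg
  by (intro divide_nonneg_nonneg add_nonneg_nonneg sum_nonneg) auto

text \<open>The two sides differ by the probability that a draw is not matched, weighted by \<open>f\<close> in the first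
  \<open>L\<close> bursts.\<close>

lemma potential_attempt:
  assumes "i \<in> X" "{i, j} \<notin> R" "i \<noteq> j" "finite R" "1 \<le> f"
  shows "p * potential n L f s k i (insert {i, j} R) X + (1 - p) * potential n L f s (Suc k) i (insert {i, j} R) X
    + 6 * (real (revealed_at R i) + 1) / n * (if s \<le> L then real f else 1) \<le> potential n L f s (Suc k) i R X"
proof -
  let ?b = "real (revealed_at R i)" and ?q = "real (card R)"
  let ?R' = "insert {i, j} R"
  let ?A = "\<lambda>R. \<Sum>l\<in>{1..n} - X. ecost 1 (revealed_at R l) 0"
  let ?early = "\<lambda>q k. if s \<le> L then f * ecost (L - s) q k else 0"
  have b': "real (revealed_at ?R' i) = ?b + 1" "real (card ?R') = ?q + 1"
    using assms by (auto simp: revealed_at_insert)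
  have "?A ?R' \<le> (\<Sum>l\<in>{1..n} - X. ecost 1 (revealed_at R l) 0 + (if l = j then cx * m else 0))"
  proof (rule sum_mono)
    fix l assume "l \<in> {1..n} - X"
    then have "l \<noteq> i" using assms by auto
    then show "ecost 1 (revealed_at ?R' l) 0 \<le> ecost 1 (revealed_at R l) 0 + (if l = j then cx * m else 0)"
      using assms by (auto simp: revealed_at_insert ecost_def algebra_simps)
  qed
  also have "\<dots> \<le> ?A R + cx * m"
    using cost_constants m_nonneg by (auto simp: sum.distrib)
  finally have A: "?A ?R' \<le> ?A R + cx * m" .
  have late: "p * ecost 0 (?b + 1) k + (1 - p) * ecost 0 (?b + 1) (Suc k) + 6 * (?b + 1) + cx * m = ecost 0 ?b (Suc k)"
    using ecost_attempt[of 0 ?b "real k"] by (simp add: add.commute)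
  have early: "p * ?early (?q + 1) k + (1 - p) * ?early (?q + 1) (Suc k)
      + 6 * (?b + 1) * (if s \<le> L then real f else 0) \<le> ?early ?q (Suc k)"
  proof (cases "s \<le> L")
    case True
    have "p * ecost (L - s) (?q + 1) k + (1 - p) * ecost (L - s) (?q + 1) (Suc k) + 6 * (?q + 1) + cx * m = ecost (L - s) ?q (Suc k)"
      using ecost_attempt[of "L - s" ?q "real k"] by (simp add: add.commute)
    moreover have "?b \<le> ?q" using revealed_at_le[OF assms(4)] by simp
    moreover have "0 \<le> cx * m" using cost_constants m_nonneg by simp
    ultimately have "p * ecost (L - s) (?q + 1) k + (1 - p) * ecost (L - s) (?q + 1) (Suc k) + 6 * (?b + 1) \<le> ecost (L - s) ?q (Suc k)"
      by simp
    from mult_left_mono[OF this, of "real f"] True show ?thesis by (simp add: algebra_simps)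
  qed simp
  have "p * (ecost 0 (?b + 1) k + ?A ?R' + ?early (?q + 1) k)
      + (1 - p) * (ecost 0 (?b + 1) (Suc k) + ?A ?R' + ?early (?q + 1) (Suc k))
      + 6 * (?b + 1) * (if s \<le> L then real f else 1)
      \<le> ecost 0 ?b (Suc k) + ?A R + ?early ?q (Suc k)" (is "?lhs \<le> ?rhs")
  proof -
    have "?lhs = (p * ecost 0 (?b + 1) k + (1 - p) * ecost 0 (?b + 1) (Suc k)) + ?A ?R' +
      (p * ?early (?q + 1) k + (1 - p) * ?early (?q + 1) (Suc k)) + 6 * (?b + 1) * (if s \<le> L then real f else 1)"
      by (simp add: algebra_simps)
    also have "\<dots> \<le> ?rhs" using late A early by (cases "s \<le> L") auto
    finally show ?thesis .
  qed
  then show ?thesis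
    unfolding potential_def b' by (intro weighted_divide_le) auto
qed

lemma potential_waste:
  assumes "finite R" "1 \<le> f"
  shows "potential n L f s k i R X + 6 * (real (revealed_at R i) + 1) / n * (if s \<le> L then real f else 1)
    \<le> potential n L f s (Suc k) i R X"
proof -
  let ?b = "real (revealed_at R i)" and ?q = "real (card R)"
  let ?A = "\<Sum>l\<in>{1..n} - X. ecost 1 (revealed_at R l) 0"
  let ?early = "\<lambda>k. if s \<le> L then f * ecost (L - s) ?q k else 0"
  have late: "ecost 0 ?b k + 6 * (?b + 1) \<le> ecost 0 ?b (Suc k)"
    using ecost_waste[of ?b "real k" 0] by (simp add: add.commute)
  have early: "?early k + 6 * (?b + 1) * (if s \<le> L then real f else 0) \<le> ?early (Suc k)"
  proof (cases "s \<le> L")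
    case True
    have "ecost (L - s) ?q k + 6 * (?q + 1) \<le> ecost (L - s) ?q (Suc k)"
      using ecost_waste[of ?q "real k" "L - s"] by (simp add: add.commute)
    moreover have "?b \<le> ?q" using revealed_at_le[OF assms(1)] by simp
    ultimately have "ecost (L - s) ?q k + 6 * (?b + 1) \<le> ecost (L - s) ?q (Suc k)" by simp
    from mult_left_mono[OF this, of "real f"] True show ?thesis by (simp add: algebra_simps)
  qed simp
  have "ecost 0 ?b k + ?A + ?early k + 6 * (?b + 1) * (if s \<le> L then real f else 1)
      \<le> ecost 0 ?b (Suc k) + ?A + ?early (Suc k)"
    using late early by (cases "s \<le> L") auto
  then show ?thesis
    unfolding potential_def using weighted_divide_le[of 1 _ 0] by simp
qed

lemma potential_next_emitter:
  assumes "i' \<in> {1..n} - X"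
  shows "integrable (measure_pmf K) (\<lambda>k. potential n L f (Suc s) k i' R (insert i' X))"
    and "measure_pmf.expectation K (\<lambda>k. potential n L f (Suc s) k i' R (insert i' X)) \<le> potential n L f s 0 i R X"
proof -
  let ?q = "real (card R)"
  let ?A = "\<lambda>X. \<Sum>l\<in>{1..n} - X. ecost 1 (revealed_at R l) 0"
  have A: "?A X = ecost 1 (revealed_at R i') 0 + ?A (insert i' X)"
  proof -
    have "{1..n} - insert i' X = ({1..n} - X) - {i'}" by blast
    then show ?thesis using assms sum.remove[of "{1..n} - X" i' "\<lambda>l. ecost 1 (revealed_at R l) 0"] by simp
  qed
  have int: "integrable (measure_pmf K) (\<lambda>k. if Suc s \<le> L then f * ecost (L - Suc s) ?q (real k) else 0)"
    by (cases "Suc s \<le> L") (simp_all add: integrable_ecost)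
  show "integrable (measure_pmf K) (\<lambda>k. potential n L f (Suc s) k i' R (insert i' X))"
    unfolding potential_def using integrable_ecost int by simp
  have early: "measure_pmf.expectation K (\<lambda>k. if Suc s \<le> L then f * ecost (L - Suc s) ?q (real k) else 0)
     \<le> (if s \<le> L then f * ecost (L - s) ?q 0 else 0)"
  proof (cases "Suc s \<le> L")
    case True
    then show ?thesis by (simp add: expectation_ecost Suc_diff_Suc)
  next
    case False
    then show ?thesis using ecost_nonneg[of ?q 0 "L - s"] by simp
  qed
  have "measure_pmf.expectation K (\<lambda>k. potential n L f (Suc s) k i' R (insert i' X)) =
    (ecost 1 (revealed_at R i') 0 + ?A (insert i' X) +
      measure_pmf.expectation K (\<lambda>k. if Suc s \<le> L then f * ecost (L - Suc s) ?q (real k) else 0)) / n"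
    unfolding potential_def using integrable_ecost int expectation_ecost[of 0] by simp
  also have "\<dots> \<le> potential n L f s 0 i R X"
    unfolding potential_def A using early by (intro divide_right_mono) auto
  finally show "measure_pmf.expectation K (\<lambda>k. potential n L f (Suc s) k i' R (insert i' X)) \<le> potential n L f s 0 i R X" .
qed

end

lemma revealed_at_eq_card_neighbours:
  assumes "R \<subseteq> all_edges n"
  shows "revealed_at R i = card {j. {i, j} \<in> R}"
proof -
  have "{e \<in> R. i \<in> e} = (\<lambda>j. {i, j}) ` {j. {i, j} \<in> R}"
  proof
    show "{e \<in> R. i \<in> e} \<subseteq> (\<lambda>j. {i, j}) ` {j. {i, j} \<in> R}"
    proof
      fix e assume e: "e \<in> {e \<in> R. i \<in> e}"
      then have "card e = 2" using assms by (auto simp: all_edges_def)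
      then obtain a b where "e = {a, b}" by (auto simp: card_2_iff)
      then have "e = {i, a} \<or> e = {i, b}" using e by auto
      then show "e \<in> (\<lambda>j. {i, j}) ` {j. {i, j} \<in> R}" using e by auto
    qed
  qed auto
  moreover have "inj_on (\<lambda>j. {i, j}) {j. {i, j} \<in> R}" by (auto simp: inj_on_def doubleton_eq_iff)
  ultimately show ?thesis by (simp add: revealed_at_def card_image)
qed

context spreading
begin

text \<open>Here \<open>g\<close> bounds the gap between the actual and the ideal number of informed servers, and the error
  increases by \<open>1 / f\<close> whenever the gap does. During the first \<open>L\<close> bursts no positive gap below
  \<open>f\<close> is allowed: a single unmatched attempt there raises the error to at least \<open>1\<close>.\<close>

lemma comparison_attempt:
  fixes h :: "nat \<Rightarrow> real" and \<phi> :: "nat \<Rightarrow> real" and f L g c n M k i :: nat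
    and X :: "nat set" and cc :: "nat \<Rightarrow> nat"
  defines "\<E> \<equiv> \<lambda>k P Q I. measure_pmf.expectation (annealed n p K M i k P Q cc X I) h"
  assumes h: "\<And>s. 0 \<le> h s" "\<And>s. h s \<le> 1" and f: "1 \<le> f"
    and PQ: "P \<subseteq> all_edges n" "Q \<subseteq> all_edges n" "P \<inter> Q = {}"
    and XI: "i \<in> X" "X \<subseteq> I" "I \<subseteq> {1..n}" and PI: "\<And>e. e \<in> P \<Longrightarrow> e \<subseteq> I"
    and gap: "card I \<le> c + g" "c \<le> card I + g" "s \<le> L \<Longrightarrow> g = 0 \<or> f \<le> g"
    and IH_hit: "\<And>P' j c' g'. \<lbrakk>j \<in> {1..n}; P' \<subseteq> all_edges n; P' \<inter> Q = {}; \<And>e. e \<in> P' \<Longrightarrow> e \<subseteq> insert j I;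
       card (insert j I) \<le> c' + g'; c' \<le> card (insert j I) + g'; s \<le> L \<Longrightarrow> g' = 0 \<or> f \<le> g'\<rbrakk> \<Longrightarrow>
       \<E> k P' Q (insert j I) \<le> attempts n k \<phi> c' + (g' + potential n L f s k i (P' \<union> Q) X) / f"
    and IH_stay: "\<And>j. \<lbrakk>{i, j} \<in> all_edges n; {i, j} \<notin> P; {i, j} \<notin> Q\<rbrakk> \<Longrightarrow>
       \<E> (Suc k) P (insert {i, j} Q) I
        \<le> attempts n (Suc k) \<phi> c + (g + potential n L f s (Suc k) i (P \<union> insert {i, j} Q) X) / f"
  shows "\<E> (Suc k) P Q I \<le> attempts n (Suc k) \<phi> c + (g + potential n L f s (Suc k) i (P \<union> Q) X) / f"
proof -
  define x where "x = attempts n k \<phi> (Suc c)"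
  define y where "y = attempts n k \<phi> c"
  define C where "C = card I"
  define V where "V = hit n c * x + (1 - hit n c) * y"
  define \<omega> :: nat where "\<omega> = (if s \<le> L then f else 1)"
  define W where "W = real \<omega> / f"
  have W0: "0 \<le> W" by (simp add: W_def)
  define bs where "bs = (if C < c then min x y else min x (y + W))"
  define bf where "bf = (if c < C then min x y else min y (x + W))"
  define R where "R = P \<union> Q"
  define b where "b = revealed_at R i"
  define pot where "pot k R = potential n L f s k i R X" for k R
  define \<delta> where "\<delta> = 6 * (real b + 1) / n * \<omega>"
  define A where "A = (g + pot (Suc k) R - \<delta>) / f"
  have f0: "0 < real f" using f by simp
  have V: "attempts n (Suc k) \<phi> c = V" by (simp add: V_def x_def y_def)
  have fI: "finite I" using XI finite_subset by blast
  have i: "i \<in> I" "i \<in> {1..n}" using XI by auto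
  then have n0: "0 < n" by auto
  have R: "R \<subseteq> all_edges n" using PQ by (auto simp: R_def)
  note R = R finite_subset[OF R finite_all_edges]
  have \<omega>R: "(if s \<le> L then real f else 1) = \<omega>" by (simp add: \<omega>_def)
  have \<omega>1: "1 \<le> \<omega>" "s \<le> L \<Longrightarrow> f \<le> g + \<omega>" using f by (auto simp: \<omega>_def)
  have \<omega>f: "(real (g + \<omega>) + z) / f = W + (g + z) / f" for z :: real
    by (simp add: W_def add_divide_distrib)
  \<comment> \<open>a success is bounded by the value \<open>x\<close> after an ideal success, or at the price of a larger gap by the
    value \<open>y\<close> after an ideal failure\<close>
  have hit_success: "\<E> k P' Q (insert j I) \<le> bs + (g + pot k (P' \<union> Q)) / f"
    if "j \<in> {1..n}" "j \<notin> I" "P' \<subseteq> all_edges n" "P' \<inter> Q = {}" "\<And>e. e \<in> P' \<Longrightarrow> e \<subseteq> insert j I" for j P'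
  proof -
    have C': "card (insert j I) = Suc C" using that fI by (simp add: C_def)
    note IH = IH_hit[OF that(1,3,4,5), unfolded C']
    have "\<E> k P' Q (insert j I) \<le> x + (g + pot k (P' \<union> Q)) / f"
      unfolding x_def pot_def using gap by (intro IH) (auto simp: C_def)
    moreover have "\<E> k P' Q (insert j I) \<le> y + (real (g + \<omega>) + pot k (P' \<union> Q)) / f"
      unfolding y_def pot_def using gap \<omega>1 by (intro IH) (auto simp: C_def)
    moreover have "\<E> k P' Q (insert j I) \<le> y + (g + pot k (P' \<union> Q)) / f" if "C < c"
      unfolding y_def pot_def using gap that by (intro IH) (auto simp: C_def)
    ultimately show ?thesis using \<omega>f[of "pot k (P' \<union> Q)"] unfolding bs_def by auto
  qed
  have hit_failure: "\<E> k P' Q (insert j I) \<le> bf + (g + pot k (P' \<union> Q)) / f"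
    if "j \<in> I" "P' \<subseteq> all_edges n" "P' \<inter> Q = {}" "\<And>e. e \<in> P' \<Longrightarrow> e \<subseteq> insert j I" for j P'
  proof -
    have j: "j \<in> {1..n}" using that XI by auto
    have C': "card (insert j I) = C" using that fI by (simp add: C_def insert_absorb)
    note IH = IH_hit[OF j that(2,3,4), unfolded C']
    have "\<E> k P' Q (insert j I) \<le> y + (g + pot k (P' \<union> Q)) / f"
      unfolding y_def pot_def using gap by (intro IH) (auto simp: C_def)
    moreover have "\<E> k P' Q (insert j I) \<le> x + (real (g + \<omega>) + pot k (P' \<union> Q)) / f"
      unfolding x_def pot_def using gap \<omega>1 by (intro IH) (auto simp: C_def)
    moreover have "\<E> k P' Q (insert j I) \<le> x + (g + pot k (P' \<union> Q)) / f" if "c < C"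
      unfolding x_def pot_def using gap that by (intro IH) (auto simp: C_def)
    ultimately show ?thesis using \<omega>f[of "pot k (P' \<union> Q)"] unfolding bf_def by auto
  qed
  \<comment> \<open>\<open>A\<close> is what remains of the error after paying for one possibly unmatched draw\<close>
  have waste: "(g + pot k R) / f \<le> A"
  proof -
    have "pot k R + \<delta> \<le> pot (Suc k) R"
      using potential_waste[OF R(2) f, where n=n and L=L and s=s and k=k and i=i and X=X]
      unfolding pot_def \<delta>_def b_def \<omega>R .
    then show ?thesis unfolding A_def using f0 by (intro divide_right_mono) auto
  qed
  have hit_less: "C < c \<Longrightarrow> hit n c \<le> hit n C" "c < C \<Longrightarrow> hit n C \<le> hit n c" "C = c \<Longrightarrow> hit n C = hit n c"
    by (auto intro: hit_antimono)
  have coupled: "\<sigma>s * bs + \<sigma>f * bf \<le> (\<sigma>s + \<sigma>f) * V + \<bar>\<sigma>s - (\<sigma>s + \<sigma>f) * hit n C\<bar> * W"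
    if "0 \<le> \<sigma>s" "0 \<le> \<sigma>f" for \<sigma>s \<sigma>f
    unfolding bs_def bf_def V_def
    using coupled_attempt[of \<sigma>s \<sigma>f W "hit n c" C c "hit n C" x y] that hit_bounds hit_less W0 by auto
  define S where "S = {j \<in> {1..n}. j \<noteq> i \<and> {i, j} \<notin> Q}"
  have fS: "finite S" by (simp add: S_def)
  have main: "\<E> (Suc k) P Q I \<le> V + (g + pot (Suc k) R) / f"
  proof (cases "S = {}")
    case True
    have "\<E> (Suc k) P Q I = \<E> k P Q (insert i I)"
      unfolding \<E>_def using annealed_attempt_wasted[OF PQ(1,3) i(1)] True i
      by (simp add: S_def insert_absorb)
    also have "\<dots> \<le> bf + (g + pot k R) / f"
      unfolding R_def using hit_failure[OF i(1) PQ(1,3)] PI by blast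
    also have "bf \<le> V + 1 * W"
    proof -
      have "bf \<le> V + \<bar>hit n C\<bar> * W" using coupled[of 0 1] by simp
      also have "\<bar>hit n C\<bar> * W \<le> 1 * W"
        using hit_bounds[of n C] W0 by (intro mult_right_mono) auto
      finally show ?thesis by simp
    qed
    also have "1 * W \<le> \<delta> / f"
    proof -
      have "{1..n} - {i} \<subseteq> {j. {i, j} \<in> R}" using True by (auto simp: S_def R_def)
      moreover have "{j. {i, j} \<in> R} \<subseteq> {1..n}" using R(1) edge_in_all_edges by blast
      ultimately have "n - 1 \<le> b"
        unfolding b_def revealed_at_eq_card_neighbours[OF R(1)]
        using i card_mono[of "{j. {i, j} \<in> R}" "{1..n} - {i}"] finite_subset[of "{j. {i, j} \<in> R}" "{1..n}"] by simp
      then have "1 \<le> 6 * (real b + 1) / n" using n0 by (simp add: field_simps)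
      then have "1 * real \<omega> \<le> \<delta>" unfolding \<delta>_def by (intro mult_right_mono) auto
      then show ?thesis using f0 by (simp add: W_def divide_right_mono)
    qed
    finally have "\<E> (Suc k) P Q I \<le> V + \<delta> / f + (g + pot k R) / f" by simp
    also have "\<dots> \<le> V + \<delta> / f + A" using waste by simp
    also have "\<dots> = V + (g + pot (Suc k) R) / f" by (simp add: A_def diff_divide_distrib add_divide_distrib)
    finally show ?thesis .
  next
    case False
    define Fs where "Fs = {j \<in> S. {i, j} \<notin> P \<and> j \<notin> I}"
    define Ff where "Ff = {j \<in> S. {i, j} \<notin> P \<and> j \<in> I}"
    define Pr where "Pr = {j \<in> S. {i, j} \<in> P}"
    have fin: "finite Fs" "finite Ff" "finite Pr" using fS by (auto simp: Fs_def Ff_def Pr_def)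
    define T where "T j = (if {i, j} \<in> P then \<E> k P Q (insert j I)
        else p * \<E> k (insert {i, j} P) Q (insert j I) + (1 - p) * \<E> (Suc k) P (insert {i, j} Q) I)" for j
    have h1: "\<bar>h z\<bar> \<le> 1" for z using h[of z] by (simp add: abs_le_iff)
    have "\<E> (Suc k) P Q I = measure_pmf.expectation (pmf_of_set S) T"
      unfolding \<E>_def annealed_attempt[OF PQ(1,3) i(2) S_def False]
      using p
      by (subst expectation_bind_pmf[OF h1])
         (auto simp: T_def \<E>_def expectation_bind_pmf[OF h1] if_distrib if_distribR intro!: Bochner_Integration.integral_cong)
    also have "\<dots> = sum T S / card S"
      using False fS by (simp add: integral_pmf_of_set)
    finally have ET: "\<E> (Suc k) P Q I = sum T S / card S" .
    have T_present: "T j \<le> bf + A" if "j \<in> Pr" for j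
    proof -
      have j: "{i, j} \<in> P" "j \<in> I" using that PI by (auto simp: Pr_def)
      have "T j \<le> bf + (g + pot k R) / f"
        using hit_failure[OF j(2) PQ(1,3)] PI j unfolding T_def R_def by auto
      then show ?thesis using waste by simp
    qed
    \<comment> \<open>the edge to the candidate is unrevealed: it is accepted with probability \<open>p\<close>\<close>
    have T_fresh: "T j \<le> p * \<beta> + (1 - p) * V + A"
      if j: "j \<in> S" "{i, j} \<notin> P" and \<beta>: "\<E> k (insert {i, j} P) Q (insert j I) \<le> \<beta> + (g + pot k (insert {i, j} P \<union> Q)) / f" for j \<beta>
    proof -
      let ?e = "{i, j}"
      have e: "?e \<in> all_edges n" "?e \<notin> Q" "i \<noteq> j" using j i by (auto simp: S_def edge_in_all_edges)
      have ins: "insert ?e P \<union> Q = insert ?e R" "P \<union> insert ?e Q = insert ?e R" by (auto simp: R_def)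
      have "T j \<le> p * (\<beta> + (g + pot k (insert ?e R)) / f) + (1 - p) * (V + (g + pot (Suc k) (insert ?e R)) / f)"
        using j p \<beta> IH_stay[OF e(1) j(2) e(2)] unfolding T_def V ins pot_def
        by (auto intro!: add_mono mult_left_mono)
      also have "\<dots> = p * \<beta> + (1 - p) * V + (g + (p * pot k (insert ?e R) + (1 - p) * pot (Suc k) (insert ?e R))) / f"
        using f0 by (simp add: field_simps)
      also have "\<dots> \<le> p * \<beta> + (1 - p) * V + A"
      proof -
        have "p * pot k (insert ?e R) + (1 - p) * pot (Suc k) (insert ?e R) + \<delta> \<le> pot (Suc k) R"
          unfolding pot_def \<delta>_def b_def \<omega>R[symmetric]
          using j e XI by (intro potential_attempt R f) (auto simp: R_def)
        then show ?thesis unfolding A_def using f0 by (intro add_left_mono divide_right_mono) auto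
      qed
      finally show ?thesis .
    qed
    have T_s: "T j \<le> p * bs + (1 - p) * V + A" if "j \<in> Fs" for j
    proof -
      have j: "j \<in> S" "{i, j} \<notin> P" "j \<notin> I" "j \<in> {1..n}" "{i, j} \<in> all_edges n" "{i, j} \<notin> Q"
        using that i by (auto simp: Fs_def S_def edge_in_all_edges)
      have "e \<subseteq> insert j I" if "e \<in> insert {i, j} P" for e using that PI[of e] i by auto
      then have "\<E> k (insert {i, j} P) Q (insert j I) \<le> bs + (g + pot k (insert {i, j} P \<union> Q)) / f"
        using j PQ by (intro hit_success) auto
      then show ?thesis using T_fresh j by blast
    qed
    have T_f: "T j \<le> p * bf + (1 - p) * V + A" if "j \<in> Ff" for j
    proof -
      have j: "j \<in> S" "{i, j} \<notin> P" "j \<in> I" "j \<in> {1..n}" "{i, j} \<in> all_edges n" "{i, j} \<notin> Q"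
        using that i by (auto simp: Ff_def S_def edge_in_all_edges)
      have "e \<subseteq> insert j I" if "e \<in> insert {i, j} P" for e using that PI[of e] i j by auto
      then have "\<E> k (insert {i, j} P) Q (insert j I) \<le> bf + (g + pot k (insert {i, j} P \<union> Q)) / f"
        using j PQ by (intro hit_failure) auto
      then show ?thesis using T_fresh j by blast
    qed
    define a f' r where "a = real (card Fs)" and "f' = real (card Ff)" and "r = real (card Pr)"
    have S3: "S = Fs \<union> (Ff \<union> Pr)" by (auto simp: Fs_def Ff_def Pr_def)
    have disj: "Fs \<inter> (Ff \<union> Pr) = {}" "Ff \<inter> Pr = {}" by (auto simp: Fs_def Ff_def Pr_def)
    have cS: "real (card S) = a + f' + r"
      unfolding S3 a_def f'_def r_def using fin disj by (simp add: card_Un_disjoint)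
    have S0: "0 < real (card S)" using False fS by (simp add: card_gt_0_iff)
    have "sum T S = sum T Fs + (sum T Ff + sum T Pr)"
      unfolding S3 using fin disj by (simp add: sum.union_disjoint)
    also have "\<dots> \<le> a * (p * bs + (1 - p) * V + A) + (f' * (p * bf + (1 - p) * V + A) + r * (bf + A))"
      unfolding a_def f'_def r_def using T_s T_f T_present
      by (intro add_mono sum_bounded_above) auto
    also have "\<dots> = (p * a) * bs + (p * f' + r) * bf + (card S - (p * a + (p * f' + r))) * V + card S * A"
      unfolding cS by (simp add: algebra_simps)
    finally have "sum T S / card S \<le>
      ((p * a) * bs + (p * f' + r) * bf + (card S - (p * a + (p * f' + r))) * V + card S * A) / card S"
      using S0 by (intro divide_right_mono) auto
    also have "\<dots> = (p * a / card S) * bs + ((p * f' + r) / card S) * bf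
       + (1 - (p * a / card S + (p * f' + r) / card S)) * V + A"
      using S0 by (simp add: field_simps)
    finally have avg: "\<E> (Suc k) P Q I \<le> (p * a / card S) * bs + ((p * f' + r) / card S) * bf
       + (1 - (p * a / card S + (p * f' + r) / card S)) * V + A"
      unfolding ET .
    have "(p * a / card S) * bs + ((p * f' + r) / card S) * bf \<le>
       (p * a / card S + (p * f' + r) / card S) * V
       + \<bar>p * a / card S - (p * a / card S + (p * f' + r) / card S) * hit n C\<bar> * W"
      using p by (intro coupled) (auto simp: a_def f'_def r_def)
    also have "\<bar>p * a / card S - (p * a / card S + (p * f' + r) / card S) * hit n C\<bar> \<le> 6 * (real b + 1) / n"
    proof -
      define N where "N = {j. {i, j} \<in> R}"
      have N: "N \<subseteq> {1..n} - {i}" using R(1) edge_in_all_edges by (auto simp: N_def)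
      then have fN: "finite N" using finite_subset by blast
      have bN: "b = card N" unfolding b_def N_def by (rule revealed_at_eq_card_neighbours[OF R(1)])
      have part: "{1..n} = insert i ((Fs \<union> Ff) \<union> N)"
        using i N by (auto simp: Fs_def Ff_def S_def N_def R_def)
      have "card {1..n} = Suc (card ((Fs \<union> Ff) \<union> N))"
        by (subst part, rule card_insert_disjoint) (use fin fN N in \<open>auto simp: Fs_def Ff_def S_def\<close>)
      also have "card ((Fs \<union> Ff) \<union> N) = card (Fs \<union> Ff) + card N"
        using fin fN by (intro card_Un_disjoint) (auto simp: Fs_def Ff_def S_def N_def R_def)
      also have "card (Fs \<union> Ff) = card Fs + card Ff"
        using fin by (intro card_Un_disjoint) (auto simp: Fs_def Ff_def)
      finally have cn: "n = Suc (card Fs + card Ff + b)" by (simp add: bN)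
      have "r \<le> b" unfolding r_def bN using fN
        by (simp add: card_mono Pr_def N_def R_def Collect_mono)
      moreover have CI: "C \<le> n" using card_mono[OF _ XI(3)] by (simp add: C_def)
      moreover have cU: "card ({1..n} - I) = n - C" using XI fI by (simp add: C_def card_Diff_subset)
      moreover have "card Fs \<le> n - C"
        unfolding cU[symmetric] by (rule card_mono) (auto simp: Fs_def S_def)
      moreover have "n - C \<le> card Fs + b"
      proof -
        have "{1..n} - I \<subseteq> Fs \<union> N" using i part by (auto simp: Ff_def)
        then have "card ({1..n} - I) \<le> card (Fs \<union> N)" using fin fN by (intro card_mono) auto
        also have "\<dots> \<le> card Fs + card N" by (rule card_Un_le)
        finally show ?thesis unfolding cU bN .
      qed
      ultimately show ?thesis unfolding hit_def
        using p S0 n0 cn cS by (intro acceptance_mismatch) (auto simp: a_def f'_def r_def)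
    qed
    finally have "(p * a / card S) * bs + ((p * f' + r) / card S) * bf \<le>
       (p * a / card S + (p * f' + r) / card S) * V + 6 * (real b + 1) / n * W"
      using W0 by (auto intro: mult_right_mono)
    then have "\<E> (Suc k) P Q I \<le> V + 6 * (real b + 1) / n * W + A"
      using avg by (simp add: algebra_simps)
    also have "\<dots> = V + (g + pot (Suc k) R) / f"
      by (simp add: A_def \<delta>_def W_def diff_divide_distrib add_divide_distrib)
    finally show ?thesis .
  qed
  then show ?thesis unfolding V pot_def R_def .
qed

text \<open>The outer induction is on the number of bursts to come, the next one on the number of attempts of the
  current burst, the innermost one on the number of unrevealed edges. Once the gap has
  reached \<open>f\<close> the error is at least \<open>1\<close> and nothing has to be shown; until then the ideal
  process is within \<open>f\<close> of the actual one, so that \<open>w\<close> needs to be superharmonic only at positive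
  heights, and only up to the tolerance \<open>f\<close> after time \<open>L\<close>.\<close>

lemma comparison_state:
  fixes h :: "nat \<Rightarrow> real" and w :: "nat \<Rightarrow> nat \<Rightarrow> real" and f L n :: nat
  assumes h: "\<And>s. 0 \<le> h s" "\<And>s. h s \<le> 1" and f: "1 \<le> f"
    and w: "\<And>s c. 0 \<le> w s c" "\<And>s c. w s c \<le> B"
    and stop_early: "\<And>s. s \<le> L \<Longrightarrow> s \<le> n \<Longrightarrow> h s \<le> w s s"
    and stop_late: "\<And>s c. \<lbrakk>L < s; s \<le> n; s < c + f; c < s + f\<rbrakk> \<Longrightarrow> h s \<le> w s c"
    and super_early: "\<And>s c. s \<le> L \<Longrightarrow> s < c \<Longrightarrow> ideal_burst n K (w (Suc s)) c \<le> w s c"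
    and super_late: "\<And>s c. L < s \<Longrightarrow> s < c + f \<Longrightarrow> ideal_burst n K (w (Suc s)) c \<le> w s c"
  shows "\<lbrakk>P \<subseteq> all_edges n; Q \<subseteq> all_edges n; P \<inter> Q = {}; X \<subseteq> I; I \<subseteq> {1..n}; card X + M = n;
      \<And>e. e \<in> P \<Longrightarrow> e \<subseteq> I; k = 0 \<or> i \<in> X; card I \<le> c + g; c \<le> card I + g;
      card X \<le> L \<Longrightarrow> g = 0 \<or> f \<le> g\<rbrakk> \<Longrightarrow>
    measure_pmf.expectation (annealed n p K M i k P Q cc X I) h
      \<le> attempts n k (w (card X)) c + (g + potential n L f (card X) k i (P \<union> Q) X) / f"
proof (induction M arbitrary: k i P Q cc X I c g rule: less_induct)
  case (less M)
  note IH_M = less.IH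
  have h1: "\<bar>h z\<bar> \<le> 1" for z using h[of z] by (simp add: abs_le_iff)
  have f0: "0 < real f" using f by simp
  have attempts_nonneg: "0 \<le> attempts n k (w s) c" for k s c using attempts_bounds(1)[OF w] .
  have k0: "measure_pmf.expectation (annealed n p K M i 0 P Q cc X I) h
      \<le> w (card X) c + (g + potential n L f (card X) 0 i (P \<union> Q) X) / f"
    if PQ: "P \<subseteq> all_edges n" "Q \<subseteq> all_edges n" "P \<inter> Q = {}" and XI: "X \<subseteq> I" "I \<subseteq> {1..n}"
      and M: "card X + M = n" and PI: "\<And>e. e \<in> P \<Longrightarrow> e \<subseteq> I"
      and gap: "card I \<le> c + g" "c \<le> card I + g" "card X \<le> L \<Longrightarrow> g = 0 \<or> f \<le> g"
    for i P Q cc X I c g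
  proof (cases "f \<le> g")
    case True
    have "measure_pmf.expectation (annealed n p K M i 0 P Q cc X I) h \<le> 1"
      using expectation_between_0_1[of h] h by blast
    also have "1 \<le> (g + potential n L f (card X) 0 i (P \<union> Q) X) / f"
      using True f0 potential_nonneg[of n L f "card X" 0 i "P \<union> Q" X] by (simp add: le_divide_eq)
    finally show ?thesis using w(1)[of "card X" c] by simp
  next
    case small: False
    have fI: "finite I" using XI finite_subset by blast
    then have fX: "finite X" using XI finite_subset by blast
    have sn: "card X \<le> n" using M by simp
    have pot0: "0 \<le> (g + potential n L f (card X) 0 i (P \<union> Q) X) / f"
      using potential_nonneg[of n L f "card X" 0 i "P \<union> Q" X] f0 by simp
    show ?thesis
    proof (cases "I - X = {}")
      case True
      then have "card I = card X" using XI by (simp add: subset_antisym)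
      then have "h (card X) \<le> w (card X) c"
        using stop_early[of "card X"] stop_late[of "card X" c] sn gap small
        by (cases "card X \<le> L") auto
      then show ?thesis using annealed_stop[OF True] pot0 by simp
    next
      case False
      define i' where "i' = Min (I - X)"
      have i': "i' \<in> I - X" unfolding i'_def using False fI by (intro Min_in) auto
      have X': "card (insert i' X) = Suc (card X)" using i' fX by simp
      have "card X < card I" using XI i' fI by (intro psubset_card_mono) auto
      moreover have "card I \<le> n" using card_mono[OF _ XI(2)] by simp
      ultimately have "0 < M" using M by simp
      then obtain M' where M': "M = Suc M'" by (cases M) auto
      have next_le: "measure_pmf.expectation (annealed n p K M' i' k P Q (cc(i' := k)) (insert i' X) I) h
          \<le> attempts n k (w (Suc (card X))) c + (g + potential n L f (Suc (card X)) k i' (P \<union> Q) (insert i' X)) / f" for k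
        using PQ XI M M' PI gap i' small X'
        by (intro IH_M[of M' P Q "insert i' X" I k i' c g "cc(i' := k)", unfolded X']) auto
      have int_att: "integrable (measure_pmf K) (\<lambda>k. attempts n k (w (Suc (card X))) c)"
        using attempts_bounds[of "w (Suc (card X))" B, OF w] attempts_nonneg
        by (intro integrable_bounded_pmf[where B=B]) simp
      have "i' \<in> {1..n} - X" using i' XI by auto
      note pot = potential_next_emitter(1)[OF this, where L=L and f=f and s="card X" and R="P \<union> Q"]
        potential_next_emitter(2)[OF this, where L=L and f=f and s="card X" and R="P \<union> Q" and i=i]
      have "measure_pmf.expectation (annealed n p K M i 0 P Q cc X I) h =
        measure_pmf.expectation K (\<lambda>k. measure_pmf.expectation (annealed n p K M' i' k P Q (cc(i' := k)) (insert i' X) I) h)"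
        unfolding M' annealed_next_emitter[OF XI(2) False i'_def]
        by (rule expectation_bind_pmf[OF h1])
      also have "\<dots> \<le> measure_pmf.expectation K (\<lambda>k. attempts n k (w (Suc (card X))) c
          + (g + potential n L f (Suc (card X)) k i' (P \<union> Q) (insert i' X)) / f)"
      proof (rule integral_mono[OF _ _ next_le])
        show "integrable (measure_pmf K) (\<lambda>k. measure_pmf.expectation (annealed n p K M' i' k P Q (cc(i' := k)) (insert i' X) I) h)"
          by (rule integrable_bounded_pmf[where B=1]) (use expectation_between_0_1[of h, OF h] in simp)
      qed (use int_att pot in auto)
      also have "\<dots> = ideal_burst n K (w (Suc (card X))) c
          + (g + measure_pmf.expectation K (\<lambda>k. potential n L f (Suc (card X)) k i' (P \<union> Q) (insert i' X))) / f"
        using int_att pot by (simp add: ideal_burst_def)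
      also have "\<dots> \<le> w (card X) c + (g + potential n L f (card X) 0 i (P \<union> Q) X) / f"
      proof (rule add_mono)
        show "ideal_burst n K (w (Suc (card X))) c \<le> w (card X) c"
          using super_early[of "card X" c] super_late[of "card X" c] \<open>card X < card I\<close> gap small
          by (cases "card X \<le> L") auto
        show "(g + measure_pmf.expectation K (\<lambda>k. potential n L f (Suc (card X)) k i' (P \<union> Q) (insert i' X))) / f
          \<le> (g + potential n L f (card X) 0 i (P \<union> Q) X) / f"
          using pot f0 by (intro divide_right_mono add_left_mono) auto
      qed
      finally show ?thesis .
    qed
  qed
  show ?case using less.prems
  proof (induction k arbitrary: P Q I c g)
    case 0
    then show ?case using k0[of P Q X I c g i cc] by simp
  next
    case (Suc k)
    note IH_k = Suc.IH
    have i: "i \<in> X" using Suc.prems by simp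
    show ?case using Suc.prems
    proof (induction "card (all_edges n - (P \<union> Q))" arbitrary: Q rule: less_induct)
      case (less Q)
      note pr = less.prems
      show ?case
      proof (rule comparison_attempt[OF h f pr(1,2,3) i pr(4,5) pr(7) pr(9,10,11)])
        fix P' j c' g'
        assume "j \<in> {1..n}" "P' \<subseteq> all_edges n" "P' \<inter> Q = {}" "\<And>e. e \<in> P' \<Longrightarrow> e \<subseteq> insert j I"
          "card (insert j I) \<le> c' + g'" "c' \<le> card (insert j I) + g'" "card X \<le> L \<Longrightarrow> g' = 0 \<or> f \<le> g'"
        then show "measure_pmf.expectation (annealed n p K M i k P' Q cc X (insert j I)) h
          \<le> attempts n k (w (card X)) c' + (g' + potential n L f (card X) k i (P' \<union> Q) X) / f"
          using pr i by (intro IH_k) auto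
      next
        fix j
        assume e: "{i, j} \<in> all_edges n" "{i, j} \<notin> P" "{i, j} \<notin> Q"
        have "card (all_edges n - (P \<union> insert {i, j} Q)) < card (all_edges n - (P \<union> Q))"
          using e finite_all_edges by (intro psubset_card_mono) auto
        then show "measure_pmf.expectation (annealed n p K M i (Suc k) P (insert {i, j} Q) cc X I) h
          \<le> attempts n (Suc k) (w (card X)) c + (g + potential n L f (card X) (Suc k) i (P \<union> insert {i, j} Q) X) / f"
          using pr e by (intro less.hyps) auto
      qed
    qed
  qed
qed

definition comparison_error :: "nat \<Rightarrow> nat \<Rightarrow> nat \<Rightarrow> real" where
  "comparison_error n L f = ecost 1 0 0 / f + ecost L 0 0 / n"

text \<open>The function \<open>w\<close> plays the role of the probability, for the ideal process, of an event such as
  \<open>\<tau> > t\<close> or \<open>\<tau> \<le> t\<close>: it must be superharmonic while the process is alive and dominate \<open>h\<close> when it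
  stops. Choosing \<open>f\<close> and then \<open>n\<close> large makes the error small for every fixed \<open>L\<close>.\<close>

theorem comparison:
  fixes h :: "nat \<Rightarrow> real" and w :: "nat \<Rightarrow> nat \<Rightarrow> real" and f L n :: nat
  assumes adm: "admissible_rule rule" and n: "0 < n"
    and h: "\<And>s. 0 \<le> h s" "\<And>s. h s \<le> 1" and f: "1 \<le> f"
    and w: "\<And>s c. 0 \<le> w s c" "\<And>s c. w s c \<le> B"
    and stop_early: "\<And>s. s \<le> L \<Longrightarrow> s \<le> n \<Longrightarrow> h s \<le> w s s"
    and stop_late: "\<And>s c. \<lbrakk>L < s; s \<le> n; s < c + f; c < s + f\<rbrakk> \<Longrightarrow> h s \<le> w s c"
    and super_early: "\<And>s c. s \<le> L \<Longrightarrow> s < c \<Longrightarrow> ideal_burst n K (w (Suc s)) c \<le> w s c"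
    and super_late: "\<And>s c. L < s \<Longrightarrow> s < c + f \<Longrightarrow> ideal_burst n K (w (Suc s)) c \<le> w s c"
  shows "measure_pmf.expectation (end_time_law n p K rule) h \<le> w 0 1 + comparison_error n L f"
proof -
  have h1: "\<bar>h z\<bar> \<le> 1" for z using h[of z] by (simp add: abs_le_iff)
  have v: "measure_pmf.expectation (annealed n p K n 0 0 {} {} (\<lambda>_. 0) {} {v}) h \<le> w 0 1 + comparison_error n L f"
    if "v \<in> {1..n}" for v
  proof -
    have "measure_pmf.expectation (annealed n p K n 0 0 {} {} (\<lambda>_. 0) {} {v}) h
      \<le> attempts n 0 (w (card ({}::nat set))) 1 + (real 0 + potential n L f (card ({}::nat set)) 0 0 ({} \<union> {}) {}) / f"
      using that by (intro comparison_state[OF h f w stop_early stop_late super_early super_late]) auto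
    also have "\<dots> = w 0 1 + comparison_error n L f"
      using n f by (simp add: potential_def revealed_at_def comparison_error_def field_simps)
    finally show ?thesis .
  qed
  have "measure_pmf.expectation (end_time_law n p K rule) h =
    measure_pmf.expectation (pmf_of_set {1..n}) (\<lambda>v. measure_pmf.expectation (annealed n p K n 0 0 {} {} (\<lambda>_. 0) {} {v}) h)"
    unfolding end_time_law_eq_annealed[OF adm n] by (rule expectation_bind_pmf[OF h1])
  also have "\<dots> = (\<Sum>v\<in>{1..n}. measure_pmf.expectation (annealed n p K n 0 0 {} {} (\<lambda>_. 0) {} {v}) h) / n"
    using n by (subst integral_pmf_of_set) auto
  also have "\<dots> \<le> (\<Sum>v\<in>{1..n}. w 0 1 + comparison_error n L f) / n"
    using v by (intro divide_right_mono sum_mono) auto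
  also have "\<dots> = w 0 1 + comparison_error n L f" using n by simp
  finally show ?thesis .
qed

end

section \<open>Sums of independent variables\<close>

lemma expectation_bind_pmf_complex:
  fixes h :: "'b \<Rightarrow> complex"
  assumes "\<And>x. norm (h x) \<le> B"
  shows "measure_pmf.expectation (p \<bind> g) h =
    measure_pmf.expectation p (\<lambda>x. measure_pmf.expectation (g x) h)"
proof -
  have int: "integrable (measure_pmf q) h" for q
    by (rule measure_pmf.integrable_const_bound[where B=B]) (use assms in auto)
  have norm: "norm (measure_pmf.expectation (g x) h) \<le> B" for x
  proof -
    have "norm (measure_pmf.expectation (g x) h) \<le> measure_pmf.expectation (g x) (\<lambda>x. norm (h x))"
      by (rule integral_norm_bound)
    also have "\<dots> \<le> B" using assms int by (intro measure_pmf.integral_le_const) auto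
    finally show ?thesis .
  qed
  have int': "integrable (measure_pmf p) (\<lambda>x. measure_pmf.expectation (g x) h)"
    by (rule measure_pmf.integrable_const_bound[where B=B]) (use norm in auto)
  have re: "\<bar>Re (h x)\<bar> \<le> B" "\<bar>Im (h x)\<bar> \<le> B" for x
    using assms[of x] abs_Re_le_cmod[of "h x"] abs_Im_le_cmod[of "h x"] by linarith+
  show ?thesis
    using expectation_bind_pmf[of "\<lambda>x. Re (h x)" B p g, OF re(1)]
      expectation_bind_pmf[of "\<lambda>x. Im (h x)" B p g, OF re(2)] int int'
    by (intro complex_eqI) simp_all
qed

lemma prob_bind_pmf:
  "measure_pmf.prob (p \<bind> g) A = measure_pmf.expectation p (\<lambda>x. measure_pmf.prob (g x) A)"
  using expectation_bind_pmf[of "indicator A :: _ \<Rightarrow> real" 1 p g] by (simp add: indicator_def)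

fun sum_pmf :: "real pmf list \<Rightarrow> real pmf" where
  "sum_pmf [] = return_pmf 0"
| "sum_pmf (q # qs) = q \<bind> (\<lambda>x. map_pmf ((+) x) (sum_pmf qs))"

lemma char_sum_pmf: "char (sum_pmf qs) t = prod_list (map (\<lambda>q. char q t) qs)"
proof (induction qs)
  case Nil
  then show ?case by (simp add: char_def integral_measure_pmf[of "{0}"])
next
  case (Cons q qs)
  have "char (sum_pmf (q # qs)) t = measure_pmf.expectation q
      (\<lambda>x. measure_pmf.expectation (sum_pmf qs) (\<lambda>y. iexp (t * (x + y))))"
    unfolding char_def sum_pmf.simps
    by (subst expectation_bind_pmf_complex[where B=1]) (simp_all del: of_real_mult of_real_add)
  also have "\<dots> = measure_pmf.expectation q (\<lambda>x. iexp (t * x) * char (sum_pmf qs) t)"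
    unfolding char_def by (simp add: exp_add distrib_left del: of_real_mult) 
  also have "\<dots> = char q t * char (sum_pmf qs) t"
    by (simp add: char_def)
  finally show ?case using Cons by simp
qed

definition mean :: "real pmf \<Rightarrow> real" where
  "mean q = measure_pmf.expectation q (\<lambda>x. x)"

definition var :: "real pmf \<Rightarrow> real" where
  "var q = measure_pmf.expectation q (\<lambda>x. (x - mean q)\<^sup>2)"

definition square_integrable :: "real pmf \<Rightarrow> bool" where
  "square_integrable q \<longleftrightarrow> integrable (measure_pmf q) (\<lambda>x. x\<^sup>2)"

lemma square_integrableD:
  assumes "square_integrable q"
  shows "integrable (measure_pmf q) (\<lambda>x. x)" "integrable (measure_pmf q) (\<lambda>x. (x - a)\<^sup>2)"
proof -
  show i: "integrable (measure_pmf q) (\<lambda>x. x)"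
    by (rule measure_pmf.square_integrable_imp_integrable) (use assms in \<open>auto simp: square_integrable_def\<close>)
  then show "integrable (measure_pmf q) (\<lambda>x. (x - a)\<^sup>2)"
    using assms by (simp add: power2_diff square_integrable_def)
qed

lemma var_nonneg: "0 \<le> var q"
  by (simp add: var_def)

lemma pair_moments:
  assumes "square_integrable q" "square_integrable r"
  shows "square_integrable (q \<bind> (\<lambda>x. map_pmf ((+) x) r))"
    "mean (q \<bind> (\<lambda>x. map_pmf ((+) x) r)) = mean q + mean r"
    "var (q \<bind> (\<lambda>x. map_pmf ((+) x) r)) = var q + var r"
proof -
  define s where "s = q \<bind> (\<lambda>x. map_pmf ((+) x) r)"
  have s: "s = map_pmf (\<lambda>z. fst z + snd z) (pair_pmf q r)"
    by (simp add: s_def pair_pmf_def map_bind_pmf map_pmf_def bind_assoc_pmf bind_return_pmf)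
  have 1: "integrable (measure_pmf (pair_pmf q r)) (\<lambda>z. fst z)" "integrable (measure_pmf (pair_pmf q r)) (\<lambda>z. snd z)"
    using square_integrableD(1)[OF assms(1)] square_integrableD(1)[OF assms(2)]
      integrable_map_pmf_eq[of fst "pair_pmf q r" "\<lambda>x. x"] integrable_map_pmf_eq[of snd "pair_pmf q r" "\<lambda>x. x"]
    by (simp_all add: map_fst_pair_pmf map_snd_pair_pmf)
  show mean_s: "mean s = mean q + mean r"
    using 1 expectation_pair_pmf_fst[of q r "\<lambda>x. x"] expectation_pair_pmf_snd[of q r "\<lambda>x. x"]
    unfolding mean_def s by simp
  have q2: "integrable (measure_pmf q) (\<lambda>x. (x - mean q)\<^sup>2)" and r2: "integrable (measure_pmf r) (\<lambda>x. (x - mean r)\<^sup>2)"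
    and r1: "integrable (measure_pmf r) (\<lambda>x. x)"
    using square_integrableD assms by blast+
  have "(\<integral>\<^sup>+z. ennreal ((z - mean s)\<^sup>2) \<partial>s) = (\<integral>\<^sup>+x. \<integral>\<^sup>+y. ennreal ((x + y - mean s)\<^sup>2) \<partial>r \<partial>q)"
    by (simp add: s_def)
  also have "\<dots> = (\<integral>\<^sup>+x. ennreal ((x - mean q)\<^sup>2 + var r) \<partial>q)"
  proof (intro nn_integral_cong)
    fix x
    have eq: "(x + y - mean s)\<^sup>2 = (x - mean q)\<^sup>2 + 2 * (x - mean q) * (y - mean r) + (y - mean r)\<^sup>2" for y
      by (simp add: mean_s power2_eq_square algebra_simps)
    have "integrable (measure_pmf r) (\<lambda>y. (x + y - mean s)\<^sup>2)"
      unfolding eq using r1 r2 by simp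
    then have "(\<integral>\<^sup>+y. ennreal ((x + y - mean s)\<^sup>2) \<partial>r) = ennreal (measure_pmf.expectation r (\<lambda>y. (x + y - mean s)\<^sup>2))"
      by (intro nn_integral_eq_integral) auto
    also have "measure_pmf.expectation r (\<lambda>y. (x + y - mean s)\<^sup>2) = (x - mean q)\<^sup>2 + var r"
      unfolding eq using r1 r2 by (simp add: var_def mean_def)
    finally show "(\<integral>\<^sup>+y. ennreal ((x + y - mean s)\<^sup>2) \<partial>r) = ennreal ((x - mean q)\<^sup>2 + var r)" .
  qed
  also have "\<dots> = ennreal (measure_pmf.expectation q (\<lambda>x. (x - mean q)\<^sup>2 + var r))"
    using q2 var_nonneg by (intro nn_integral_eq_integral) auto
  also have "measure_pmf.expectation q (\<lambda>x. (x - mean q)\<^sup>2 + var r) = var q + var r"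
    using q2 by (simp add: var_def)
  finally have nn: "(\<integral>\<^sup>+z. ennreal ((z - mean s)\<^sup>2) \<partial>s) = ennreal (var q + var r)" .
  have int: "integrable (measure_pmf s) (\<lambda>z. (z - mean s)\<^sup>2)"
    using nn by (intro integrableI_nonneg) auto
  have "var s = enn2real (ennreal (var q + var r))"
    unfolding var_def[of s] nn[symmetric] by (intro integral_eq_nn_integral) auto
  then show "var s = var q + var r"
    using var_nonneg[of q] var_nonneg[of r] by (simp del: ennreal_plus)
  have "integrable (measure_pmf s) (\<lambda>z. z)" unfolding s using 1 by (simp add: integrable_map_pmf_eq)
  then have "integrable (measure_pmf s) (\<lambda>z. (z - mean s)\<^sup>2 + 2 * mean s * z - (mean s)\<^sup>2)"
    using int by simp
  then show "square_integrable s"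
    by (simp add: square_integrable_def power2_diff)
qed

lemma sum_pmf_moments:
  assumes "\<forall>q\<in>set qs. square_integrable q"
  shows "square_integrable (sum_pmf qs)" "mean (sum_pmf qs) = sum_list (map mean qs)"
    "var (sum_pmf qs) = sum_list (map var qs)"
proof -
  have "square_integrable (sum_pmf qs) \<and> mean (sum_pmf qs) = sum_list (map mean qs) \<and>
    var (sum_pmf qs) = sum_list (map var qs)"
    using assms
    by (induction qs)
       (auto simp: pair_moments, auto simp: square_integrable_def mean_def var_def
         intro!: integrable_measure_pmf_finite)
  then show "square_integrable (sum_pmf qs)" "mean (sum_pmf qs) = sum_list (map mean qs)"
    "var (sum_pmf qs) = sum_list (map var qs)" by auto
qed

lemma sum_pmf_Chebyshev:
  assumes "\<forall>q\<in>set qs. square_integrable q" "0 < a" "sum_list (map mean qs) \<le> - a"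
  shows "measure_pmf.prob (sum_pmf qs) {0..} \<le> sum_list (map var qs) / a\<^sup>2"
proof -
  note mom = sum_pmf_moments[OF assms(1)]
  have "measure_pmf.prob (sum_pmf qs) {0..} \<le>
    measure_pmf.prob (sum_pmf qs) {x\<in>space (sum_pmf qs). a \<le> \<bar>x - measure_pmf.expectation (sum_pmf qs) (\<lambda>x. x)\<bar>}"
    using assms mom(2) by (intro measure_pmf.finite_measure_mono) (auto simp: mean_def)
  also have "\<dots> \<le> var (sum_pmf qs) / a\<^sup>2"
    unfolding var_def mean_def using mom(1) assms(2)
    by (intro measure_pmf.Chebyshev_inequality) (auto simp: square_integrable_def)
  finally show ?thesis using mom(3) by simp
qed

section \<open>The coupon collector duality\<close>

text \<open>Minus the number of attempts spent until the next success.\<close>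

definition neg_wait :: "real \<Rightarrow> real pmf" where
  "neg_wait \<pi> = map_pmf (\<lambda>g. - (real g + 1)) (geometric_pmf \<pi>)"

lemma wait_unfold:
  assumes "0 < \<pi>" "\<pi> \<le> 1"
  shows "neg_wait \<pi> = bernoulli_pmf \<pi> \<bind> (\<lambda>b. if b then return_pmf (-1) else map_pmf (\<lambda>x. x - 1) (neg_wait \<pi>))"
proof -
  have "neg_wait \<pi> = map_pmf (\<lambda>g. - (real g + 1))
     (bernoulli_pmf \<pi> \<bind> (\<lambda>b. if b then return_pmf 0 else map_pmf Suc (geometric_pmf \<pi>)))"
    unfolding neg_wait_def using assms by (subst geometric_bind_pmf_unfold) auto
  also have "\<dots> = bernoulli_pmf \<pi> \<bind> (\<lambda>b. if b then return_pmf (-1) else map_pmf (\<lambda>x. x - 1) (neg_wait \<pi>))"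
    unfolding map_bind_pmf
    by (intro bind_pmf_cong refl) (auto simp: neg_wait_def pmf.map_comp o_def algebra_simps)
  finally show ?thesis .
qed

lemma attempts_eq_1: "(\<And>d. c \<le> d \<Longrightarrow> \<phi> d = 1) \<Longrightarrow> attempts n k \<phi> c = 1"
  by (induction k arbitrary: c) auto

lemma attempts_add: "attempts n (a + b) \<phi> c = attempts n a (attempts n b \<phi>) c"
  by (induction a arbitrary: c) auto

lemma attempts_expectation:
  assumes "\<And>k c. 0 \<le> F k c" "\<And>k c. F k c \<le> B"
  shows "attempts n N (\<lambda>c. measure_pmf.expectation K (\<lambda>k. F k c)) c =
    measure_pmf.expectation K (\<lambda>k. attempts n N (F k) c)"
proof (induction N arbitrary: c)
  case (Suc N)
  have "integrable (measure_pmf K) (\<lambda>k. attempts n N (F k) c)" for c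
    using attempts_bounds[OF assms] by (intro integrable_bounded_pmf[where B=B]) simp
  then show ?case using Suc by simp
qed simp

lemma set_wait: "x \<in> set_pmf (neg_wait \<pi>) \<Longrightarrow> x \<le> -1"
  by (auto simp: neg_wait_def)

lemma set_sum_wait: "x \<in> set_pmf (sum_pmf (map (\<lambda>r. neg_wait (\<pi> r)) rs)) \<Longrightarrow> x \<le> 0"
proof (induction rs arbitrary: x)
  case (Cons r rs)
  then obtain y z where "x = y + z" "y \<in> set_pmf (neg_wait (\<pi> r))" "z \<in> set_pmf (sum_pmf (map (\<lambda>r. neg_wait (\<pi> r)) rs))"
    by auto
  then show ?case using Cons.IH[of z] set_wait[of y] by fastforce
qed simp

lemma vimage_add_atLeast: "(+) x -` {a..} = {a - x..}" for x a :: real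
  by auto

text \<open>Both sides satisfy the same recursion: the first attempt either ends the first waiting time or
  leaves a waiting time with the same law.\<close>

lemma attempts_eq_prob_wait:
  assumes "y < n"
  shows "attempts n N (\<lambda>d. if y < d then 1 else 0) c =
    measure_pmf.prob (sum_pmf (map (\<lambda>r. neg_wait (hit n r)) [c..<Suc y])) {- real N..}"
proof (induction N arbitrary: c)
  case 0
  show ?case
  proof (cases "y < c")
    case True
    then show ?thesis by (simp add: indicator_def)
  next
    case False
    then have "[c..<Suc y] = c # [Suc c..<Suc y]" by (simp add: upt_conv_Cons)
    then have "x \<le> -1" if "x \<in> set_pmf (sum_pmf (map (\<lambda>r. neg_wait (hit n r)) [c..<Suc y]))" for x
      using that set_wait set_sum_wait[of _ "hit n" "[Suc c..<Suc y]"] by (fastforce simp del: upt_Suc)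
    then have "set_pmf (sum_pmf (map (\<lambda>r. neg_wait (hit n r)) [c..<Suc y])) \<inter> {- real 0..} = {}" by fastforce
    then show ?thesis using False by (simp add: measure_pmf_zero_iff del: upt_Suc)
  qed
next
  case (Suc N)
  show ?case
  proof (cases "y < c")
    case True
    then have "attempts n (Suc N) (\<lambda>d. if y < d then 1 else 0) c = 1" by (intro attempts_eq_1) auto
    then show ?thesis using True by (simp add: indicator_def)
  next
    case False
    define \<pi> where "\<pi> = hit n c"
    define qs where "qs = map (\<lambda>r. neg_wait (hit n r)) [Suc c..<Suc y]"
    have l: "map (\<lambda>r. neg_wait (hit n r)) [c..<Suc y] = neg_wait \<pi> # qs"
      using False by (simp add: upt_conv_Cons \<pi>_def qs_def del: upt_Suc)
    have \<pi>: "0 < \<pi>" "\<pi> \<le> 1" using False assms hit_bounds by (auto simp: \<pi>_def hit_def)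
    have "sum_pmf (neg_wait \<pi> # qs) = bernoulli_pmf \<pi> \<bind> (\<lambda>b. if b then map_pmf ((+) (-1)) (sum_pmf qs)
        else map_pmf ((+) (-1)) (sum_pmf (neg_wait \<pi> # qs)))"
      by (subst sum_pmf.simps, subst wait_unfold[OF \<pi>])
         (auto simp: bind_assoc_pmf bind_return_pmf bind_map_pmf map_bind_pmf pmf.map_comp o_def algebra_simps
           intro!: bind_pmf_cong map_pmf_cong)
    then have "measure_pmf.prob (sum_pmf (neg_wait \<pi> # qs)) {- real (Suc N)..} =
      measure_pmf.prob (bernoulli_pmf \<pi> \<bind> (\<lambda>b. if b then map_pmf ((+) (-1)) (sum_pmf qs)
        else map_pmf ((+) (-1)) (sum_pmf (neg_wait \<pi> # qs)))) {- real (Suc N)..}"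
      by (rule arg_cong)
    also have "\<dots> = \<pi> * measure_pmf.prob (sum_pmf qs) {- real N..} + (1 - \<pi>) * measure_pmf.prob (sum_pmf (neg_wait \<pi> # qs)) {- real N..}"
      using \<pi> vimage_add_atLeast[of "-1" "- real (Suc N)"]
      unfolding prob_bind_pmf by (simp del: sum_pmf.simps)
    finally show ?thesis using Suc.IH[of "Suc c"] Suc.IH[of c] unfolding l by (simp add: \<pi>_def qs_def del: upt_Suc sum_pmf.simps)
  qed
qed

lemma ideal_burst_bounds:
  assumes "\<And>c. 0 \<le> \<phi> c" "\<And>c. \<phi> c \<le> B"
  shows "0 \<le> ideal_burst n K \<phi> c" "ideal_burst n K \<phi> c \<le> B"
proof -
  have "integrable (measure_pmf K) (\<lambda>k. attempts n k \<phi> c)"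
    using attempts_bounds[OF assms] by (intro integrable_bounded_pmf[where B=B]) simp
  then show "ideal_burst n K \<phi> c \<le> B"
    unfolding ideal_burst_def using attempts_bounds[OF assms] by (intro measure_pmf.integral_le_const) auto
qed (use attempts_bounds[OF assms] in \<open>simp add: ideal_burst_def\<close>)

lemma ideal_bursts_bounds:
  assumes "\<And>c. 0 \<le> \<phi> c" "\<And>c. \<phi> c \<le> B"
  shows "0 \<le> (ideal_burst n K ^^ T) \<phi> c \<and> (ideal_burst n K ^^ T) \<phi> c \<le> B"
proof (induction T arbitrary: c)
  case (Suc T)
  then show ?case
    using ideal_burst_bounds[of "(ideal_burst n K ^^ T) \<phi>" B n K c] by simp
qed (use assms in auto)

text \<open>The increments of the difference between the attempts offered by \<open>T\<close> bursts and the attempts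
  needed to go from \<open>c\<close> to more than \<open>y\<close> informed servers.\<close>

definition walk :: "nat \<Rightarrow> nat pmf \<Rightarrow> nat \<Rightarrow> nat \<Rightarrow> nat \<Rightarrow> real pmf list" where
  "walk n K T c y = replicate T (map_pmf real K) @ map (\<lambda>r. neg_wait (hit n r)) [c..<Suc y]"

text \<open>The number of informed servers exceeds \<open>y\<close> after \<open>T\<close> bursts if and only if the attempts offered
  suffice for the successive waiting times. This replaces a process with dependent increments by a sum
  of independent variables.\<close>

theorem ideal_bursts_eq_walk:
  assumes "y < n"
  shows "(ideal_burst n K ^^ T) (\<lambda>d. if y < d then 1 else 0) c = measure_pmf.prob (sum_pmf (walk n K T c y)) {0..}"
proof -
  let ?\<phi> = "\<lambda>d. if y < d then 1 else (0 :: real)"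
  have "attempts n N ((ideal_burst n K ^^ T) ?\<phi>) c = measure_pmf.prob (sum_pmf (walk n K T c y)) {- real N..}" for N
  proof (induction T arbitrary: N)
    case 0
    then show ?case using attempts_eq_prob_wait[OF assms] by (simp add: walk_def del: upt_Suc)
  next
    case (Suc T)
    let ?\<psi> = "(ideal_burst n K ^^ T) ?\<phi>"
    have \<psi>: "0 \<le> ?\<psi> c" "?\<psi> c \<le> 1" for c using ideal_bursts_bounds[of ?\<phi> 1] by auto
    have "attempts n N ((ideal_burst n K ^^ Suc T) ?\<phi>) c =
      attempts n N (\<lambda>c. measure_pmf.expectation K (\<lambda>k. attempts n k ?\<psi> c)) c"
      by (simp add: ideal_burst_def[abs_def])
    also have "\<dots> = measure_pmf.expectation K (\<lambda>k. attempts n N (attempts n k ?\<psi>) c)"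
      using attempts_bounds[of ?\<psi> 1, OF \<psi>] by (intro attempts_expectation[where B=1])
    also have "\<dots> = measure_pmf.expectation K (\<lambda>k. measure_pmf.prob (sum_pmf (walk n K T c y)) {- real (N + k)..})"
      unfolding attempts_add[symmetric] Suc.IH ..
    also have "\<dots> = measure_pmf.prob (sum_pmf (walk n K (Suc T) c y)) {- real N..}"
    proof -
      have "(+) (real k) -` {- real N..} = {- real (N + k)..}" for k
        using vimage_add_atLeast[of "real k" "- real N"] by (simp add: algebra_simps)
      then show ?thesis by (simp add: walk_def prob_bind_pmf del: upt_Suc)
    qed
    finally show ?case .
  qed
  from this[of 0] show ?thesis by simp
qed

section \<open>A central limit theorem for independent summands\<close>

definition centred :: "real pmf \<Rightarrow> real pmf" where
  "centred q = map_pmf (\<lambda>x. x - mean q) q"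

lemma sum_pmf_centred:
  "sum_pmf (map centred qs) = map_pmf (\<lambda>x. x - sum_list (map mean qs)) (sum_pmf qs)"
proof (induction qs)
  case (Cons q qs)
  show ?case
    unfolding list.map sum_pmf.simps Cons.IH
    by (simp add: centred_def bind_map_pmf map_bind_pmf pmf.map_comp o_def algebra_simps)
qed simp

lemma char_centred_approx:
  assumes "square_integrable q"
  shows "cmod (char (centred q) s - complex_of_real (1 - s\<^sup>2 * var q / 2)) \<le>
    (s\<^sup>2 / 6) * measure_pmf.expectation q (\<lambda>x. min (6 * (x - mean q)\<^sup>2) (\<bar>s\<bar> * \<bar>x - mean q\<bar> ^ 3))"
proof -
  have mean0: "measure_pmf.expectation q (\<lambda>x. x - mean q) = 0"
    using square_integrableD(1)[OF assms] by (simp add: mean_def)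
  have "cmod (char (distr (measure_pmf q) borel (\<lambda>x. x - mean q)) s - complex_of_real (1 - s\<^sup>2 * var q / 2)) \<le>
    (s\<^sup>2 / 6) * measure_pmf.expectation q (\<lambda>x. min (6 * (x - mean q)\<^sup>2) (\<bar>s\<bar> * \<bar>x - mean q\<bar> ^ 3))"
    using prob_space.char_approx3'[OF measure_pmf.prob_space_axioms, of "\<lambda>x. x - mean q" q "var q"
        "distr (measure_pmf q) borel (\<lambda>x. x - mean q)" s]
      square_integrableD[OF assms] mean0
    by (simp add: var_def)
  moreover have "char (distr (measure_pmf q) borel (\<lambda>x. x - mean q)) s = char (centred q) s"
    by (simp add: char_def centred_def integral_distr del: of_real_mult of_real_diff)
  ultimately show ?thesis by simp
qed

lemma cmod_char_pmf_le_1: "cmod (char (measure_pmf q) s) \<le> 1"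
proof -
  have "cmod (char (measure_pmf q) s) \<le> measure_pmf.expectation q (\<lambda>x. cmod (iexp (s * x)))"
    unfolding char_def by (rule integral_norm_bound)
  then show ?thesis by simp
qed

lemma norm_prod_list_diff:
  fixes f g :: "'a \<Rightarrow> complex"
  assumes "\<And>x. x \<in> set xs \<Longrightarrow> norm (f x) \<le> 1" "\<And>x. x \<in> set xs \<Longrightarrow> norm (g x) \<le> 1"
  shows "norm (prod_list (map f xs) - prod_list (map g xs)) \<le> (\<Sum>x\<leftarrow>xs. norm (f x - g x))"
  using assms
proof (induction xs)
  case (Cons x xs)
  let ?F = "prod_list (map f xs)" and ?G = "prod_list (map g xs)"
  have G: "norm ?G \<le> 1" using Cons.prems(2)
    by (induction xs) (auto simp: norm_mult intro!: mult_le_one)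
  have "f x * ?F - g x * ?G = f x * (?F - ?G) + (f x - g x) * ?G" by (simp add: algebra_simps)
  then have "norm (f x * ?F - g x * ?G) \<le> norm (f x) * norm (?F - ?G) + norm (f x - g x) * norm ?G"
    by (metis norm_mult norm_triangle_ineq)
  also have "\<dots> \<le> 1 * norm (?F - ?G) + norm (f x - g x) * 1"
    using G Cons.prems by (intro add_mono mult_mono) auto
  finally show ?case using Cons by simp
qed simp

lemma exp_minus_approx:
  fixes a :: real assumes "0 \<le> a"
  shows "\<bar>(1 - a) - exp (- a)\<bar> \<le> a\<^sup>2"
proof -
  have 1: "1 - a \<le> exp (- a)" using exp_ge_add_one_self[of "- a"] by simp
  have "exp (- a) \<le> 1 / (1 + a)"
    using exp_ge_add_one_self[of a] assms by (simp add: exp_minus divide_simps)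
  also have "1 / (1 + a) \<le> 1 - a + a\<^sup>2"
  proof -
    have "(1 - a + a\<^sup>2) * (1 + a) = 1 + a ^ 3" by (simp add: algebra_simps power2_eq_square power3_eq_cube)
    then show ?thesis using assms by (simp add: divide_le_eq)
  qed
  finally show ?thesis using 1 by (simp add: abs_le_iff)
qed

definition gaussian :: "real \<Rightarrow> real measure" where
  "gaussian V = distr std_normal_distribution borel (\<lambda>x. sqrt V * x)"

lemma real_distribution_gaussian: "real_distribution (gaussian V)"
proof -
  interpret real_distribution std_normal_distribution by (rule real_dist_normal_dist)
  show ?thesis unfolding gaussian_def by (rule real_distribution_distr) auto
qed

lemma char_gaussian: "0 \<le> V \<Longrightarrow> char (gaussian V) t = complex_of_real (exp (- V * t\<^sup>2 / 2))"
proof -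
  assume "0 \<le> V"
  have "char (gaussian V) t = char std_normal_distribution (t * sqrt V)"
    unfolding gaussian_def char_def by (subst integral_distr) (simp_all add: mult.assoc del: of_real_mult)
  then show ?thesis using \<open>0 \<le> V\<close> by (simp add: char_std_normal_distribution power_mult_distrib mult.commute)
qed

text \<open>The classical argument by characteristic functions: the product of the characteristic functions of
  the summands is replaced, factor by factor, by a product of Gaussian ones; the last assumption makes
  the total error vanish.\<close>

theorem clt_independent_array:
  fixes qs :: "nat \<Rightarrow> real pmf list"
  assumes sq: "\<And>n q. q \<in> set (qs n) \<Longrightarrow> square_integrable q"
    and var_bound: "\<And>n q. q \<in> set (qs n) \<Longrightarrow> var q \<le> B"
    and len: "\<And>n. real (length (qs n)) \<le> C * real n"
    and V: "0 \<le> V" "(\<lambda>n. (\<Sum>q\<leftarrow>qs n. var q) / real n) \<longlonglongrightarrow> V"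
    and lindeberg: "\<And>t. (\<lambda>n. (\<Sum>q\<leftarrow>qs n. measure_pmf.expectation q
        (\<lambda>x. min (6 * (x - mean q)\<^sup>2) (\<bar>t / sqrt (real n)\<bar> * \<bar>x - mean q\<bar> ^ 3))) / real n) \<longlonglongrightarrow> 0"
  shows "weak_conv_m (\<lambda>n. distr (sum_pmf (qs n)) borel (\<lambda>x. (x - (\<Sum>q\<leftarrow>qs n. mean q)) / sqrt (real n))) (gaussian V)"
proof (rule levy_continuity)
  show "real_distribution (distr (sum_pmf (qs n)) borel (\<lambda>x. (x - (\<Sum>q\<leftarrow>qs n. mean q)) / sqrt (real n)))" for n
    by (rule prob_space.real_distribution_distr[OF measure_pmf.prob_space_axioms]) simp
  show "real_distribution (gaussian V)" by (rule real_distribution_gaussian)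
  fix t
  define E where "E n = (\<Sum>q\<leftarrow>qs n. measure_pmf.expectation q
        (\<lambda>x. min (6 * (x - mean q)\<^sup>2) (\<bar>t / sqrt (real n)\<bar> * \<bar>x - mean q\<bar> ^ 3))) / real n" for n
  define \<psi> where "\<psi> n q = complex_of_real (exp (- ((t / sqrt (real n))\<^sup>2 * var q / 2)))" for n :: nat and q
  have ch: "char (distr (sum_pmf (qs n)) borel (\<lambda>x. (x - (\<Sum>q\<leftarrow>qs n. mean q)) / sqrt (real n))) t =
    prod_list (map (\<lambda>q. char (centred q) (t / sqrt (real n))) (qs n))" for n
  proof -
    have "char (distr (sum_pmf (qs n)) borel (\<lambda>x. (x - (\<Sum>q\<leftarrow>qs n. mean q)) / sqrt (real n))) t =
      char (sum_pmf (map centred (qs n))) (t / sqrt (real n))"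
      unfolding sum_pmf_centred char_def
      by (subst integral_distr) (simp_all add: field_simps del: of_real_mult of_real_divide)
    then show ?thesis by (simp add: char_sum_pmf o_def)
  qed
  have bound: "cmod (prod_list (map (\<lambda>q. char (centred q) (t / sqrt (real n))) (qs n)) - prod_list (map (\<psi> n) (qs n)))
     \<le> t\<^sup>2 / 6 * E n + C * (t\<^sup>2 * B / 2)\<^sup>2 / n" if n: "0 < n" for n
  proof -
    have tn: "(t / sqrt (real n))\<^sup>2 = t\<^sup>2 / n" using n by (simp add: power_divide)
    have "cmod (prod_list (map (\<lambda>q. char (centred q) (t / sqrt (real n))) (qs n)) - prod_list (map (\<psi> n) (qs n)))
      \<le> (\<Sum>q\<leftarrow>qs n. cmod (char (centred q) (t / sqrt (real n)) - \<psi> n q))"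
      by (rule norm_prod_list_diff) (auto simp: cmod_char_pmf_le_1 \<psi>_def var_nonneg)
    also have "\<dots> \<le> (\<Sum>q\<leftarrow>qs n. (t\<^sup>2 / real n / 6) * measure_pmf.expectation q
        (\<lambda>x. min (6 * (x - mean q)\<^sup>2) (\<bar>t / sqrt (real n)\<bar> * \<bar>x - mean q\<bar> ^ 3)) + (t\<^sup>2 * B / 2 / real n)\<^sup>2)"
    proof (rule sum_list_mono)
      fix q assume q: "q \<in> set (qs n)"
      let ?a = "(t / sqrt (real n))\<^sup>2 * var q / 2"
      have "cmod (char (centred q) (t / sqrt (real n)) - \<psi> n q) \<le>
        cmod (char (centred q) (t / sqrt (real n)) - complex_of_real (1 - ?a)) + cmod (complex_of_real (1 - ?a) - \<psi> n q)"
        by (metis norm_triangle_ineq diff_add_cancel add_diff_eq)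
      also have "cmod (complex_of_real (1 - ?a) - \<psi> n q) = \<bar>(1 - ?a) - exp (- ?a)\<bar>"
        unfolding \<psi>_def by (metis norm_of_real of_real_diff)
      also have "\<dots> \<le> ?a\<^sup>2" by (rule exp_minus_approx) (simp add: var_nonneg)
      also have "?a\<^sup>2 \<le> (t\<^sup>2 * B / 2 / real n)\<^sup>2"
        unfolding tn using mult_left_mono[OF var_bound[OF q], of "t\<^sup>2 / real n / 2"] var_nonneg[of q]
        by (intro power_mono) (simp_all add: mult_ac)
      also have "cmod (char (centred q) (t / sqrt (real n)) - complex_of_real (1 - ?a)) \<le> (t\<^sup>2 / real n / 6) * measure_pmf.expectation q
        (\<lambda>x. min (6 * (x - mean q)\<^sup>2) (\<bar>t / sqrt (real n)\<bar> * \<bar>x - mean q\<bar> ^ 3))"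
        using char_centred_approx[OF sq[OF q], of "t / sqrt (real n)"] unfolding tn by simp
      finally show "cmod (char (centred q) (t / sqrt (real n)) - \<psi> n q) \<le> (t\<^sup>2 / real n / 6) * measure_pmf.expectation q
        (\<lambda>x. min (6 * (x - mean q)\<^sup>2) (\<bar>t / sqrt (real n)\<bar> * \<bar>x - mean q\<bar> ^ 3)) + (t\<^sup>2 * B / 2 / real n)\<^sup>2"
        by simp
    qed
    also have "\<dots> = t\<^sup>2 / 6 * E n + length (qs n) * (t\<^sup>2 * B / 2 / real n)\<^sup>2"
    proof -
      have "(\<Sum>q\<leftarrow>xs. a * F q + d) = a * sum_list (map F xs) + length xs * d" for xs :: "real pmf list" and a d :: real and F
        by (induction xs) (auto simp: algebra_simps)
      then show ?thesis by (simp only: E_def) simp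
    qed
    also have "length (qs n) * (t\<^sup>2 * B / 2 / real n)\<^sup>2 \<le> (C * n) * (t\<^sup>2 * B / 2 / real n)\<^sup>2"
      using len by (intro mult_right_mono) auto
    also have "(C * n) * (t\<^sup>2 * B / 2 / real n)\<^sup>2 = C * (t\<^sup>2 * B / 2)\<^sup>2 / n"
      using n by (simp add: power_divide power2_eq_square)
    finally show ?thesis by simp
  qed
  have "E \<longlonglongrightarrow> 0" using lindeberg unfolding E_def .
  then have null: "(\<lambda>n. t\<^sup>2 / 6 * E n + C * (t\<^sup>2 * B / 2)\<^sup>2 / real n) \<longlonglongrightarrow> 0"
    by (auto intro!: tendsto_eq_intros lim_const_over_n)
  have "\<forall>\<^sub>F n in sequentially. cmod (prod_list (map (\<lambda>q. char (centred q) (t / sqrt (real n))) (qs n)) - prod_list (map (\<psi> n) (qs n)))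
     \<le> t\<^sup>2 / 6 * E n + C * (t\<^sup>2 * B / 2)\<^sup>2 / real n"
    by (rule eventually_sequentiallyI[of 1], rule bound) simp
  then have "(\<lambda>n. prod_list (map (\<lambda>q. char (centred q) (t / sqrt (real n))) (qs n)) - prod_list (map (\<psi> n) (qs n))) \<longlonglongrightarrow> 0"
    using null by (rule Lim_null_comparison)
  moreover have "(\<lambda>n. prod_list (map (\<psi> n) (qs n))) \<longlonglongrightarrow> char (gaussian V) t"
  proof -
    have "prod_list (map (\<psi> n) (qs n)) = complex_of_real (exp (- ((\<Sum>q\<leftarrow>qs n. var q) / real n) * t\<^sup>2 / 2))" if "0 < n" for n
    proof -
      have "prod_list (map (\<lambda>q. complex_of_real (exp (- (c * var q)))) xs) = complex_of_real (exp (- (c * sum_list (map var xs))))" for c xs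
      proof (induction xs)
        case (Cons q xs)
        have "exp (- (c * (var q + S))) = exp (- (c * var q)) * exp (- (c * S))" for S
          by (simp add: distrib_left mult_exp_exp)
        then show ?case using Cons by simp
      qed simp
      from this[of "(t / sqrt (real n))\<^sup>2 / 2" "qs n"] show ?thesis
        using that by (simp add: \<psi>_def[abs_def] power_divide algebra_simps)
    qed
    then have ev: "\<forall>\<^sub>F n in sequentially. complex_of_real (exp (- ((\<Sum>q\<leftarrow>qs n. var q) / real n) * t\<^sup>2 / 2)) = prod_list (map (\<psi> n) (qs n))"
      by (intro eventually_sequentiallyI[of 1]) auto
    show ?thesis unfolding char_gaussian[OF V(1)]
      by (rule Lim_transform_eventually[OF _ ev]) (use V in \<open>intro tendsto_intros, simp_all\<close>)
  qed
  ultimately have "(\<lambda>n. prod_list (map (\<lambda>q. char (centred q) (t / sqrt (real n))) (qs n))) \<longlonglongrightarrow> char (gaussian V) t"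
    by (rule Lim_transform[rotated])
  then show "(\<lambda>n. char (distr (sum_pmf (qs n)) borel (\<lambda>x. (x - (\<Sum>q\<leftarrow>qs n. mean q)) / sqrt (real n))) t) \<longlonglongrightarrow> char (gaussian V) t"
    unfolding ch .
qed

section \<open>Moments of the waiting times\<close>

lemma summable_cubic_geometric:
  fixes a \<rho> :: real
  assumes "0 < \<rho>" "\<rho> < 1"
  shows "summable (\<lambda>k. \<rho> ^ k * (real k + a) ^ 3)"
proof (rule summable_comparison_test_bigo)
  show "summable (\<lambda>k. norm (1 / real k ^ 2))"
    using inverse_power_summable[of 2, where 'a=real] by (simp add: inverse_eq_divide)
  show "(\<lambda>k. \<rho> ^ k * (real k + a) ^ 3) \<in> O(\<lambda>k. 1 / real k ^ 2)"
    using assms by real_asymp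
qed

lemma nn_integral_geometric_cubic:
  fixes a \<pi> \<pi>0 :: real
  assumes "0 < \<pi>0" "\<pi>0 < 1" "\<pi>0 \<le> \<pi>" "\<pi> \<le> 1" "0 \<le> a"
  shows "(\<integral>\<^sup>+k. ennreal ((real k + a) ^ 3) \<partial>geometric_pmf \<pi>) \<le> ennreal (\<Sum>k. (1 - \<pi>0) ^ k * (real k + a) ^ 3)"
proof -
  have "(\<integral>\<^sup>+k. ennreal ((real k + a) ^ 3) \<partial>geometric_pmf \<pi>) =
     (\<Sum>k. ennreal ((1 - \<pi>) ^ k * \<pi> * (real k + a) ^ 3))"
    using assms by (simp add: nn_integral_measure_pmf nn_integral_count_space_nat ennreal_mult)
  also have "\<dots> \<le> (\<Sum>k. ennreal ((1 - \<pi>0) ^ k * (real k + a) ^ 3))"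
  proof (rule suminf_le)
    fix k
    have "(1 - \<pi>) ^ k * \<pi> \<le> (1 - \<pi>0) ^ k * 1" using assms by (intro mult_mono power_mono) auto
    then show "ennreal ((1 - \<pi>) ^ k * \<pi> * (real k + a) ^ 3) \<le> ennreal ((1 - \<pi>0) ^ k * (real k + a) ^ 3)"
      using assms by (intro ennreal_leI mult_right_mono) auto
  qed auto
  also have "\<dots> = ennreal (\<Sum>k. (1 - \<pi>0) ^ k * (real k + a) ^ 3)"
    using assms by (intro suminf_ennreal2 summable_cubic_geometric) auto
  finally show ?thesis .
qed

lemma mean_wait:
  assumes "0 < \<pi>" "\<pi> \<le> 1" shows "mean (neg_wait \<pi>) = - (1 / \<pi>)"
proof -
  have "integrable (geometric_pmf \<pi>) real" "measure_pmf.expectation (geometric_pmf \<pi>) real = (1 - \<pi>) / \<pi>"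
    using assms by (auto intro: integrable_real_geometric_pmf expectation_geometric_pmf)
  then show ?thesis using assms by (simp add: mean_def neg_wait_def field_simps)
qed

lemma wait_third_moment:
  assumes "0 < \<pi>0" "\<pi>0 < 1" "\<pi>0 \<le> \<pi>" "\<pi> \<le> 1"
  shows "integrable (measure_pmf (neg_wait \<pi>)) (\<lambda>x. \<bar>x - mean (neg_wait \<pi>)\<bar> ^ 3)"
    "measure_pmf.expectation (neg_wait \<pi>) (\<lambda>x. \<bar>x - mean (neg_wait \<pi>)\<bar> ^ 3)
       \<le> (\<Sum>k. (1 - \<pi>0) ^ k * (real k + (1 + 1 / \<pi>0)) ^ 3)"
proof -
  have \<pi>: "0 < \<pi>" using assms by simp
  have le: "\<bar>- (real k + 1) - mean (neg_wait \<pi>)\<bar> \<le> real k + (1 + 1 / \<pi>0)" for k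
  proof -
    have "0 \<le> 1 / \<pi>" "1 / \<pi> \<le> 1 / \<pi>0" "0 \<le> 1 / \<pi>0" using assms by (auto intro: divide_left_mono)
    then show ?thesis unfolding mean_wait[OF \<pi> assms(4)] abs_le_iff by linarith
  qed
  have "(\<integral>\<^sup>+x. ennreal (\<bar>x - mean (neg_wait \<pi>)\<bar> ^ 3) \<partial>neg_wait \<pi>)
    \<le> (\<integral>\<^sup>+k. ennreal ((real k + (1 + 1 / \<pi>0)) ^ 3) \<partial>geometric_pmf \<pi>)"
  proof -
    have "(\<integral>\<^sup>+x. ennreal (\<bar>x - \<mu>\<bar> ^ 3) \<partial>neg_wait \<pi>) = (\<integral>\<^sup>+k. ennreal (\<bar>- (real k + 1) - \<mu>\<bar> ^ 3) \<partial>geometric_pmf \<pi>)" for \<mu>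
      by (simp add: neg_wait_def)
    then show ?thesis
      using le by (simp only:) (intro nn_integral_mono ennreal_leI power_mono, auto)
  qed
  also have "\<dots> \<le> ennreal (\<Sum>k. (1 - \<pi>0) ^ k * (real k + (1 + 1 / \<pi>0)) ^ 3)"
    using assms by (intro nn_integral_geometric_cubic) auto
  finally have nn: "(\<integral>\<^sup>+x. ennreal (\<bar>x - mean (neg_wait \<pi>)\<bar> ^ 3) \<partial>neg_wait \<pi>) \<le> ennreal (\<Sum>k. (1 - \<pi>0) ^ k * (real k + (1 + 1 / \<pi>0)) ^ 3)" .
  then show int: "integrable (measure_pmf (neg_wait \<pi>)) (\<lambda>x. \<bar>x - mean (neg_wait \<pi>)\<bar> ^ 3)"
    by (intro integrableI_nonneg) (auto intro: le_less_trans)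
  have "0 \<le> (\<Sum>k. (1 - \<pi>0) ^ k * (real k + (1 + 1 / \<pi>0)) ^ 3)"
    using assms by (intro suminf_nonneg summable_cubic_geometric) auto
  then show "measure_pmf.expectation (neg_wait \<pi>) (\<lambda>x. \<bar>x - mean (neg_wait \<pi>)\<bar> ^ 3)
       \<le> (\<Sum>k. (1 - \<pi>0) ^ k * (real k + (1 + 1 / \<pi>0)) ^ 3)"
    using nn by (subst (asm) nn_integral_eq_integral[OF int]) auto
qed

lemma square_integrable_wait:
  assumes "0 < \<pi>" "\<pi> \<le> 1" shows "square_integrable (neg_wait \<pi>)"
proof -
  have int: "integrable (measure_pmf (neg_wait \<pi>)) (\<lambda>x. \<bar>x - mean (neg_wait \<pi>)\<bar> ^ 3)"
    using assms by (intro wait_third_moment[of "\<pi> / 2"]) auto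
  have "integrable (measure_pmf (neg_wait \<pi>)) (\<lambda>x. (x - mean (neg_wait \<pi>))\<^sup>2)"
  proof (rule Bochner_Integration.integrable_bound)
    show "integrable (measure_pmf (neg_wait \<pi>)) (\<lambda>x. 1 + \<bar>x - mean (neg_wait \<pi>)\<bar> ^ 3)" using int by simp
    have "z\<^sup>2 \<le> 1 + \<bar>z\<bar> ^ 3" for z :: real
    proof (cases "\<bar>z\<bar> \<le> 1")
      case True
      then have "\<bar>z\<bar>\<^sup>2 \<le> 1" by (intro power_le_one) auto
      then show ?thesis by (simp add: add_increasing2)
    next
      case False
      then have "\<bar>z\<bar>\<^sup>2 \<le> \<bar>z\<bar> ^ 3" by (intro power_increasing) auto
      then show ?thesis by simp
    qed
    then show "AE x in measure_pmf (neg_wait \<pi>). norm ((x - mean (neg_wait \<pi>))\<^sup>2) \<le> norm (1 + \<bar>x - mean (neg_wait \<pi>)\<bar> ^ 3)"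
      by (auto simp: abs_of_nonneg add_nonneg_nonneg)
  qed simp
  moreover have "integrable (measure_pmf (neg_wait \<pi>)) (\<lambda>x. x)"
    unfolding neg_wait_def using assms by (auto simp: integrable_real_geometric_pmf)
  ultimately have "integrable (measure_pmf (neg_wait \<pi>)) (\<lambda>x. (x - mean (neg_wait \<pi>))\<^sup>2 + 2 * mean (neg_wait \<pi>) * x - (mean (neg_wait \<pi>))\<^sup>2)"
    by simp
  then show ?thesis by (simp add: square_integrable_def power2_diff)
qed

text \<open>The decomposition of a waiting time at its first attempt gives a linear equation for its variance.\<close>

lemma var_wait:
  assumes "0 < \<pi>" "\<pi> \<le> 1" shows "var (neg_wait \<pi>) = (1 - \<pi>) / \<pi>\<^sup>2"
proof -
  let ?m = "mean (neg_wait \<pi>)" and ?v = "var (neg_wait \<pi>)"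
  note si = square_integrableD[OF square_integrable_wait[OF assms]]
  have shift: "measure_pmf.expectation (neg_wait \<pi>) (\<lambda>x. (x - 1 - ?m)\<^sup>2) = ?v + 1"
  proof -
    have "(x - 1 - ?m)\<^sup>2 = (x - ?m)\<^sup>2 - 2 * (x - ?m) + 1" for x
      by (simp add: power2_eq_square algebra_simps)
    then show ?thesis using si by (simp add: var_def mean_def)
  qed
  have "ennreal ?v = (\<integral>\<^sup>+x. ennreal ((x - ?m)\<^sup>2) \<partial>neg_wait \<pi>)"
    unfolding var_def using si by (intro nn_integral_eq_integral[symmetric]) auto
  also have "\<dots> = (\<integral>\<^sup>+x. ennreal ((x - ?m)\<^sup>2) \<partial>measure_pmf (bind_pmf (bernoulli_pmf \<pi>)
      (\<lambda>b. if b then return_pmf (-1) else map_pmf (\<lambda>x. x - 1) (neg_wait \<pi>))))"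
    using wait_unfold[OF assms] by simp
  also have "\<dots> = ennreal ((- 1 - ?m)\<^sup>2) * \<pi> + (\<integral>\<^sup>+x. ennreal ((x - 1 - ?m)\<^sup>2) \<partial>neg_wait \<pi>) * (1 - \<pi>)"
    using assms by simp
  also have "(\<integral>\<^sup>+x. ennreal ((x - 1 - ?m)\<^sup>2) \<partial>neg_wait \<pi>) = ennreal (?v + 1)"
    unfolding shift[symmetric] using si(2)[of "1 + ?m"]
    by (intro nn_integral_eq_integral) (auto simp: algebra_simps)
  also have "ennreal ((- 1 - ?m)\<^sup>2) * \<pi> + ennreal (?v + 1) * (1 - \<pi>) = ennreal ((- 1 - ?m)\<^sup>2 * \<pi> + (?v + 1) * (1 - \<pi>))"
  proof -
    have "ennreal a * \<pi> + ennreal b * (1 - \<pi>) = ennreal (a * \<pi> + b * (1 - \<pi>))" if "0 \<le> a" "0 \<le> b" for a b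
      using that assms by (simp add: ennreal_mult ennreal_plus)
    from this[of "(- 1 - ?m)\<^sup>2" "?v + 1"] show ?thesis using var_nonneg[of "neg_wait \<pi>"]
      by (simp del: ennreal_plus)
  qed
  finally have "?v = (- 1 - ?m)\<^sup>2 * \<pi> + (?v + 1) * (1 - \<pi>)"
    using assms var_nonneg by (subst (asm) ennreal_inj) (auto intro!: add_nonneg_nonneg mult_nonneg_nonneg)
  then have "?v * \<pi> = (1 / \<pi> - 1)\<^sup>2 * \<pi> + (1 - \<pi>)"
    using mean_wait[OF assms] by (simp add: algebra_simps)
  also have "\<dots> = (1 - \<pi>) / \<pi>" using assms by (simp add: field_simps power2_eq_square)
  finally show ?thesis using assms by (simp add: field_simps power2_eq_square)
qed

section \<open>The deterministic limit\<close>

locale supercritical = spreading +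
  assumes m_gt_1: "1 < m"
begin

definition q :: real where "q = limit_fraction K"

lemma drift_derivative:
  "x < 1 \<Longrightarrow> ((\<lambda>x. x * m + ln (1 - x)) has_real_derivative (m - 1 / (1 - x))) (at x)"
  by (auto intro!: derivative_eq_intros simp: field_simps)

lemma drift_increasing:
  assumes "0 \<le> a" "a < b" "b \<le> 1 - 1 / m"
  shows "a * m + ln (1 - a) < b * m + ln (1 - b)"
proof (rule DERIV_pos_imp_increasing_open[OF assms(2)])
  have m1: "0 < 1 / m" using m_gt_1 by simp
  fix x assume x: "a < x" "x < b"
  then have "x < 1" "1 / m < 1 - x" using assms m1 by linarith+
  then have "1 / (1 - x) < m" using m_gt_1 by (simp add: field_simps)
  then show "\<exists>y. ((\<lambda>x. x * m + ln (1 - x)) has_real_derivative y) (at x) \<and> 0 < y"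
    using drift_derivative[OF \<open>x < 1\<close>] by (intro exI[of _ "m - 1 / (1 - x)"]) auto
next
  have "b < 1" using assms m_gt_1 by (metis diff_gt_0_iff_gt le_less_trans less_numeral_extra(1) diff_less_eq less_add_same_cancel1 less_trans zero_less_divide_1_iff)
  then show "continuous_on {a..b} (\<lambda>x. x * m + ln (1 - x))"
    by (intro continuous_intros) auto
qed

lemma drift_decreasing:
  assumes "1 - 1 / m \<le> a" "a < b" "b < 1"
  shows "b * m + ln (1 - b) < a * m + ln (1 - a)"
proof (rule DERIV_neg_imp_decreasing_open[OF assms(2)])
  fix x assume x: "a < x" "x < b"
  then have "x < 1" "1 - x < 1 / m" using assms by linarith+
  then have "m < 1 / (1 - x)" using m_gt_1 by (simp add: field_simps)
  then show "\<exists>y. ((\<lambda>x. x * m + ln (1 - x)) has_real_derivative y) (at x) \<and> y < 0"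
    using drift_derivative[OF \<open>x < 1\<close>] by (intro exI[of _ "m - 1 / (1 - x)"]) auto
next
  show "continuous_on {a..b} (\<lambda>x. x * m + ln (1 - x))"
    using assms by (intro continuous_intros) auto
qed

text \<open>The drift \<open>x m + ln (1 - x)\<close> vanishes at \<open>0\<close>, increases up to \<open>1 - 1 / m\<close> and then decreases to minus
  infinity, so it has exactly one positive zero, which lies beyond the maximum.\<close>

lemma q_properties: "1 - 1 / m < q" "q < 1" "q * m + ln (1 - q) = 0"
proof -
  \<comment> \<open>at this point \<open>ln (1 - x1) = - m\<close>, so that the drift is negative\<close>
  define x1 where "x1 = 1 - exp (- m)"
  have m0: "0 < m" using m_gt_1 by simp
  have x1: "x1 < 1" by (simp add: x1_def)
  have star: "0 < 1 - 1 / m" "1 - 1 / m < 1" using m_gt_1 by auto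
  have "m < exp m" using exp_gt_one[of m] exp_ge_add_one_self[of m] by linarith
  then have lt: "1 - 1 / m < x1" unfolding x1_def using m0
    by (simp add: exp_minus field_simps)
  have pos: "0 < (1 - 1 / m) * m + ln (1 - (1 - 1 / m))"
    using drift_increasing[of 0 "1 - 1 / m"] star by simp
  have "x1 * m + ln (1 - x1) = - (exp (- m) * m)" by (simp add: x1_def algebra_simps)
  then have neg: "x1 * m + ln (1 - x1) < 0" using m0 by simp
  have "\<exists>x. 1 - 1 / m \<le> x \<and> x \<le> x1 \<and> x * m + ln (1 - x) = 0"
    using pos neg lt x1 by (intro IVT2') (auto intro!: continuous_intros)
  then obtain z where z: "1 - 1 / m \<le> z" "z \<le> x1" "z * m + ln (1 - z) = 0" by auto
  have z1: "z < 1" using z x1 by simp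
  have "z \<noteq> 1 - 1 / m" using pos z(3) by auto
  then have z0: "1 - 1 / m < z" using z by simp
  have "limit_fraction K = z"
    unfolding limit_fraction_def m_def[symmetric]
  proof (rule Greatest_equality)
    fix y assume y: "y < 1 \<and> y * m + ln (1 - y) = 0"
    show "y \<le> z"
    proof (rule ccontr)
      assume "\<not> y \<le> z"
      then show False using drift_decreasing[of z y] z0 y z(3) by simp
    qed
  qed (use z z1 in auto)
  then show "1 - 1 / m < q" "q < 1" "q * m + ln (1 - q) = 0"
    using z0 z1 z(3) by (simp_all add: q_def)
qed

lemma q_pos: "0 < q"
  using q_properties(1) m_gt_1 by (smt (verit) divide_le_eq_1)

lemma drift_slope_pos: "0 < 1 / (1 - q) - m"
  using q_properties(1,2) m_gt_1 by (simp add: field_simps)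

lemma drift_pos:
  assumes "0 < x" "x < q" shows "0 < x * m + ln (1 - x)"
proof (cases "x \<le> 1 - 1 / m")
  case True
  then show ?thesis using drift_increasing[of 0 x] assms by simp
next
  case False
  then show ?thesis using drift_decreasing[of x q] assms q_properties by simp
qed

end

section \<open>Riemann sums\<close>

text \<open>For a monotone integrand, each term of the Riemann sum lies between the increments of the
  antiderivative over the two adjacent intervals.\<close>

lemma riemann_sum_bounds:
  fixes f A :: "real \<Rightarrow> real" and n :: real
  assumes n: "0 < n" and c: "1 \<le> c" "c \<le> Suc y" and y: "real (Suc y) / n \<le> b"
    and mono: "\<And>u v. 0 \<le> u \<Longrightarrow> u \<le> v \<Longrightarrow> v \<le> b \<Longrightarrow> f u \<le> f v"
    and deriv: "\<And>u. 0 \<le> u \<Longrightarrow> u \<le> b \<Longrightarrow> (A has_real_derivative f u) (at u)"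
  shows "A (real y / n) - A (real (c - 1) / n) \<le> (\<Sum>r\<in>{c..<Suc y}. f (real r / n)) / n"
    and "(\<Sum>r\<in>{c..<Suc y}. f (real r / n)) / n \<le> A (real (Suc y) / n) - A (real c / n)"
proof -
  have step: "f (real r / n) / n \<le> A (real (Suc r) / n) - A (real r / n)"
    "A (real (Suc r) / n) - A (real r / n) \<le> f (real (Suc r) / n) / n" if "r \<le> y" for r
  proof -
    have le: "real (Suc r) / n \<le> b" using that y n by (smt (verit) divide_right_mono of_nat_0_le_iff of_nat_mono Suc_le_mono)
    have lt: "real r / n < real (Suc r) / n" using n by (simp add: divide_strict_right_mono)
    have r0: "0 \<le> real r / n" using n by simp
    obtain z where z: "real r / n < z" "z < real (Suc r) / n"
      and eq: "A (real (Suc r) / n) - A (real r / n) = (real (Suc r) / n - real r / n) * f z"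
      using MVT2[OF lt, of A f] deriv le r0 by (metis order_trans less_imp_le)
    have "real (Suc r) / n - real r / n = 1 / n" by (simp add: diff_divide_distrib[symmetric])
    then have eq': "A (real (Suc r) / n) - A (real r / n) = f z / n" using eq by simp
    have "f (real r / n) \<le> f z" "f z \<le> f (real (Suc r) / n)"
      using z le r0 by (auto intro!: mono)
    then show "f (real r / n) / n \<le> A (real (Suc r) / n) - A (real r / n)"
      "A (real (Suc r) / n) - A (real r / n) \<le> f (real (Suc r) / n) / n"
      unfolding eq' using n by (auto intro: divide_right_mono)
  qed
  have "A (real (Suc y) / n) - A (real c / n) = (\<Sum>r\<in>{c..<Suc y}. A (real (Suc r) / n) - A (real r / n))"
    using sum_Suc_diff'[OF c(2), of "\<lambda>r. A (real r / n)"] by simp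
  also have "\<dots> \<ge> (\<Sum>r\<in>{c..<Suc y}. f (real r / n) / n)"
    by (intro sum_mono step) auto
  finally show "(\<Sum>r\<in>{c..<Suc y}. f (real r / n)) / n \<le> A (real (Suc y) / n) - A (real c / n)"
    unfolding sum_divide_distrib .
  have "A (real y / n) - A (real (c - 1) / n) = (\<Sum>r\<in>{c - 1..<y}. A (real (Suc r) / n) - A (real r / n))"
    using sum_Suc_diff'[of "c - 1" y "\<lambda>r. A (real r / n)"] c by (simp add: of_nat_diff)
  also have "\<dots> \<le> (\<Sum>r\<in>{c - 1..<y}. f (real (Suc r) / n) / n)"
    by (intro sum_mono step) auto
  also have "\<dots> = (\<Sum>r\<in>{c..<Suc y}. f (real r / n) / n)"
    using sum.shift_bounds_Suc_ivl[of "\<lambda>r. f (real r / n) / n" "c - 1" y] c by simp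
  finally show "A (real y / n) - A (real (c - 1) / n) \<le> (\<Sum>r\<in>{c..<Suc y}. f (real r / n)) / n"
    unfolding sum_divide_distrib .
qed

lemma tendsto_scaled_difference:
  fixes u :: "nat \<Rightarrow> real" and A :: "real \<Rightarrow> real"
  assumes D: "(A has_real_derivative D) (at a)" and u: "(\<lambda>n. sqrt (real n) * (u n - a)) \<longlonglongrightarrow> x"
  shows "(\<lambda>n. sqrt (real n) * (A (u n) - A a)) \<longlonglongrightarrow> x * D"
proof -
  obtain g where g: "\<And>z. A z - A a = g z * (z - a)" "isCont g a" "g a = D"
    using D by (auto simp: CARAT_DERIV)
  have inv: "(\<lambda>n. 1 / sqrt (real n)) \<longlonglongrightarrow> 0" by real_asymp
  have "(\<lambda>n. a + (1 / sqrt (real n)) * (sqrt (real n) * (u n - a))) \<longlonglongrightarrow> a + 0 * x"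
    by (intro tendsto_intros inv u)
  moreover have "\<forall>\<^sub>F n in sequentially. a + (1 / sqrt (real n)) * (sqrt (real n) * (u n - a)) = u n"
    by (rule eventually_sequentiallyI[of 1]) simp
  ultimately have "u \<longlonglongrightarrow> a" by (simp add: Lim_transform_eventually)
  then have "(\<lambda>n. g (u n)) \<longlonglongrightarrow> D" using g(2,3) isCont_tendsto_compose by metis
  then have "(\<lambda>n. (sqrt (real n) * (u n - a)) * g (u n)) \<longlonglongrightarrow> x * D"
    by (intro tendsto_mult u)
  then show ?thesis by (simp add: g(1) mult_ac)
qed

section \<open>Gaussian distribution functions\<close>

lemma cdf_gaussian:
  assumes "0 < V" shows "cdf (gaussian V) z = cdf std_normal_distribution (z / sqrt V)"
proof -
  have "(\<lambda>x. sqrt V * x) -` {..z} = {..z / sqrt V}" using assms by (auto simp: field_simps)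
  then show ?thesis unfolding gaussian_def cdf_def by (subst measure_distr) auto
qed

lemma isCont_cdf_std_normal: "isCont (cdf std_normal_distribution) z"
proof -
  interpret real_distribution std_normal_distribution by (rule real_dist_normal_dist)
  have "emeasure std_normal_distribution {z} = 0"
    by (subst emeasure_density) (auto simp: nn_integral_indicator_singleton)
  then have "measure std_normal_distribution {z} = 0" by (simp add: measure_def)
  then show ?thesis by (simp add: isCont_cdf)
qed

lemma isCont_cdf_gaussian:
  assumes "0 < V" shows "isCont (cdf (gaussian V)) z"
proof -
  have "cdf (gaussian V) = (\<lambda>z. cdf std_normal_distribution (z / sqrt V))"
    by (rule ext) (rule cdf_gaussian[OF assms])
  then show ?thesis
    using assms by (simp only:) (intro isCont_o2[OF _ isCont_cdf_std_normal] continuous_intros, simp)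
qed

lemma density_normal_eq_gaussian:
  assumes "0 < \<sigma>" shows "density lborel (normal_density 0 \<sigma>) = gaussian (\<sigma>\<^sup>2)"
proof -
  interpret prob_space std_normal_distribution
    using real_dist_normal_dist by (simp add: real_distribution_def)
  have "distributed std_normal_distribution lborel (\<lambda>x. x) (normal_density 0 1)"
    unfolding distributed_def by (auto simp: distr_id2 real_distribution_def)
  from normal_density_affine[OF this, of \<sigma> 0] assms
  have "distributed std_normal_distribution lborel (\<lambda>x. \<sigma> * x) (normal_density 0 \<sigma>)" by simp
  then have "distr std_normal_distribution lborel (\<lambda>x. \<sigma> * x) = density lborel (normal_density 0 \<sigma>)"
    by (simp add: distributed_def)
  moreover have "distr std_normal_distribution lborel (\<lambda>x. \<sigma> * x) = gaussian (\<sigma>\<^sup>2)"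
    unfolding gaussian_def using assms by (intro distr_cong) auto
  ultimately show ?thesis by simp
qed

lemma weak_conv_tail:
  assumes M: "\<And>n. real_distribution (M n)" and lim: "weak_conv_m M M'"
    and cont: "\<And>x. isCont (cdf M') x" and b: "b \<longlonglongrightarrow> b0"
  shows "(\<lambda>n. measure (M n) {b n..}) \<longlonglongrightarrow> 1 - cdf M' b0"
proof (rule LIMSEQ_I)
  fix e :: real assume e: "0 < e"
  obtain d where d: "0 < d" and close: "\<And>x. \<bar>x - b0\<bar> \<le> d \<Longrightarrow> \<bar>cdf M' x - cdf M' b0\<bar> < e / 2"
  proof -
    from cont[of b0] e obtain s where s: "0 < s" "\<And>x. \<bar>x - b0\<bar> < s \<Longrightarrow> \<bar>cdf M' x - cdf M' b0\<bar> < e / 2"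
      unfolding isCont_def LIM_def by (metis dist_real_def half_gt_zero abs_zero cancel_comm_monoid_add_class.diff_cancel)
    show ?thesis by (rule that[of "s / 2"]) (use s in auto)
  qed
  have lim': "(\<lambda>n. cdf (M n) x) \<longlonglongrightarrow> cdf M' x" for x
    using lim cont by (simp add: weak_conv_m_def weak_conv_def)
  have "\<forall>\<^sub>F n in sequentially. \<bar>b n - b0\<bar> < d"
    using tendstoD[OF b d] by (simp add: dist_real_def)
  moreover have "\<forall>\<^sub>F n in sequentially. \<bar>cdf (M n) (b0 + d) - cdf M' (b0 + d)\<bar> < e / 2"
    using tendstoD[OF lim', of "e / 2"] e by (simp add: dist_real_def)
  moreover have "\<forall>\<^sub>F n in sequentially. \<bar>cdf (M n) (b0 - d) - cdf M' (b0 - d)\<bar> < e / 2"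
    using tendstoD[OF lim', of "e / 2"] e by (simp add: dist_real_def)
  ultimately have "\<forall>\<^sub>F n in sequentially. norm (measure (M n) {b n..} - (1 - cdf M' b0)) < e"
  proof eventually_elim
    case (elim n)
    interpret real_distribution "M n" by (rule M)
    have tail: "measure (M n) {x<..} = 1 - cdf (M n) x" for x
    proof -
      have "{x<..} = space (M n) - {..x}" by auto
      then show ?thesis using prob_compl[of "{..x}"] by (simp add: cdf_def)
    qed
    have "measure (M n) {b0 + d<..} \<le> measure (M n) {b n..}"
      by (intro finite_measure_mono) (use elim in auto)
    moreover have "measure (M n) {b n..} \<le> measure (M n) {b0 - d<..}"
      by (intro finite_measure_mono) (use elim in auto)
    moreover have "\<bar>cdf M' (b0 + d) - cdf M' b0\<bar> < e / 2" "\<bar>cdf M' (b0 - d) - cdf M' b0\<bar> < e / 2"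
      using close d by auto
    ultimately show ?case using elim(2,3) unfolding tail real_norm_def by linarith
  qed
  then show "\<exists>no. \<forall>n\<ge>no. norm (measure (M n) {b n..} - (1 - cdf M' b0)) < e"
    by (simp add: eventually_sequentially)
qed

section \<open>The central limit theorem for the walk\<close>

lemma sum_list_walk:
  "sum_list (map F (walk n K T c y)) = real T * F (map_pmf real K) + (\<Sum>r\<in>{c..<Suc y}. F (neg_wait (hit n r)))"
  by (simp add: walk_def sum_list_replicate o_def interv_sum_list_conv_sum_set_nat del: upt_Suc)

lemma hit_eq: "r \<le> n \<Longrightarrow> 0 < n \<Longrightarrow> hit n r = 1 - real r / real n"
  by (simp add: hit_def of_nat_diff diff_divide_distrib)

lemma DERIV_minus_ln_one_minus:
  "u < 1 \<Longrightarrow> ((\<lambda>u. - ln (1 - u)) has_real_derivative 1 / (1 - u)) (at u)"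
  by (auto intro!: derivative_eq_intros simp: field_simps)

lemma DERIV_wait_variance:
  assumes "u < 1"
  shows "((\<lambda>u. 1 / (1 - u) + ln (1 - u)) has_real_derivative u / (1 - u)\<^sup>2) (at u)"
proof -
  have "u / (1 - u)\<^sup>2 = 1 / (1 - u)\<^sup>2 - 1 / (1 - u)"
    using assms by (simp add: divide_simps power2_eq_square)
  then show ?thesis
    using assms by (auto intro!: derivative_eq_intros simp: power2_eq_square)
qed

context supercritical
begin

definition \<sigma>2 :: real where "\<sigma>2 = m2 - m\<^sup>2"

lemma K_moments:
  "square_integrable (map_pmf real K)" "mean (map_pmf real K) = m" "var (map_pmf real K) = \<sigma>2"
proof -
  show "square_integrable (map_pmf real K)" using K2 by (simp add: square_integrable_def)
  show "mean (map_pmf real K) = m" by (simp add: mean_def m_def)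
  have "var (map_pmf real K) = measure_pmf.variance K real"
    by (simp add: var_def mean_def)
  also have "\<dots> = \<sigma>2"
    unfolding \<sigma>2_def m_def m2_def using K1 K2 by (rule measure_pmf.variance_eq)
  finally show "var (map_pmf real K) = \<sigma>2" .
qed

lemma \<sigma>2_nonneg: "0 \<le> \<sigma>2"
  using m2_ge by (simp add: \<sigma>2_def)

text \<open>The variance per server of the walk with \<open>T = y = n q\<close>: the resources contribute \<open>q \<sigma>2\<close>, and the waiting
  times contribute the integral of \<open>u / (1 - u)\<^sup>2\<close> over \<open>[0, q]\<close>.\<close>

definition V :: real where "V = q * \<sigma>2 + q / (1 - q) + ln (1 - q)"

lemma V_pos: "0 < V"
proof -
  have "ln (1 / (1 - q)) \<le> 1 / (1 - q) - 1"
    using q_properties(2) by (intro ln_le_minus_one) simp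
  moreover have "ln (1 / (1 - q)) \<noteq> 1 / (1 - q) - 1"
    using ln_eq_minus_one[of "1 / (1 - q)"] q_pos q_properties(2) by auto
  ultimately have "ln (1 / (1 - q)) < 1 / (1 - q) - 1" by simp
  then have "0 < q / (1 - q) + ln (1 - q)"
    using q_pos q_properties(2) by (simp add: ln_div field_simps)
  moreover have "0 \<le> q * \<sigma>2" using q_pos \<sigma>2_nonneg by simp
  ultimately show ?thesis unfolding V_def by linarith
qed

lemma K_lindeberg:
  "(\<lambda>n. measure_pmf.expectation (map_pmf real K)
     (\<lambda>x. min (6 * (x - m)\<^sup>2) (\<bar>t / sqrt (real n)\<bar> * \<bar>x - m\<bar> ^ 3))) \<longlonglongrightarrow> 0"
proof -
  have pt: "(\<lambda>n. min (6 * (x - m)\<^sup>2) (\<bar>t / sqrt (real n)\<bar> * \<bar>x - m\<bar> ^ 3)) \<longlonglongrightarrow> 0" for x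
  proof (rule tendsto_sandwich[of "\<lambda>_. 0" _ _ "\<lambda>n. \<bar>t\<bar> * \<bar>x - m\<bar> ^ 3 * (1 / sqrt (real n))"])
    have "(\<lambda>n. 1 / sqrt (real n)) \<longlonglongrightarrow> 0" by real_asymp
    from tendsto_mult_left[OF this, of "\<bar>t\<bar> * \<bar>x - m\<bar> ^ 3"]
    show "(\<lambda>n. \<bar>t\<bar> * \<bar>x - m\<bar> ^ 3 * (1 / sqrt (real n))) \<longlonglongrightarrow> 0" by simp
  qed (auto simp: abs_divide)
  have "(\<lambda>n. measure_pmf.expectation (map_pmf real K)
     (\<lambda>x. min (6 * (x - m)\<^sup>2) (\<bar>t / sqrt (real n)\<bar> * \<bar>x - m\<bar> ^ 3))) \<longlonglongrightarrow>
     measure_pmf.expectation (map_pmf real K) (\<lambda>x. 0)"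
    using pt square_integrableD(2)[OF K_moments(1), of m]
    by (intro integral_dominated_convergence[where w="\<lambda>x. 6 * (x - m)\<^sup>2"]) auto
  then show ?thesis by simp
qed

text \<open>The limit does not depend on \<open>c\<close>, nor on bounded changes of \<open>T\<close> and \<open>y\<close>. This is why the first bursts
  have no influence on the fluctuations.\<close>

theorem walk_clt:
  assumes T: "(\<lambda>n. (real (T n) - real n * q) / sqrt (real n)) \<longlonglongrightarrow> x"
    and y: "(\<lambda>n. (real (y n) - real n * q) / sqrt (real n)) \<longlonglongrightarrow> x"
    and c: "1 \<le> c"
  shows "(\<lambda>n. measure_pmf.prob (sum_pmf (walk n K (T n) c (y n))) {0..})
    \<longlonglongrightarrow> 1 - cdf (gaussian V) (x * (1 / (1 - q) - m))"
proof -
  define b where "b = (1 + q) / 2"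
  have b: "q < b" "b < 1" "0 < b" using q_pos q_properties(2) by (auto simp: b_def)
  have frac: "(\<lambda>n. real (z n) / real n) \<longlonglongrightarrow> q" if "(\<lambda>n. (real (z n) - real n * q) / sqrt (real n)) \<longlonglongrightarrow> x" for z
  proof -
    have "(\<lambda>n. 1 / sqrt (real n)) \<longlonglongrightarrow> 0" by real_asymp
    then have "(\<lambda>n. q + (1 / sqrt (real n)) * ((real (z n) - real n * q) / sqrt (real n))) \<longlonglongrightarrow> q + 0 * x"
      by (intro tendsto_intros that)
    moreover have "\<forall>\<^sub>F n in sequentially. q + (1 / sqrt (real n)) * ((real (z n) - real n * q) / sqrt (real n)) = real (z n) / real n"
      by (rule eventually_sequentiallyI[of 1]) (simp add: field_simps)
    ultimately show ?thesis by (simp add: Lim_transform_eventually)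
  qed
  have inv_n: "(\<lambda>n. k / real n) \<longlonglongrightarrow> 0" for k :: real by (rule lim_const_over_n)
  have Sy: "(\<lambda>n. real (Suc (y n)) / real n) \<longlonglongrightarrow> q"
    using tendsto_add[OF frac[OF y] inv_n[of 1]] by (simp add: add_divide_distrib add.commute)
  \<comment> \<open>for the finitely many other \<open>n\<close> the walk is replaced by the empty sum, so that the bounds
    below hold for all \<open>n\<close>\<close>
  define good where "good n \<longleftrightarrow> 0 < n \<and> c \<le> Suc (y n) \<and> real (Suc (y n)) / real n \<le> b \<and> real (T n) / real n \<le> 1" for n
  have ev_good: "\<forall>\<^sub>F n in sequentially. good n"
  proof -
    have 1: "\<forall>\<^sub>F n in sequentially. real (Suc (y n)) / real n < b"
      using Sy b(1) by (rule order_tendstoD)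
    have 2: "\<forall>\<^sub>F n in sequentially. real (T n) / real n < 1"
      using frac[OF T] q_properties(2) by (rule order_tendstoD)
    have 3: "\<forall>\<^sub>F n in sequentially. real c / real n < q / 2"
      using inv_n[of "real c"] q_pos by (intro order_tendstoD) auto
    have 4: "\<forall>\<^sub>F n in sequentially. q / 2 < real (Suc (y n)) / real n"
      using Sy q_pos by (intro order_tendstoD) auto
    show ?thesis using 1 2 3 4 eventually_gt_at_top[of 0]
    proof eventually_elim
      case (elim n)
      then have "real c / real n < real (Suc (y n)) / real n" by linarith
      then have "c < Suc (y n)" using elim(5) by (simp add: divide_less_cancel)
      then show ?case using elim unfolding good_def by simp
    qed
  qed
  define qs where "qs n = (if good n then walk n K (T n) c (y n) else [])" for n
  define \<pi>0 where "\<pi>0 = (1 - b) / 2"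
  \<comment> \<open>a uniform lower bound for the success probabilities up to \<open>y n\<close>\<close>
  have \<pi>0: "0 < \<pi>0" "\<pi>0 < 1" using b by (auto simp: \<pi>0_def)
  have range: "r \<le> n" "real r / real n \<le> b" "\<pi>0 \<le> hit n r" "0 < hit n r" "hit n r \<le> 1" if "good n" "r < Suc (y n)" for n r
  proof -
    have n: "0 < n" "real (Suc (y n)) / real n \<le> b" using that by (auto simp: good_def)
    have "real r / real n \<le> real (Suc (y n)) / real n" using that by (intro divide_right_mono) auto
    then show rb: "real r / real n \<le> b" using n by simp
    then have "real r / real n \<le> 1" using b by simp
    then show rn: "r \<le> n" using n by simp
    have "(1 - b) / 2 \<le> 1 - u" "0 < 1 - u" if "u \<le> b" for u
      using that b by (auto simp: field_simps)
    from this[OF rb] show "\<pi>0 \<le> hit n r" "0 < hit n r"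
      unfolding hit_eq[OF rn n(1)] \<pi>0_def .
    show "hit n r \<le> 1" by (rule hit_bounds)
  qed
  have set_walk: "p' = map_pmf real K \<or> (\<exists>r. p' = neg_wait (hit n r) \<and> r < Suc (y n))" if "p' \<in> set (qs n)" for p' n
    using that by (auto simp: qs_def walk_def set_replicate_conv_if split: if_splits)
  define C3 where "C3 = (\<Sum>k. (1 - \<pi>0) ^ k * (real k + (1 + 1 / \<pi>0)) ^ 3)"
  have C3: "0 \<le> C3" unfolding C3_def using \<pi>0 by (intro suminf_nonneg summable_cubic_geometric) auto
  have sq: "square_integrable p'" if "p' \<in> set (qs n)" for p' n
  proof -
    have "good n" using that by (auto simp: qs_def split: if_splits)
    then show ?thesis using set_walk[OF that] range K_moments(1) square_integrable_wait by blast
  qed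
  have var_bound: "var p' \<le> \<sigma>2 + 1 / \<pi>0\<^sup>2" if "p' \<in> set (qs n)" for p' n
  proof -
    have g: "good n" using that by (auto simp: qs_def split: if_splits)
    note mem = set_walk[OF that]
    consider "p' = map_pmf real K" | r where "p' = neg_wait (hit n r)" "r < Suc (y n)" using mem by auto
    then show ?thesis
    proof cases
      case 1 then show ?thesis by (simp add: K_moments)
    next
      case 2
      note rg = range[OF g 2(2)]
      have "(1 - hit n r) / (hit n r)\<^sup>2 \<le> 1 / \<pi>0\<^sup>2"
        using rg \<pi>0 by (intro frac_le power_mono) auto
      then show ?thesis using 2 rg var_wait \<sigma>2_nonneg by simp
    qed
  qed
  have le_n: "real (Suc (y n)) \<le> real n" "real (T n) \<le> real n" if "good n" for n
  proof -
    have n: "0 < real n" and T1: "real (T n) / real n \<le> 1" using that by (simp_all only: good_def of_nat_0_less_iff)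
    have "real (Suc (y n)) / real n \<le> 1"
      using that b(2) unfolding good_def by (meson less_imp_le order_trans)
    then show "real (Suc (y n)) \<le> real n" "real (T n) \<le> real n"
      using n T1 by (simp_all only: divide_le_eq_1_pos)
  qed
  have len: "real (length (qs n)) \<le> 2 * real n" for n
  proof (cases "good n")
    case True
    then show ?thesis using le_n[OF True] by (simp add: qs_def walk_def del: upt_Suc)
  qed (simp add: qs_def)
  have Vlim: "(\<lambda>n. (\<Sum>p'\<leftarrow>qs n. var p') / real n) \<longlonglongrightarrow> V"
  proof -
    define A where "A u = 1 / (1 - u) + ln (1 - u)" for u :: real
    have contA: "isCont A u" if "u < 1" for u unfolding A_def using that by (intro continuous_intros) auto
    define R where "R n = (\<Sum>r\<in>{c..<Suc (y n)}. (real r / real n) / (1 - real r / real n)\<^sup>2) / real n" for n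
    have Rb: "A (real (y n) / real n) - A (real (c - 1) / real n) \<le> R n \<and> R n \<le> A (real (Suc (y n)) / real n) - A (real c / real n)"
      if g: "good n" for n
    proof -
      have mono: "u / (1 - u)\<^sup>2 \<le> v / (1 - v)\<^sup>2" if "0 \<le> u" "u \<le> v" "v \<le> b" for u v
        using that b by (intro frac_le power_mono) auto
      have der: "(A has_real_derivative u / (1 - u)\<^sup>2) (at u)" if "0 \<le> u" "u \<le> b" for u
        unfolding A_def using that b by (intro DERIV_wait_variance) auto
      have n: "0 < real n" "c \<le> Suc (y n)" "real (Suc (y n)) / real n \<le> b"
        using g by (simp_all only: good_def of_nat_0_less_iff)
      show ?thesis unfolding R_def using riemann_sum_bounds[OF n(1) c n(2,3) mono der] by blast
    qed
    have lims: "(\<lambda>n. A (real (y n) / real n)) \<longlonglongrightarrow> A q" "(\<lambda>n. A (real (Suc (y n)) / real n)) \<longlonglongrightarrow> A q"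
      "(\<lambda>n. A (real (c - 1) / real n)) \<longlonglongrightarrow> A 0" "(\<lambda>n. A (real c / real n)) \<longlonglongrightarrow> A 0"
      using q_properties(2) by (intro isCont_tendsto_compose[OF contA] frac[OF y] Sy inv_n, simp)+
    have Rlim: "R \<longlonglongrightarrow> A q - A 0"
      by (rule tendsto_sandwich[OF _ _ tendsto_diff[OF lims(1,3)] tendsto_diff[OF lims(2,4)]])
         (use ev_good Rb in \<open>auto elim: eventually_mono\<close>)
    have "q * \<sigma>2 + (A q - A 0) = V"
      using q_properties(2) by (simp add: V_def A_def field_simps)
    then have "(\<lambda>n. (real (T n) / real n) * \<sigma>2 + R n) \<longlonglongrightarrow> V"
      using tendsto_add[OF tendsto_mult_right[OF frac[OF T], of \<sigma>2] Rlim] by simp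
    moreover have "\<forall>\<^sub>F n in sequentially. (real (T n) / real n) * \<sigma>2 + R n = (\<Sum>p'\<leftarrow>qs n. var p') / real n"
      using ev_good
    proof eventually_elim
      case (elim n)
      have n: "0 < n" using elim by (simp add: good_def)
      have "var (neg_wait (hit n r)) = (real r / real n) / (1 - real r / real n)\<^sup>2" if "r < Suc (y n)" for r
        using range[OF elim that] n var_wait[of "hit n r"] hit_eq[of r n] by simp
      then have "(\<Sum>r\<in>{c..<Suc (y n)}. var (neg_wait (hit n r))) = (\<Sum>r\<in>{c..<Suc (y n)}. (real r / real n) / (1 - real r / real n)\<^sup>2)"
        by (intro sum.cong) auto
      then show ?case
        using elim by (simp only: qs_def if_True sum_list_walk K_moments R_def add_divide_distrib) simp
    qed
    ultimately show ?thesis by (rule Lim_transform_eventually)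
  qed
  have lind: "(\<lambda>n. (\<Sum>p'\<leftarrow>qs n. measure_pmf.expectation p'
        (\<lambda>x. min (6 * (x - mean p')\<^sup>2) (\<bar>t / sqrt (real n)\<bar> * \<bar>x - mean p'\<bar> ^ 3))) / real n) \<longlonglongrightarrow> 0" for t
  proof -
    define F where "F n p' = measure_pmf.expectation p'
        (\<lambda>x. min (6 * (x - mean p')\<^sup>2) (\<bar>t / sqrt (real n)\<bar> * \<bar>x - mean p'\<bar> ^ 3))" for n :: nat and p'
    have F0: "0 \<le> F n p'" for n p' unfolding F_def by (intro integral_nonneg_AE) auto
    have Fw: "F n (neg_wait \<pi>) \<le> \<bar>t / sqrt (real n)\<bar> * C3" if "\<pi>0 \<le> \<pi>" "\<pi> \<le> 1" for n \<pi>
    proof -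
      note tm = wait_third_moment[OF \<pi>0 that]
      have "square_integrable (neg_wait \<pi>)" using that \<pi>0 by (intro square_integrable_wait) auto
      note sq' = square_integrableD(2)[OF this, of "mean (neg_wait \<pi>)"]
      have "F n (neg_wait \<pi>) \<le> measure_pmf.expectation (neg_wait \<pi>) (\<lambda>x. \<bar>t / sqrt (real n)\<bar> * \<bar>x - mean (neg_wait \<pi>)\<bar> ^ 3)"
        unfolding F_def
      proof (rule integral_mono)
        show "integrable (measure_pmf (neg_wait \<pi>)) (\<lambda>x. min (6 * (x - mean (neg_wait \<pi>))\<^sup>2) (\<bar>t / sqrt (real n)\<bar> * \<bar>x - mean (neg_wait \<pi>)\<bar> ^ 3))"
          by (intro integrable_min integrable_mult_right sq' tm(1))
        show "integrable (measure_pmf (neg_wait \<pi>)) (\<lambda>x. \<bar>t / sqrt (real n)\<bar> * \<bar>x - mean (neg_wait \<pi>)\<bar> ^ 3)"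
          by (intro integrable_mult_right tm(1))
      qed (rule min.cobounded2)
      also have "\<dots> \<le> \<bar>t / sqrt (real n)\<bar> * C3"
        unfolding C3_def integral_mult_right_zero by (intro mult_left_mono tm(2) abs_ge_zero)
      finally show ?thesis .
    qed
    have up: "(\<Sum>p'\<leftarrow>qs n. F n p') / real n \<le> F n (map_pmf real K) + \<bar>t / sqrt (real n)\<bar> * C3" for n
    proof (cases "good n")
      case True
      have n: "0 < real n" using True by (simp add: good_def)
      note le = le_n[OF True]
      have "(\<Sum>r\<in>{c..<Suc (y n)}. F n (neg_wait (hit n r))) \<le> real (card {c..<Suc (y n)}) * (\<bar>t / sqrt (real n)\<bar> * C3)"
        using range[OF True] Fw by (intro sum_bounded_above) auto
      also have "\<dots> \<le> real n * (\<bar>t / sqrt (real n)\<bar> * C3)"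
        using le C3 by (intro mult_right_mono mult_nonneg_nonneg) auto
      finally have 1: "(\<Sum>r\<in>{c..<Suc (y n)}. F n (neg_wait (hit n r))) \<le> real n * (\<bar>t / sqrt (real n)\<bar> * C3)" .
      have 2: "real (T n) * F n (map_pmf real K) \<le> real n * F n (map_pmf real K)"
        using le F0 by (intro mult_right_mono) auto
      have "(\<Sum>p'\<leftarrow>qs n. F n p') \<le> real n * F n (map_pmf real K) + real n * (\<bar>t / sqrt (real n)\<bar> * C3)"
        using True 1 2 by (simp add: qs_def sum_list_walk)
      then show ?thesis using n by (simp add: pos_divide_le_eq algebra_simps)
    next
      case False
      then show ?thesis using F0 C3 by (simp add: qs_def)
    qed
    have "(\<lambda>n. 1 / sqrt (real n)) \<longlonglongrightarrow> 0" by real_asymp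
    then have "(\<lambda>n. \<bar>t * (1 / sqrt (real n))\<bar>) \<longlonglongrightarrow> 0"
      by (intro tendsto_rabs_zero tendsto_mult_right_zero)
    then have "(\<lambda>n. \<bar>t / sqrt (real n)\<bar>) \<longlonglongrightarrow> 0" by (simp only: times_divide_eq_right mult_1_right)
    then have upl: "(\<lambda>n. F n (map_pmf real K) + \<bar>t / sqrt (real n)\<bar> * C3) \<longlonglongrightarrow> 0"
      using K_lindeberg[of t] unfolding F_def K_moments(2) by (intro tendsto_add_zero tendsto_mult_left_zero)
    have "(\<lambda>n. (\<Sum>p'\<leftarrow>qs n. F n p') / real n) \<longlonglongrightarrow> 0"
    proof (rule tendsto_sandwich[OF _ _ tendsto_const upl])
      show "\<forall>\<^sub>F n in sequentially. 0 \<le> (\<Sum>p'\<leftarrow>qs n. F n p') / real n"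
        by (auto intro!: always_eventually divide_nonneg_nonneg sum_list_nonneg F0)
      show "\<forall>\<^sub>F n in sequentially. (\<Sum>p'\<leftarrow>qs n. F n p') / real n \<le> F n (map_pmf real K) + \<bar>t / sqrt (real n)\<bar> * C3"
        by (rule always_eventually, rule allI, rule up)
    qed
    then show ?thesis unfolding F_def .
  qed
  define \<mu> where "\<mu> n = (\<Sum>p'\<leftarrow>qs n. mean p')" for n
  have mean_lim: "(\<lambda>n. - \<mu> n / sqrt (real n)) \<longlonglongrightarrow> x * (1 / (1 - q) - m)"
  proof -
    define A where "A u = - ln (1 - u)" for u :: real
    have Aq: "A q = q * m" using q_properties(3) by (simp add: A_def)
    have A0: "A 0 = 0" by (simp add: A_def)
    have DA: "(A has_real_derivative 1 / (1 - u)) (at u)" if "u < 1" for u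
      unfolding A_def using that by (rule DERIV_minus_ln_one_minus)
    define R where "R n = (\<Sum>r\<in>{c..<Suc (y n)}. 1 / (1 - real r / real n)) / real n" for n
    have Rb: "A (real (y n) / real n) - A (real (c - 1) / real n) \<le> R n \<and> R n \<le> A (real (Suc (y n)) / real n) - A (real c / real n)"
      if g: "good n" for n
    proof -
      have mono: "1 / (1 - u) \<le> 1 / (1 - v)" if "0 \<le> u" "u \<le> v" "v \<le> b" for u v
        using that b by (intro frac_le) auto
      have der: "(A has_real_derivative 1 / (1 - u)) (at u)" if "0 \<le> u" "u \<le> b" for u
        using that b by (intro DA) auto
      have n: "0 < real n" "c \<le> Suc (y n)" "real (Suc (y n)) / real n \<le> b"
        using g by (simp_all only: good_def of_nat_0_less_iff)
      show ?thesis unfolding R_def using riemann_sum_bounds[OF n(1) c n(2,3) mono der] by blast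
    qed
    have root: "(\<lambda>n. sqrt (real n) * (real k / real n - 0)) \<longlonglongrightarrow> 0" for k by real_asymp
    have sy: "(\<lambda>n. sqrt (real n) * (real (y n) / real n - q)) \<longlonglongrightarrow> x"
    proof (rule Lim_transform_eventually[OF y])
      show "\<forall>\<^sub>F n in sequentially. (real (y n) - real n * q) / sqrt (real n) = sqrt (real n) * (real (y n) / real n - q)"
        by (rule eventually_sequentiallyI[of 1]) (simp add: field_simps)
    qed
    have "(\<lambda>n. sqrt (real n) * (real (y n) / real n - q) + sqrt (real n) * (real 1 / real n - 0)) \<longlonglongrightarrow> x + 0"
      by (intro tendsto_add sy root)
    then have sSy: "(\<lambda>n. sqrt (real n) * (real (Suc (y n)) / real n - q)) \<longlonglongrightarrow> x"
      by (simp add: algebra_simps add_divide_distrib)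
    note sd = tendsto_scaled_difference[OF DA]
    have l: "(\<lambda>n. sqrt (real n) * (A (real (y n) / real n) - A q) - sqrt (real n) * (A (real (c - 1) / real n) - A 0)
         - m * ((real (T n) - real n * q) / sqrt (real n))) \<longlonglongrightarrow> x * (1 / (1 - q)) - 0 * (1 / (1 - 0)) - m * x"
      using q_properties(2) by (intro tendsto_intros sd sy root T) auto
    have u: "(\<lambda>n. sqrt (real n) * (A (real (Suc (y n)) / real n) - A q) - sqrt (real n) * (A (real c / real n) - A 0)
         - m * ((real (T n) - real n * q) / sqrt (real n))) \<longlonglongrightarrow> x * (1 / (1 - q)) - 0 * (1 / (1 - 0)) - m * x"
      using q_properties(2) by (intro tendsto_intros sd sSy root T) auto
    have \<mu>_eq: "- \<mu> n / sqrt (real n) = sqrt (real n) * (R n - q * m) - m * ((real (T n) - real n * q) / sqrt (real n))" if "good n" for n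
    proof -
      have n: "0 < n" using that by (simp add: good_def)
      have "mean (neg_wait (hit n r)) = - (1 / (1 - real r / real n))" if "r < Suc (y n)" for r
        using range[OF \<open>good n\<close> that] n mean_wait[of "hit n r"] hit_eq[of r n] by simp
      then have "(\<Sum>r\<in>{c..<Suc (y n)}. mean (neg_wait (hit n r))) = (\<Sum>r\<in>{c..<Suc (y n)}. - (1 / (1 - real r / real n)))"
        by (intro sum.cong) auto
      then have \<mu>: "\<mu> n = real (T n) * m - real n * R n"
        using that n by (simp add: \<mu>_def qs_def sum_list_walk K_moments R_def sum_negf del: sum.op_ivl_Suc)
      have "real n / sqrt (real n) = sqrt (real n)" by (rule real_div_sqrt) simp
      then have s: "sqrt (real n) * z = real n * z / sqrt (real n)" for z
        by (metis times_divide_eq_left)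
      show ?thesis unfolding s \<mu> by (simp add: diff_divide_distrib algebra_simps add_divide_distrib)
    qed
    have "(\<lambda>n. - \<mu> n / sqrt (real n)) \<longlonglongrightarrow> x * (1 / (1 - q)) - 0 * (1 / (1 - 0)) - m * x"
    proof (rule tendsto_sandwich[OF _ _ l u])
      show "\<forall>\<^sub>F n in sequentially. sqrt (real n) * (A (real (y n) / real n) - A q) - sqrt (real n) * (A (real (c - 1) / real n) - A 0)
         - m * ((real (T n) - real n * q) / sqrt (real n)) \<le> - \<mu> n / sqrt (real n)"
        using ev_good
      proof eventually_elim
        case (elim n)
        have "sqrt (real n) * (A (real (y n) / real n) - A (real (c - 1) / real n)) \<le> sqrt (real n) * R n"
          using Rb[OF elim] by (intro mult_left_mono) auto
        then show ?case unfolding \<mu>_eq[OF elim] Aq A0 by (simp add: algebra_simps)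
      qed
      show "\<forall>\<^sub>F n in sequentially. - \<mu> n / sqrt (real n) \<le> sqrt (real n) * (A (real (Suc (y n)) / real n) - A q) - sqrt (real n) * (A (real c / real n) - A 0)
         - m * ((real (T n) - real n * q) / sqrt (real n))"
        using ev_good
      proof eventually_elim
        case (elim n)
        have "sqrt (real n) * R n \<le> sqrt (real n) * (A (real (Suc (y n)) / real n) - A (real c / real n))"
          using Rb[OF elim] by (intro mult_left_mono) auto
        then show ?case unfolding \<mu>_eq[OF elim] Aq A0 by (simp add: algebra_simps)
      qed
    qed
    then show ?thesis by (simp add: algebra_simps)
  qed
  let ?M = "\<lambda>n. distr (sum_pmf (qs n)) borel (\<lambda>x. (x - \<mu> n) / sqrt (real n))"
  have "weak_conv_m ?M (gaussian V)"
    unfolding \<mu>_def using V_pos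
    by (intro clt_independent_array[where B="\<sigma>2 + 1 / \<pi>0\<^sup>2" and C=2] sq var_bound len Vlim lind) auto
  moreover have "real_distribution (?M n)" for n
    by (rule prob_space.real_distribution_distr[OF measure_pmf.prob_space_axioms]) simp
  ultimately have "(\<lambda>n. measure (?M n) {- \<mu> n / sqrt (real n)..}) \<longlonglongrightarrow> 1 - cdf (gaussian V) (x * (1 / (1 - q) - m))"
    using mean_lim isCont_cdf_gaussian[OF V_pos] by (intro weak_conv_tail) auto
  moreover have "\<forall>\<^sub>F n in sequentially. measure (?M n) {- \<mu> n / sqrt (real n)..} = measure_pmf.prob (sum_pmf (walk n K (T n) c (y n))) {0..}"
    using ev_good
  proof eventually_elim
    case (elim n)
    then have "0 < sqrt (real n)" by (simp add: good_def)
    then have "- \<mu> n / sqrt (real n) \<le> (z - \<mu> n) / sqrt (real n) \<longleftrightarrow> 0 \<le> z" for z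
      unfolding divide_le_cancel by simp
    then have "(\<lambda>x. (x - \<mu> n) / sqrt (real n)) -` {- \<mu> n / sqrt (real n)..} = {0..}"
      by (simp only: vimage_def atLeast_def mem_Collect_eq)
    then show ?case using elim by (subst measure_distr) (auto simp: qs_def)
  qed
  ultimately show ?thesis by (rule Lim_transform_eventually)
qed

end

section \<open>The ideal process\<close>

lemma integrable_attempts:
  assumes "\<And>c. 0 \<le> \<phi> c" "\<And>c. \<phi> c \<le> B"
  shows "integrable (measure_pmf K) (\<lambda>k. attempts n k \<phi> c)"
  using attempts_bounds[OF assms] by (intro integrable_bounded_pmf[where B=B]) simp

lemma attempts_cong: "(\<And>d. c \<le> d \<Longrightarrow> \<phi> d = \<psi> d) \<Longrightarrow> attempts n k \<phi> c = attempts n k \<psi> c"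
  by (induction k arbitrary: c) auto

lemma attempts_le: "(\<And>d. c \<le> d \<Longrightarrow> \<phi> d \<le> \<psi> d) \<Longrightarrow> attempts n k \<phi> c \<le> attempts n k \<psi> c"
proof (induction k arbitrary: c)
  case (Suc k)
  have "attempts n k \<phi> (Suc c) \<le> attempts n k \<psi> (Suc c)" "attempts n k \<phi> c \<le> attempts n k \<psi> c"
    using Suc.prems by (auto intro!: Suc.IH)
  then show ?case using hit_bounds[of n c] by (auto intro!: add_mono mult_left_mono)
qed simp

lemma attempts_linear: "attempts n k (\<lambda>d. a * \<phi> d + b * \<psi> d) c = a * attempts n k \<phi> c + b * attempts n k \<psi> c"
  by (induction k arbitrary: c) (auto simp: algebra_simps)

lemma attempts_mono:
  assumes "mono \<phi>" shows "mono (attempts n k \<phi>)"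
proof (induction k)
  case (Suc k)
  have step: "attempts n (Suc k) \<phi> c \<le> attempts n (Suc k) \<phi> (Suc c)" for c
  proof -
    have le: "attempts n k \<phi> c \<le> attempts n k \<phi> (Suc c)" "attempts n k \<phi> (Suc c) \<le> attempts n k \<phi> (Suc (Suc c))"
      using Suc by (auto simp: mono_def)
    have "attempts n (Suc k) \<phi> c \<le> attempts n k \<phi> (Suc c)"
      using le hit_bounds[of n c] by (simp add: convex_bound_le)
    also have "attempts n k \<phi> (Suc c) = hit n (Suc c) * attempts n k \<phi> (Suc c) + (1 - hit n (Suc c)) * attempts n k \<phi> (Suc c)"
      by (simp add: algebra_simps)
    also have "\<dots> \<le> attempts n (Suc k) \<phi> (Suc c)"
      unfolding attempts.simps using le hit_bounds[of n "Suc c"] by (intro add_mono mult_left_mono) auto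
    finally show ?thesis .
  qed
  then show ?case by (rule mono_iff_le_Suc[THEN iffD2, rule_format])
qed (use assms in \<open>simp add: mono_def\<close>)

lemma ideal_burst_le:
  assumes "\<And>c. 0 \<le> \<phi> c" "\<And>c. \<phi> c \<le> B" "\<And>c. 0 \<le> \<psi> c" "\<And>c. \<psi> c \<le> B'" "\<And>d. c \<le> d \<Longrightarrow> \<phi> d \<le> \<psi> d"
  shows "ideal_burst n K \<phi> c \<le> ideal_burst n K \<psi> c"
  unfolding ideal_burst_def
  by (intro integral_mono integrable_attempts[OF assms(1,2)] integrable_attempts[OF assms(3,4)] attempts_le assms(5))

lemma ideal_burst_linear:
  assumes "\<And>c. 0 \<le> \<phi> c" "\<And>c. \<phi> c \<le> B" "\<And>c. 0 \<le> \<psi> c" "\<And>c. \<psi> c \<le> B'"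
  shows "ideal_burst n K (\<lambda>d. a * \<phi> d + b * \<psi> d) c = a * ideal_burst n K \<phi> c + b * ideal_burst n K \<psi> c"
  unfolding ideal_burst_def attempts_linear
  using integrable_attempts[OF assms(1,2)] integrable_attempts[OF assms(3,4)] by simp

lemma ideal_burst_const [simp]: "ideal_burst n K (\<lambda>_. a) c = a"
proof -
  have "attempts n k (\<lambda>_. a) c = a" for k c by (induction k arbitrary: c) (auto simp: algebra_simps)
  then show ?thesis by (simp add: ideal_burst_def)
qed

lemma ideal_bursts_mono:
  assumes "mono \<phi>" "\<And>c. 0 \<le> \<phi> c" "\<And>c. \<phi> c \<le> B"
  shows "mono ((ideal_burst n K ^^ T) \<phi>)"
proof (induction T)
  case (Suc T)
  have b: "0 \<le> (ideal_burst n K ^^ T) \<phi> c" "(ideal_burst n K ^^ T) \<phi> c \<le> B" for c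
    using ideal_bursts_bounds[OF assms(2,3)] by auto
  define \<Phi> where "\<Phi> = (ideal_burst n K ^^ T) \<phi>"
  have mono: "mono \<Phi>" using Suc by (simp add: \<Phi>_def)
  have "ideal_burst n K \<Phi> c \<le> ideal_burst n K \<Phi> d" if "c \<le> d" for c d
    using that b unfolding ideal_burst_def[of _ _ \<Phi>] \<Phi>_def[symmetric]
    by (intro integral_mono integrable_attempts[where B=B] monoD[OF attempts_mono[OF mono]])
  then show ?case by (simp add: mono_def \<Phi>_def)
qed (use assms in simp)

text \<open>The probability that the ideal process, started with \<open>c\<close> informed servers, has more than \<open>y\<close> of them
  after \<open>T\<close> bursts. The process continues after it has come down to the diagonal.\<close>

definition reach :: "nat \<Rightarrow> nat pmf \<Rightarrow> nat \<Rightarrow> nat \<Rightarrow> nat \<Rightarrow> real" where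
  "reach n K T y c = (ideal_burst n K ^^ T) (\<lambda>d. if y < d then 1 else 0) c"

lemma reach_bounds: "0 \<le> reach n K T y c" "reach n K T y c \<le> 1"
  using ideal_bursts_bounds[of "\<lambda>d. if y < d then 1 else 0" 1] by (auto simp: reach_def)

lemma reach_0 [simp]: "reach n K 0 y c = (if y < c then 1 else 0)"
  by (simp add: reach_def)

lemma reach_Suc: "reach n K (Suc T) y c = ideal_burst n K (reach n K T y) c"
  by (simp add: reach_def[abs_def])

lemma reach_mono: "c \<le> d \<Longrightarrow> reach n K T y c \<le> reach n K T y d"
  using ideal_bursts_mono[of "\<lambda>d. if y < d then 1 else 0" 1 T n K] by (auto simp: reach_def mono_def)

lemma reach_eq_walk: "y < n \<Longrightarrow> reach n K T y c = measure_pmf.prob (sum_pmf (walk n K T c y)) {0..}"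
  by (simp add: reach_def ideal_bursts_eq_walk)

text \<open>The expected value of \<open>\<psi>\<close> after \<open>d\<close> bursts on the event that the ideal process has been above the
  diagonal at the times \<open>s, \<dots>, s + d\<close>.\<close>

fun surviving :: "nat \<Rightarrow> nat pmf \<Rightarrow> nat \<Rightarrow> nat \<Rightarrow> (nat \<Rightarrow> real) \<Rightarrow> nat \<Rightarrow> real" where
  "surviving n K 0 s \<psi> c = (if c \<le> s then 0 else \<psi> c)"
| "surviving n K (Suc d) s \<psi> c = (if c \<le> s then 0 else ideal_burst n K (surviving n K d (Suc s) \<psi>) c)"

lemma surviving_bounds:
  assumes "\<And>c. 0 \<le> \<psi> c" "\<And>c. \<psi> c \<le> B"
  shows "0 \<le> surviving n K d s \<psi> c \<and> surviving n K d s \<psi> c \<le> B"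
proof (induction d arbitrary: s c)
  case 0
  then show ?case using assms[of c] by (auto intro: order_trans)
next
  case (Suc d)
  have "0 \<le> B" using assms order_trans by blast
  then show ?case using ideal_burst_bounds[of "surviving n K d (Suc s) \<psi>" B n K c] Suc by auto
qed

lemma surviving_le:
  assumes "\<And>c. 0 \<le> \<phi> c" "\<And>c. \<phi> c \<le> B" "\<And>c. 0 \<le> \<psi> c" "\<And>c. \<psi> c \<le> B'" "\<And>c. 1 \<le> c \<Longrightarrow> \<phi> c \<le> \<psi> c"
  shows "surviving n K d s \<phi> c \<le> surviving n K d s \<psi> c"
proof (induction d arbitrary: s c)
  case 0
  then show ?case using assms(5)[of c] by auto
next
  case (Suc d)
  show ?case
    using ideal_burst_le[of "surviving n K d (Suc s) \<phi>" B "surviving n K d (Suc s) \<psi>" B' c n K]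
      surviving_bounds[OF assms(1,2)] surviving_bounds[OF assms(3,4)] Suc by auto
qed

lemma surviving_linear:
  assumes "\<And>c. 0 \<le> \<phi> c" "\<And>c. \<phi> c \<le> B" "\<And>c. 0 \<le> \<psi> c" "\<And>c. \<psi> c \<le> B'"
  shows "surviving n K d s (\<lambda>c. a * \<phi> c + b * \<psi> c) c = a * surviving n K d s \<phi> c + b * surviving n K d s \<psi> c"
proof (induction d arbitrary: s c)
  case (Suc d)
  have "surviving n K d (Suc s) (\<lambda>c. a * \<phi> c + b * \<psi> c) = (\<lambda>c. a * surviving n K d (Suc s) \<phi> c + b * surviving n K d (Suc s) \<psi> c)"
    using Suc by auto
  then show ?case
    using ideal_burst_linear[of "surviving n K d (Suc s) \<phi>" B "surviving n K d (Suc s) \<psi>" B' n K a b c]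
      surviving_bounds[OF assms(1,2)] surviving_bounds[OF assms(3,4)] by auto
qed simp

context spreading
begin

lemma ideal_burst_linear_growth:
  assumes "\<And>c. 0 \<le> \<phi> c" "\<And>c. \<phi> c \<le> B" "\<And>c. \<phi> c \<le> (real c + r) / M" "0 < M"
  shows "ideal_burst n K \<phi> c \<le> (real c + r + m) / M"
proof -
  have att: "attempts n k \<phi> c \<le> (real c + real k + r) / M" for k c
  proof (induction k arbitrary: c)
    case (Suc k)
    have "attempts n k \<phi> c \<le> (real c + real (Suc k) + r) / M" "attempts n k \<phi> (Suc c) \<le> (real c + real (Suc k) + r) / M"
      using Suc[of c] Suc[of "Suc c"] assms(4) by (auto simp: field_simps)
    then show ?case using hit_bounds[of n c] by (simp add: convex_bound_le)
  qed (use assms(3) in simp)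
  have "ideal_burst n K \<phi> c \<le> measure_pmf.expectation K (\<lambda>k. (real c + real k + r) / M)"
    unfolding ideal_burst_def using K1 att by (intro integral_mono integrable_attempts[OF assms(1,2)]) auto
  also have "\<dots> = (real c + r + m) / M" using K1 by (simp add: m_def add_ac)
  finally show ?thesis .
qed

lemma surviving_linear_growth:
  assumes "\<And>c. 0 \<le> \<psi> c" "\<And>c. \<psi> c \<le> 1" "\<And>c. \<psi> c \<le> real c / M" "0 < M"
  shows "surviving n K d s \<psi> c \<le> (real c + d * m) / M"
proof (induction d arbitrary: s c)
  case 0
  then show ?case using assms(3)[of c] assms(4) by auto
next
  case (Suc d)
  have "ideal_burst n K (surviving n K d (Suc s) \<psi>) c \<le> (real c + d * m + m) / M"
    using surviving_bounds[OF assms(1,2)] Suc assms(4) by (intro ideal_burst_linear_growth[where B=1]) auto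
  moreover have "0 \<le> (real c + d * m + m) / M" using m_nonneg assms(4) by simp
  ultimately show ?case by (simp add: algebra_simps)
qed

section \<open>Comparison bounds for the end of the transmission\<close>

text \<open>A transmission that is still active at time \<open>t\<close> has more than \<open>t\<close> informed servers, so the ideal
  process has more than \<open>t - f\<close> of them as long as the gap is less than \<open>f\<close>. The superharmonic function
  is the probability of this event and of the survival of the first \<open>L\<close> bursts.\<close>

lemma late_end_le:
  assumes adm: "admissible_rule rule" and n: "0 < n" and f: "1 \<le> f" "f \<le> t" and L: "L \<le> t"
  shows "measure_pmf.prob (end_time_law n p K rule) {s. t < s} \<le>
    surviving n K L 0 (reach n K (t - L) (t - f)) 1 + comparison_error n L f"
proof -
  define w where "w s = (if s \<le> L then surviving n K (L - s) s (reach n K (t - L) (t - f))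
      else if s \<le> t then reach n K (t - s) (t - f) else (\<lambda>_. 1))" for s
  have late: "ideal_burst n K (w (Suc s)) c \<le> reach n K (t - s) (t - f) c" if "L \<le> s" "s \<le> t" "s < c + f" for s c
  proof (cases "s = t")
    case True
    then show ?thesis using that f by (simp add: w_def)
  next
    case False
    then have "t - s = Suc (t - Suc s)" using that by simp
    then show ?thesis using that False by (simp add: w_def reach_Suc)
  qed
  have "measure_pmf.expectation (end_time_law n p K rule) (indicator {s. t < s}) \<le> w 0 1 + comparison_error n L f"
  proof (rule comparison[OF adm n, where B=1])
    show "0 \<le> w s c" "w s c \<le> 1" for s c
      using surviving_bounds[OF reach_bounds] reach_bounds by (auto simp: w_def)
    show "indicator {s. t < s} s \<le> w s s" if "s \<le> L" for s
      using that L surviving_bounds[OF reach_bounds] by (auto simp: w_def)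
    show "indicator {s. t < s} s \<le> w s c" if "L < s" for s c
      using that reach_bounds by (auto simp: w_def indicator_def)
    show "ideal_burst n K (w (Suc s)) c \<le> w s c" if "s \<le> L" "s < c" for s c
    proof (cases "s = L")
      case True
      then show ?thesis using late[of s c] that L f by (simp add: w_def)
    next
      case False
      then have "L - s = Suc (L - Suc s)" using that by simp
      then show ?thesis using that False by (simp add: w_def)
    qed
    show "ideal_burst n K (w (Suc s)) c \<le> w s c" if "L < s" "s < c + f" for s c
      using late[of s c] that by (cases "s \<le> t") (auto simp: w_def)
  qed (use f in auto)
  then show ?thesis by (simp add: w_def)
qed

text \<open>As long as fewer than \<open>c1\<close> servers are informed, each attempt succeeds with probability at least
  \<open>\<pi>0\<close>, so that \<open>\<theta> ^ c\<close> decreases in expectation at least as fast as for a branching process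
  with thinned offspring.\<close>

lemma attempts_power_le:
  fixes \<theta> \<pi>0 :: real
  assumes "0 < \<theta>" "\<theta> < 1" and hit: "\<And>d. d < c1 \<Longrightarrow> \<pi>0 \<le> hit n d" and "0 \<le> \<pi>0" "\<pi>0 \<le> 1"
  shows "attempts n k (\<lambda>d. if d < c1 then \<theta> ^ d else 0) c \<le> (if c < c1 then \<theta> ^ c * (\<pi>0 * \<theta> + 1 - \<pi>0) ^ k else 0)"
proof (induction k arbitrary: c)
  case (Suc k)
  let ?v = "\<pi>0 * \<theta> + 1 - \<pi>0"
  have "0 \<le> \<pi>0 * \<theta>" using assms by simp
  then have th: "0 \<le> ?v" using assms by linarith
  show ?case
  proof (cases "c < c1")
    case True
    have "attempts n k (\<lambda>d. if d < c1 then \<theta> ^ d else 0) (Suc c) \<le> \<theta> ^ Suc c * ?v ^ k"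
      using Suc[of "Suc c"] th assms by (auto split: if_splits intro: order_trans)
    moreover have "attempts n k (\<lambda>d. if d < c1 then \<theta> ^ d else 0) c \<le> \<theta> ^ c * ?v ^ k"
      using Suc[of c] True by simp
    ultimately have "attempts n (Suc k) (\<lambda>d. if d < c1 then \<theta> ^ d else 0) c \<le>
       hit n c * (\<theta> ^ Suc c * ?v ^ k) + (1 - hit n c) * (\<theta> ^ c * ?v ^ k)"
      unfolding attempts.simps using hit_bounds[of n c] by (intro add_mono mult_left_mono) auto
    also have "\<dots> = \<theta> ^ c * ?v ^ k * (1 - hit n c * (1 - \<theta>))" by (simp add: algebra_simps)
    also have "\<dots> \<le> \<theta> ^ c * ?v ^ k * (1 - \<pi>0 * (1 - \<theta>))"
      using hit[OF True] assms th by (intro mult_left_mono diff_left_mono mult_right_mono mult_nonneg_nonneg) auto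
    also have "\<dots> = \<theta> ^ c * ?v ^ Suc k" by (simp add: algebra_simps)
    finally show ?thesis using True by simp
  next
    case False
    then have "attempts n (Suc k) (\<lambda>d. if d < c1 then \<theta> ^ d else 0) c = attempts n (Suc k) (\<lambda>d. 0) c"
      by (intro attempts_cong) auto
    also have "\<dots> = 0" using attempts_linear[of n "Suc k" 0 "\<lambda>_. 0" 0 "\<lambda>_. 0" c] by simp
    finally show ?thesis using False by simp
  qed
qed simp

end

text \<open>The last assumption says that the thinned offspring law is supercritical, in the form of a
  value \<open>\<theta>\<close> at which its generating function lies below the diagonal. It makes \<open>\<theta> ^ c / \<theta> ^ s\<close>
  decrease by the factor \<open>\<rho>\<close> in each burst.\<close>

locale branching = spreading +
  fixes \<theta> \<pi>0 \<rho> :: real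
  assumes th: "0 < \<theta>" "\<theta> < 1" and pi0: "0 < \<pi>0" "\<pi>0 < 1" and rho: "0 \<le> \<rho>" "\<rho> < 1"
    and gf: "measure_pmf.expectation K (\<lambda>k. (\<pi>0 * \<theta> + 1 - \<pi>0) ^ k) \<le> \<rho> * \<theta>"
begin

text \<open>The cut at \<open>c1\<close> only affects processes that cannot die before time \<open>c1\<close>, even without further
  successes.\<close>

definition extinction :: "nat \<Rightarrow> nat \<Rightarrow> real" where
  "extinction c1 c = (if c < c1 then \<theta> ^ c else 0)"

lemma extinction_bounds: "0 \<le> extinction c1 c" "extinction c1 c \<le> 1"
  using th by (auto simp: extinction_def power_le_one)

lemma ideal_burst_extinction:
  assumes "\<And>d. d < c1 \<Longrightarrow> \<pi>0 \<le> hit n d"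
  shows "ideal_burst n K (extinction c1) c \<le> \<rho> * \<theta> * extinction c1 c"
proof -
  let ?v = "\<pi>0 * \<theta> + 1 - \<pi>0"
  have "0 \<le> \<pi>0 * \<theta>" "\<pi>0 * \<theta> \<le> \<pi>0" using th pi0 by (simp_all add: mult_left_le)
  then have v: "0 \<le> ?v" "?v \<le> 1" using pi0 by linarith+
  have "ideal_burst n K (extinction c1) c \<le> measure_pmf.expectation K (\<lambda>k. extinction c1 c * ?v ^ k)"
    unfolding ideal_burst_def
  proof (rule integral_mono)
    show "integrable (measure_pmf K) (\<lambda>k. extinction c1 c * ?v ^ k)"
      using v extinction_bounds[of c1 c] by (intro integrable_bounded_pmf[where B=1]) (auto intro!: mult_le_one power_le_one)
    show "attempts n k (extinction c1) c \<le> extinction c1 c * ?v ^ k" for k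
      using attempts_power_le[OF th assms, of c1 k c] pi0
      by (simp add: extinction_def[abs_def] split: if_splits)
  qed (rule integrable_attempts[OF extinction_bounds])
  also have "\<dots> = extinction c1 c * measure_pmf.expectation K (\<lambda>k. ?v ^ k)" by simp
  also have "\<dots> \<le> extinction c1 c * (\<rho> * \<theta>)" using gf extinction_bounds by (intro mult_left_mono)
  finally show ?thesis by (simp add: mult_ac)
qed

text \<open>By the optional stopping argument for the supermartingale \<open>\<theta> ^ c / \<theta> ^ s\<close>, which is at least \<open>1\<close> when the
  process dies.\<close>

lemma surviving_ge:
  assumes hit: "\<And>d. d < c1 \<Longrightarrow> \<pi>0 \<le> hit n d" and "s + d < c1"
  shows "1 - (1 / \<theta>) ^ s * extinction c1 c \<le> surviving n K d s (\<lambda>_. 1) c"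
  using assms(2)
proof (induction d arbitrary: s c)
  case 0
  show ?case
  proof (cases "c \<le> s")
    case True
    then have "\<theta> ^ s \<le> \<theta> ^ c" using th by (intro power_decreasing) auto
    then show ?thesis using True 0 th by (simp add: extinction_def power_one_over divide_simps)
  next
    case False
    then show ?thesis using extinction_bounds[of c1 c] th by simp
  qed
next
  case (Suc d)
  show ?case
  proof (cases "c \<le> s")
    case True
    then have "\<theta> ^ s \<le> \<theta> ^ c" using th by (intro power_decreasing) auto
    then show ?thesis using True Suc.prems th by (simp add: extinction_def power_one_over divide_simps)
  next
    case False
    let ?S = "surviving n K d (Suc s) (\<lambda>_. 1)" and ?A = "(1 / \<theta>) ^ Suc s"
    have A: "0 \<le> ?A" using th by simp
    have Sb: "0 \<le> ?S c" "?S c \<le> 1" for c using surviving_bounds[of "\<lambda>_. 1" 1] by auto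
    have "1 = ideal_burst n K (\<lambda>c. 1) c" by simp
    also have "\<dots> \<le> ideal_burst n K (\<lambda>c. 1 * ?S c + ?A * extinction c1 c) c"
    proof (rule ideal_burst_le[where B=1 and B'="1 + ?A"])
      show "0 \<le> 1 * ?S c + ?A * extinction c1 c" for c
        using Sb A extinction_bounds by (intro add_nonneg_nonneg mult_nonneg_nonneg) auto
      show "1 * ?S c + ?A * extinction c1 c \<le> 1 + ?A" for c
        using Sb[of c] mult_left_le[OF extinction_bounds(2) A, of c1 c] by simp
      show "1 \<le> 1 * ?S d + ?A * extinction c1 d" for d using Suc.IH[of "Suc s" d] Suc.prems by simp
    qed auto
    also have "\<dots> = 1 * ideal_burst n K ?S c + ?A * ideal_burst n K (extinction c1) c"
      by (rule ideal_burst_linear[OF Sb extinction_bounds])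
    also have "\<dots> \<le> ideal_burst n K ?S c + ?A * (\<rho> * \<theta> * extinction c1 c)"
      unfolding mult_1 by (intro add_left_mono mult_left_mono ideal_burst_extinction hit A)
    also have "?A * (\<rho> * \<theta> * extinction c1 c) = \<rho> * ((1 / \<theta>) ^ s * extinction c1 c)" using th by simp
    also have "\<dots> \<le> 1 * ((1 / \<theta>) ^ s * extinction c1 c)"
      using rho th extinction_bounds by (intro mult_right_mono mult_nonneg_nonneg) auto
    finally show ?thesis using False by simp
  qed
qed

text \<open>An end at time \<open>s \<le> t\<close> falls into one of three cases. For \<open>s \<le> L\<close> it is the death of the ideal process
  in the first bursts. For \<open>L < s \<le> N1\<close> it is bounded by the branching supermartingale, which has
  decreased geometrically during the first \<open>L\<close> bursts. For \<open>N1 < s \<le> t\<close> the ideal process would be at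
  most at \<open>t'\<close> at the later time \<open>t'\<close> with probability at least \<open>1 / \<gamma>\<close>, so that the
  probability of such an end is at most \<open>\<gamma>\<close> times that of the position at \<open>t'\<close>.\<close>

lemma early_end_le:
  assumes adm: "admissible_rule rule" and n: "0 < n" and f: "1 \<le> f"
    and hit: "\<And>d. d < c1 \<Longrightarrow> \<pi>0 \<le> hit n d" and N1: "L \<le> N1" "N1 + f \<le> c1" and t: "L \<le> t'" "t \<le> t'" and \<gamma>: "0 \<le> \<gamma>"
    and stop: "\<And>s c. \<lbrakk>N1 < s; s \<le> t; c < s + f\<rbrakk> \<Longrightarrow> 1 \<le> \<gamma> * (1 - reach n K (t' - s) t' c)"
  shows "measure_pmf.prob (end_time_law n p K rule) {s. s \<le> t} \<le>
    1 - surviving n K L 0 (\<lambda>_. 1) 1 + \<gamma> * (1 - reach n K (t' - L) t' 1) * surviving n K L 0 (\<lambda>_. 1) 1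
      + (1 / \<theta>) ^ f * \<rho> ^ L + comparison_error n L f"
proof -
  define \<psi> where "\<psi> s c = \<gamma> * (1 - reach n K (t' - s) t' c)" for s c
  \<comment> \<open>one superharmonic function for each of the three cases\<close>
  define w1 where "w1 s c = (if s \<le> L then 1 - surviving n K (L - s) s (\<lambda>_. 1) c else 0)" for s c
  define w2 where "w2 s c = (if s \<le> L then surviving n K (L - s) s (\<psi> L) c else if s \<le> t' then \<psi> s c else 0)" for s c
  define A where "A s = (1 / \<theta>) ^ (f + s) * \<rho> ^ (L - s)" for s
  define w3 where "w3 s c = (if s \<le> N1 then A s * extinction c1 c else 0)" for s c
  have A0: "0 \<le> A s" for s using th rho by (simp add: A_def)
  have \<psi>b: "0 \<le> \<psi> s c" "\<psi> s c \<le> \<gamma>" for s c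
    using \<gamma> reach_bounds[of n K "t' - s" t' c] by (auto simp: \<psi>_def mult_left_le)
  have one: "(0::real) \<le> 1" "(1::real) \<le> 1" by auto
  have sb: "0 \<le> surviving n K d s (\<lambda>_. 1) c" "surviving n K d s (\<lambda>_. 1) c \<le> 1" for d s c
    using surviving_bounds[of "\<lambda>_. 1" 1] by auto
  have s\<psi>b: "0 \<le> surviving n K d s (\<psi> L) c" "surviving n K d s (\<psi> L) c \<le> \<gamma>" for d s c
    using surviving_bounds[OF \<psi>b] by auto
  have w1b: "0 \<le> w1 s c" "w1 s c \<le> 1" for s c using sb by (auto simp: w1_def)
  have w2b: "0 \<le> w2 s c" "w2 s c \<le> \<gamma>" for s c using s\<psi>b \<psi>b \<gamma> by (auto simp: w2_def)
  have Ale: "A s \<le> (1 / \<theta>) ^ (f + N1)" if "s \<le> N1" for s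
  proof -
    have "(1 / \<theta>) ^ (f + s) * \<rho> ^ (L - s) \<le> (1 / \<theta>) ^ (f + N1) * 1"
      using th rho that by (intro mult_mono power_increasing power_le_one) auto
    then show ?thesis by (simp add: A_def)
  qed
  have w3b: "0 \<le> w3 s c" "w3 s c \<le> (1 / \<theta>) ^ (f + N1)" for s c
  proof -
    show "0 \<le> w3 s c" using A0 extinction_bounds by (simp add: w3_def)
    have "A s * extinction c1 c \<le> A s" using A0 extinction_bounds by (simp add: mult_left_le)
    then show "w3 s c \<le> (1 / \<theta>) ^ (f + N1)" using Ale[of s] th by (auto simp: w3_def)
  qed
  have S1: "ideal_burst n K (w1 (Suc s)) c \<le> w1 s c" if "(s \<le> L \<longrightarrow> s < c)" for s c
  proof (cases "s < L")
    case True
    then have d: "L - s = Suc (L - Suc s)" by simp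
    have "ideal_burst n K (w1 (Suc s)) c = ideal_burst n K (\<lambda>c. 1 * 1 + (-1) * surviving n K (L - Suc s) (Suc s) (\<lambda>_. 1) c) c"
      using True by (simp add: w1_def[abs_def])
    also have "\<dots> = 1 * ideal_burst n K (\<lambda>_. 1) c + (-1) * ideal_burst n K (surviving n K (L - Suc s) (Suc s) (\<lambda>_. 1)) c"
      by (rule ideal_burst_linear[OF one sb])
    finally show ?thesis using True that by (simp add: w1_def d)
  next
    case False
    then have "ideal_burst n K (w1 (Suc s)) c = 0" by (simp add: w1_def[abs_def])
    then show ?thesis using w1b by simp
  qed
  have \<psi>_step: "ideal_burst n K (w2 (Suc s)) c \<le> \<psi> s c" if "L \<le> s" "s \<le> t'" for s c
  proof (cases "s = t'")
    case True
    then show ?thesis using that \<psi>b by (simp add: w2_def[abs_def])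
  next
    case False
    then have d: "t' - s = Suc (t' - Suc s)" using that by simp
    have "ideal_burst n K (w2 (Suc s)) c = ideal_burst n K (\<lambda>c. \<gamma> * 1 + (- \<gamma>) * reach n K (t' - Suc s) t' c) c"
      using that False by (simp add: w2_def[abs_def] \<psi>_def algebra_simps)
    also have "\<dots> = \<gamma> * ideal_burst n K (\<lambda>_. 1) c + (- \<gamma>) * ideal_burst n K (reach n K (t' - Suc s) t') c"
      by (rule ideal_burst_linear[OF one reach_bounds])
    finally show ?thesis by (simp add: \<psi>_def d reach_Suc algebra_simps)
  qed
  have S2: "ideal_burst n K (w2 (Suc s)) c \<le> w2 s c" if "(s \<le> L \<longrightarrow> s < c)" for s c
  proof -
    consider "s < L" | "s = L" | "L < s" "s \<le> t'" | "t' < s" "L < s" by linarith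
    then show ?thesis
    proof cases
      case 1
      then have "L - s = Suc (L - Suc s)" by simp
      then show ?thesis using 1 that by (simp add: w2_def[abs_def])
    next
      case 2
      then show ?thesis using \<psi>_step[of L c] t that by (simp add: w2_def[of L c])
    next
      case 3
      then show ?thesis using \<psi>_step[of s c] by (simp add: w2_def[of s])
    next
      case 4
      then show ?thesis by (simp add: w2_def[abs_def])
    qed
  qed
  have S3: "ideal_burst n K (w3 (Suc s)) c \<le> w3 s c" for s c
  proof (cases "Suc s \<le> N1")
    case True
    have "ideal_burst n K (w3 (Suc s)) c = A (Suc s) * ideal_burst n K (extinction c1) c"
      using True ideal_burst_linear[OF extinction_bounds extinction_bounds, where a="A (Suc s)" and b=0]
      by (simp add: w3_def[abs_def])
    also have "\<dots> \<le> A (Suc s) * (\<rho> * \<theta> * extinction c1 c)"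
      by (intro mult_left_mono ideal_burst_extinction hit A0)
    also have "\<dots> = (A (Suc s) * \<rho> * \<theta>) * extinction c1 c" by simp
    also have "\<dots> \<le> A s * extinction c1 c"
    proof (rule mult_right_mono)
      have "A (Suc s) * \<rho> * \<theta> = (1 / \<theta>) ^ (f + s) * (\<rho> ^ (L - Suc s) * \<rho>)" using th by (simp add: A_def)
      also have "\<dots> \<le> A s"
      proof -
        have "\<rho> ^ (L - Suc s) * \<rho> \<le> \<rho> ^ (L - s)"
        proof (cases "s < L")
          case True
          then have "L - s = Suc (L - Suc s)" by simp
          then show ?thesis by (simp add: mult.commute)
        next
          case False
          then show ?thesis using rho by simp
        qed
        then show ?thesis unfolding A_def using th by (intro mult_left_mono) auto
      qed
      finally show "A (Suc s) * \<rho> * \<theta> \<le> A s" .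
    qed (rule extinction_bounds)
    finally show ?thesis using True by (simp add: w3_def)
  next
    case False
    then have "ideal_burst n K (w3 (Suc s)) c = 0" by (simp add: w3_def[abs_def])
    then show ?thesis using w3b by simp
  qed
  define w where "w s c = w1 s c + w2 s c + w3 s c" for s c
  have S: "ideal_burst n K (w (Suc s)) c \<le> w s c" if "(s \<le> L \<longrightarrow> s < c)" for s c
  proof -
    have b12: "0 \<le> 1 * w1 (Suc s) c + 1 * w2 (Suc s) c" "1 * w1 (Suc s) c + 1 * w2 (Suc s) c \<le> 1 + \<gamma>" for c
      using w1b[of "Suc s" c] w2b[of "Suc s" c] by auto
    have "ideal_burst n K (w (Suc s)) c = ideal_burst n K (\<lambda>c. 1 * (1 * w1 (Suc s) c + 1 * w2 (Suc s) c) + 1 * w3 (Suc s) c) c"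
      by (simp add: w_def[abs_def])
    also have "\<dots> = 1 * ideal_burst n K (\<lambda>c. 1 * w1 (Suc s) c + 1 * w2 (Suc s) c) c + 1 * ideal_burst n K (w3 (Suc s)) c"
      by (rule ideal_burst_linear[OF b12 w3b])
    also have "ideal_burst n K (\<lambda>c. 1 * w1 (Suc s) c + 1 * w2 (Suc s) c) c = 1 * ideal_burst n K (w1 (Suc s)) c + 1 * ideal_burst n K (w2 (Suc s)) c"
      by (rule ideal_burst_linear[OF w1b w2b])
    finally show ?thesis using S1[OF that] S2[OF that] S3[of s c] by (simp add: w_def[abs_def])
  qed
  have "measure_pmf.expectation (end_time_law n p K rule) (indicator {s. s \<le> t}) \<le> w 0 1 + comparison_error n L f"
  proof (rule comparison[OF adm n, where B="1 + \<gamma> + (1 / \<theta>) ^ (f + N1)"])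
    show "0 \<le> w s c" "w s c \<le> 1 + \<gamma> + (1 / \<theta>) ^ (f + N1)" for s c
      using w1b[of s c] w2b[of s c] w3b[of s c] by (auto simp: w_def)
    show "indicator {s. s \<le> t} s \<le> w s s" if "s \<le> L" for s
    proof -
      have "surviving n K (L - s) s (\<lambda>_. 1) s = 0" by (cases "L - s") auto
      then have "w1 s s = 1" using that by (simp add: w1_def)
      then show ?thesis using w2b[of s s] w3b[of s s] by (simp add: w_def indicator_def)
    qed
    show "indicator {s. s \<le> t} s \<le> w s c" if s: "L < s" "c < s + f" for s c
    proof (cases "s \<le> t")
      case True
      have "1 \<le> w2 s c + w3 s c"
      proof (cases "s \<le> N1")
        case N: True
        have "c < c1" using N N1 s by simp
        moreover have "\<theta> ^ (f + s) \<le> \<theta> ^ c" using th s by (intro power_decreasing) auto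
        ultimately have "1 \<le> w3 s c" using N s th
          by (simp add: w3_def A_def extinction_def power_one_over divide_simps)
        then show ?thesis using w2b[of s c] by simp
      next
        case False
        then have "1 \<le> w2 s c" using stop[of s c] True s t by (simp add: w2_def \<psi>_def)
        then show ?thesis using w3b[of s c] by simp
      qed
      then show ?thesis using True w1b[of s c] by (simp add: w_def)
    next
      case False
      then show ?thesis using w1b[of s c] w2b[of s c] w3b[of s c] by (simp add: w_def)
    qed
    show "ideal_burst n K (w (Suc s)) c \<le> w s c" if "s \<le> L" "s < c" for s c using that by (intro S) auto
    show "ideal_burst n K (w (Suc s)) c \<le> w s c" if "L < s" for s c using that by (intro S) auto
  qed (use f in auto)
  also have "w 0 1 \<le> 1 - surviving n K L 0 (\<lambda>_. 1) 1 + \<gamma> * (1 - reach n K (t' - L) t' 1) * surviving n K L 0 (\<lambda>_. 1) 1 + (1 / \<theta>) ^ f * \<rho> ^ L"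
  proof -
    let ?M = "\<gamma> * (1 - reach n K (t' - L) t' 1)"
    have M: "0 \<le> ?M" using \<psi>b[of L 1] by (simp add: \<psi>_def)
    have "surviving n K L 0 (\<psi> L) 1 \<le> surviving n K L 0 (\<lambda>c. ?M * 1 + 0 * 1) 1"
      using M \<gamma> by (intro surviving_le[OF \<psi>b, where B'="?M"]) (auto simp: \<psi>_def intro!: mult_left_mono reach_mono)
    also have "\<dots> = ?M * surviving n K L 0 (\<lambda>_. 1) 1 + 0 * surviving n K L 0 (\<lambda>_. 1) 1"
      by (rule surviving_linear[OF one one])
    finally have "w2 0 1 \<le> ?M * surviving n K L 0 (\<lambda>_. 1) 1" by (simp add: w2_def)
    moreover have "w3 0 1 \<le> (1 / \<theta>) ^ f * \<rho> ^ L"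
      using mult_left_le[OF extinction_bounds(2)[of c1 1] A0[of 0]] by (simp add: w3_def A_def)
    moreover have "w1 0 1 = 1 - surviving n K L 0 (\<lambda>_. 1) 1" by (simp add: w1_def)
    ultimately show ?thesis by (simp add: w_def)
  qed
  finally show ?thesis by simp
qed

end

section \<open>Asymptotics\<close>

lemma one_minus_power_le:
  fixes x :: real
  assumes "0 \<le> x" "x \<le> 1"
  shows "(1 - x) ^ k \<le> 1 - k * x + (real k)\<^sup>2 * x\<^sup>2 / 2"
proof -
  have "(1 - x) ^ k \<le> 1 - k * x + real k * (real k - 1) / 2 * x\<^sup>2"
  proof (induction k)
    case (Suc k)
    have kk: "0 \<le> real k * (real k - 1)" by (cases k) auto
    have "(1 - x) ^ Suc k \<le> (1 - x) * (1 - k * x + real k * (real k - 1) / 2 * x\<^sup>2)"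
      using Suc assms by (simp add: mult_left_mono)
    also have "\<dots> = 1 - Suc k * x + real (Suc k) * (real (Suc k) - 1) / 2 * x\<^sup>2 - real k * (real k - 1) / 2 * x ^ 3"
      by (simp add: field_simps power2_eq_square power3_eq_cube)
    also have "\<dots> \<le> 1 - Suc k * x + real (Suc k) * (real (Suc k) - 1) / 2 * x\<^sup>2"
      using kk assms by simp
    finally show ?case .
  qed simp
  also have "real k * (real k - 1) / 2 * x\<^sup>2 \<le> (real k)\<^sup>2 * x\<^sup>2 / 2"
  proof -
    have "real k * (real k - 1) \<le> (real k)\<^sup>2" by (simp add: power2_eq_square algebra_simps)
    from mult_right_mono[OF this, of "x\<^sup>2 / 2"] show ?thesis by simp
  qed
  finally show ?thesis by simp
qed

context supercritical
begin

text \<open>Since \<open>m > 1\<close>, the thinned mean \<open>\<pi>0 m\<close> can be kept above \<open>1\<close>; a second order expansion of the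
  generating function at \<open>1\<close> then puts it below the diagonal at \<open>\<theta> = 1 - e\<close> for small \<open>e\<close>.\<close>

lemma exists_branching: "\<exists>\<theta> \<pi>0 \<rho>. branching p K \<theta> \<pi>0 \<rho>"
proof -
  define \<pi>0 where "\<pi>0 = (1 + 1 / m) / 2"
  have m0: "0 < m" using m_gt_1 by simp
  have pi0: "0 < \<pi>0" "\<pi>0 < 1" and pm: "\<pi>0 * m = (m + 1) / 2"
    using m_gt_1 by (auto simp: \<pi>0_def field_simps)
  have "1 < m\<^sup>2" using m_gt_1 by (simp add: power2_eq_square less_1_mult)
  then have m2: "0 < m2" using m2_ge by linarith
  define e where "e = min (1 / 2) ((m - 1) / (2 * m2))"
  have e: "0 < e" "e < 1" using m_gt_1 m2 by (auto simp: e_def)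
  have em: "m2 * e \<le> (m - 1) / 2"
  proof -
    have "m2 * e \<le> m2 * ((m - 1) / (2 * m2))" using m2 by (intro mult_left_mono) (auto simp: e_def)
    then show ?thesis using m2 by simp
  qed
  define \<theta> where "\<theta> = 1 - e"
  have th: "0 < \<theta>" "\<theta> < 1" using e by (auto simp: \<theta>_def)
  define G where "G = measure_pmf.expectation K (\<lambda>k. (\<pi>0 * \<theta> + 1 - \<pi>0) ^ k)"
  have v: "\<pi>0 * \<theta> + 1 - \<pi>0 = 1 - \<pi>0 * e" by (simp add: \<theta>_def algebra_simps)
  have pe: "0 \<le> \<pi>0 * e" "\<pi>0 * e \<le> e" "\<pi>0 * e \<le> 1"
    using pi0 e by (auto intro: mult_le_one mult_left_le_one_le)
  have "G \<le> measure_pmf.expectation K (\<lambda>k. 1 - k * (\<pi>0 * e) + (real k)\<^sup>2 * (\<pi>0 * e)\<^sup>2 / 2)"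
    unfolding G_def v
  proof (rule integral_mono)
    show "integrable (measure_pmf K) (\<lambda>k. (1 - \<pi>0 * e) ^ k)"
      using pe by (intro integrable_bounded_pmf[where B=1]) (auto intro: power_le_one)
    show "integrable (measure_pmf K) (\<lambda>k. 1 - k * (\<pi>0 * e) + (real k)\<^sup>2 * (\<pi>0 * e)\<^sup>2 / 2)"
      using K1 K2 by simp
    show "(1 - \<pi>0 * e) ^ k \<le> 1 - k * (\<pi>0 * e) + (real k)\<^sup>2 * (\<pi>0 * e)\<^sup>2 / 2" for k
      using pe by (intro one_minus_power_le) auto
  qed
  also have "\<dots> = 1 - m * (\<pi>0 * e) + m2 * (\<pi>0 * e)\<^sup>2 / 2"
    using K1 K2 by (simp add: m_def m2_def)
  also have "\<dots> \<le> 1 - m * (\<pi>0 * e) + m2 * e\<^sup>2 / 2"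
    using pe m2 by (simp add: mult_left_mono power_mono)
  also have "\<dots> = 1 - e * (\<pi>0 * m) + e * (m2 * e) / 2" by (simp add: power2_eq_square mult_ac)
  also have "\<dots> \<le> 1 - e * ((m + 1) / 2) + e * ((m - 1) / 2) / 2"
    unfolding pm using em e by (intro add_left_mono divide_right_mono mult_left_mono) auto
  also have "\<dots> = \<theta> - e * ((m - 1) / 4)" by (simp add: \<theta>_def field_simps)
  also have "\<dots> < \<theta>" using e m_gt_1 by simp
  finally have G1: "G < \<theta>" .
  have G0: "0 \<le> G" unfolding G_def v using pe by (intro integral_nonneg_AE) auto
  have "branching p K \<theta> \<pi>0 (G / \<theta>)"
    by unfold_locales (use th pi0 G0 G1 in \<open>auto simp: G_def[symmetric]\<close>)
  then show ?thesis by blast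
qed

text \<open>The chord of \<open>u \<mapsto> - ln (1 - u)\<close> from \<open>\<eta>\<close> to \<open>q\<close> is steeper than \<open>m\<close>, because the chord from \<open>0\<close> to \<open>q\<close>
  has slope \<open>m\<close> and the function is strictly convex. The chords that start to the right of \<open>\<eta>\<close> are
  steeper still.\<close>

lemma chord_slope:
  assumes \<eta>: "0 < \<eta>" "\<eta> < q" and y: "(y \<longlongrightarrow> q) sequentially"
  shows "\<exists>\<kappa>>0. \<forall>\<^sub>F n in sequentially. \<forall>x. \<eta> \<le> x \<and> x < y n \<longrightarrow>
    (m + \<kappa>) * (y n - x) \<le> - ln (1 - y n) + ln (1 - x)"
proof -
  define A where "A u = - ln (1 - u)" for u :: real
  define slope where "slope z = (A z - A \<eta>) / (z - \<eta>)" for z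
  define \<kappa> where "\<kappa> = (slope q - m) / 2"
  have "A \<eta> < \<eta> * m" using drift_pos[OF \<eta>] by (simp add: A_def)
  moreover have "A q = q * m" using q_properties(3) by (simp add: A_def)
  ultimately have "m * (q - \<eta>) < A q - A \<eta>" by (simp add: algebra_simps)
  then have "m < slope q" using \<eta> by (simp add: slope_def pos_less_divide_eq)
  then have \<kappa>: "0 < \<kappa>" "m + \<kappa> < slope q" by (simp_all add: \<kappa>_def field_simps)
  have "isCont slope q"
    unfolding slope_def A_def using \<eta> q_properties(2) by (intro continuous_intros) auto
  then have "(\<lambda>n. slope (y n)) \<longlonglongrightarrow> slope q" using y by (rule isCont_tendsto_compose)
  then have 1: "\<forall>\<^sub>F n in sequentially. m + \<kappa> < slope (y n)" using \<kappa>(2) by (rule order_tendstoD)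
  have 2: "\<forall>\<^sub>F n in sequentially. y n < 1" using y q_properties(2) by (rule order_tendstoD)
  have conv: "convex_on {..<1} A"
    unfolding A_def
  proof (rule convex_on_realI)
    show "((\<lambda>u. - ln (1 - u)) has_real_derivative 1 / (1 - u)) (at u)" if "u \<in> {..<1}" for u :: real
      using that by (intro DERIV_minus_ln_one_minus) auto
    show "1 / (1 - u) \<le> 1 / (1 - v)" if "u \<in> {..<1}" "v \<in> {..<1}" "u \<le> v" for u v :: real
      using that by (intro frac_le) auto
  qed auto
  have "\<forall>\<^sub>F n in sequentially. \<forall>x. \<eta> \<le> x \<and> x < y n \<longrightarrow> (m + \<kappa>) * (y n - x) \<le> A (y n) - A x"
    using 1 2
  proof eventually_elim
    case (elim n)
    show ?case
    proof (intro allI impI)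
      fix x assume x: "\<eta> \<le> x \<and> x < y n"
      have "slope (y n) \<le> (A (y n) - A x) / (y n - x)"
      proof (cases "x = \<eta>")
        case False
        then have "(A \<eta> - A (y n)) / (\<eta> - y n) \<le> (A x - A (y n)) / (x - y n)"
          using x elim by (intro convex_on_slope_le(2)[OF conv]) auto
        then show ?thesis unfolding slope_def by (metis minus_diff_eq minus_divide_divide)
      qed (simp add: slope_def)
      then have "m + \<kappa> \<le> (A (y n) - A x) / (y n - x)" using elim by simp
      then show "(m + \<kappa>) * (y n - x) \<le> A (y n) - A x" using x by (simp add: pos_le_divide_eq)
    qed
  qed
  then show ?thesis using \<kappa> by (intro exI[of _ \<kappa>]) (simp add: A_def)
qed

text \<open>From the diagonal at time \<open>s\<close> the walk has \<open>T - s\<close> bursts at its disposal and must cover as many waiting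
  times. By \<open>chord_slope\<close> its mean is at most a negative multiple of \<open>T - s\<close>, whereas its
  variance is of order \<open>T - s\<close>; as \<open>T - s\<close> is at least of order \<open>sqrt n\<close>, Chebyshev's inequality
  applies uniformly in \<open>s\<close>.\<close>

lemma reach_from_diagonal:
  fixes T t :: "nat \<Rightarrow> nat"
  assumes \<eta>: "0 < \<eta>" "\<eta> < q" and T: "(\<lambda>n. real (T n) / real n) \<longlonglongrightarrow> q" and \<delta>: "0 < \<delta>"
    and gap: "\<forall>\<^sub>F n in sequentially. real (t n) + \<delta> * sqrt (real n) \<le> real (T n)" and e: "0 < e" and f: "1 \<le> f"
  shows "\<forall>\<^sub>F n in sequentially. \<forall>s c. \<eta> * real n \<le> real s \<and> s \<le> t n \<and> c < s + f \<longrightarrow> reach n K (T n - s) (T n) c \<le> e"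
proof -
  obtain \<kappa> where \<kappa>: "0 < \<kappa>" and chord: "\<forall>\<^sub>F n in sequentially. \<forall>x. \<eta> \<le> x \<and> x < real (T n) / real n \<longrightarrow>
    (m + \<kappa>) * (real (T n) / real n - x) \<le> - ln (1 - real (T n) / real n) + ln (1 - x)"
    using chord_slope[OF \<eta> T] by auto
  define b where "b = (1 + q) / 2"
  have b: "q < b" "b < 1" using q_properties(2) by (auto simp: b_def)
  define C where "C = (\<sigma>2 + 1 / (1 - b)\<^sup>2) / (\<kappa> / 2)\<^sup>2"
  \<comment> \<open>once \<open>T - s\<close> exceeds \<open>W\<close>, the tolerance \<open>f\<close> costs at most half of the drift, and the bound
    \<open>C / (T - s)\<close> of Chebyshev's inequality is at most \<open>e\<close>\<close>
  define W where "W = max (real f + 1) (max (2 * (m + \<kappa>) * f / \<kappa>) (C / e))"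
  have C0: "0 \<le> C" using \<sigma>2_nonneg b by (simp add: C_def)
  have ST: "(\<lambda>n. real (Suc (T n)) / real n) \<longlonglongrightarrow> q"
    using tendsto_add[OF T lim_const_over_n[of 1]] by (simp add: add_divide_distrib add.commute)
  have ev_b: "\<forall>\<^sub>F n in sequentially. real (Suc (T n)) / real n < b" using ST b(1) by (rule order_tendstoD)
  have ev_W: "\<forall>\<^sub>F n in sequentially. W \<le> \<delta> * sqrt (real n)"
  proof -
    have "filterlim (\<lambda>n. \<delta> * sqrt (real n)) at_top sequentially" using \<delta> by real_asymp
    then show ?thesis by (simp add: filterlim_at_top)
  qed
  show ?thesis using chord ev_b ev_W gap eventually_gt_at_top[of 0]
  proof eventually_elim
    case (elim n)
    show ?case
    proof (intro allI impI)
      fix s c assume sc: "\<eta> * real n \<le> real s \<and> s \<le> t n \<and> c < s + f"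
      have n: "0 < real n" using elim by simp
      define D where "D = T n - s"
      have TW: "W \<le> real (T n) - real s" using elim(3,4) sc by simp
      have W0: "0 < W" by (simp add: W_def)
      have sT: "s \<le> T n" using TW W0 by simp
      have D: "real D = real (T n) - real s" using sT by (simp add: D_def of_nat_diff)
      have DW: "real f + 1 \<le> real D" "2 * (m + \<kappa>) * f / \<kappa> \<le> real D" "C / e \<le> real D"
        using TW by (auto simp: D W_def)
      have D0: "0 < real D" using DW f by linarith
      have sf: "s + f < T n" using DW(1) sT by (simp add: D_def)
      have STb: "real (Suc (T n)) / real n \<le> b" using elim by simp
      have "real (Suc (T n)) < real n"
        using STb b n by (metis divide_less_eq_1_pos le_less_trans)
      then have Tn: "T n < n" by simp
      define qs where "qs = walk n K D (s + f) (T n)"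
      have rg: "r \<le> n" "real r / real n \<le> b" "1 - b \<le> hit n r" "0 < hit n r" "hit n r \<le> 1" if "r < Suc (T n)" for r
      proof -
        have "real r / real n \<le> real (Suc (T n)) / real n" using that by (intro divide_right_mono) auto
        then show rb: "real r / real n \<le> b" using STb by linarith
        show rn: "r \<le> n" using that Tn by simp
        have "hit n r = 1 - real r / real n" using rn n by (intro hit_eq) auto
        then show "1 - b \<le> hit n r" "0 < hit n r" using rb b by auto
        show "hit n r \<le> 1" by (rule hit_bounds)
      qed
      have "\<forall>p'\<in>set qs. square_integrable p'"
        using rg K_moments(1) square_integrable_wait
        by (auto simp: qs_def walk_def set_replicate_conv_if simp del: upt_Suc)
      moreover have mean_qs: "sum_list (map mean qs) \<le> - (\<kappa> / 2 * real D)"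
      proof -
        define x where "x = real (s + f - 1) / real n"
        have sf1: "real (s + f - 1) = real s + (real f - 1)" using f by (simp add: of_nat_diff)
        have "real s / real n \<le> x" unfolding x_def using n f by (intro divide_right_mono) auto
        moreover have "\<eta> \<le> real s / real n" using sc n by (simp add: pos_le_divide_eq)
        ultimately have x\<eta>: "\<eta> \<le> x" by linarith
        have xT: "x < real (T n) / real n" unfolding x_def using n sf by (intro divide_strict_right_mono) auto
        have ch: "(m + \<kappa>) * (real (T n) / real n - x) \<le> - ln (1 - real (T n) / real n) + ln (1 - x)"
          using elim(1) x\<eta> xT by blast
        have mono: "1 / (1 - u) \<le> 1 / (1 - v)" if "0 \<le> u" "u \<le> v" "v \<le> b" for u v
          using that b by (intro frac_le) auto
        have der: "((\<lambda>u. - ln (1 - u)) has_real_derivative 1 / (1 - u)) (at u)" if "0 \<le> u" "u \<le> b" for u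
          using that b by (intro DERIV_minus_ln_one_minus) auto
        have "- ln (1 - real (T n) / real n) - (- ln (1 - real (s + f - 1) / real n))
            \<le> (\<Sum>r\<in>{s + f..<Suc (T n)}. 1 / (1 - real r / real n)) / real n"
          using f sf by (intro riemann_sum_bounds(1)[OF n _ _ STb mono der]) auto
        then have "(m + \<kappa>) * (real (T n) / real n - x) \<le> (\<Sum>r\<in>{s + f..<Suc (T n)}. 1 / (1 - real r / real n)) / real n"
          using ch by (simp add: x_def)
        then have "(m + \<kappa>) * (real (T n) / real n - x) * real n \<le> (\<Sum>r\<in>{s + f..<Suc (T n)}. 1 / (1 - real r / real n))"
          using n by (simp only: pos_le_divide_eq)
        moreover have "(m + \<kappa>) * (real (T n) / real n - x) * real n = (m + \<kappa>) * (real D - (real f - 1))"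
          unfolding x_def sf1 D using n by (simp add: field_simps)
        ultimately have S: "(m + \<kappa>) * (real D - (real f - 1)) \<le> (\<Sum>r\<in>{s + f..<Suc (T n)}. 1 / (1 - real r / real n))" by simp
        have "(\<Sum>r\<in>{s + f..<Suc (T n)}. mean (neg_wait (hit n r))) = - (\<Sum>r\<in>{s + f..<Suc (T n)}. 1 / (1 - real r / real n))"
          unfolding sum_negf[symmetric]
        proof (rule sum.cong[OF refl])
          fix r assume "r \<in> {s + f..<Suc (T n)}"
          then have r: "r < Suc (T n)" by simp
          show "mean (neg_wait (hit n r)) = - (1 / (1 - real r / real n))"
            using mean_wait[OF rg(4,5)[OF r]] hit_eq[OF rg(1)[OF r]] n by simp
        qed
        then have "sum_list (map mean qs) = real D * m - (\<Sum>r\<in>{s + f..<Suc (T n)}. 1 / (1 - real r / real n))"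
          unfolding qs_def sum_list_walk K_moments by simp
        also have "\<dots> \<le> real D * m - (m + \<kappa>) * (real D - (real f - 1))" using S by simp
        also have "\<dots> = - (\<kappa> * real D) + (m + \<kappa>) * (real f - 1)" by (simp add: algebra_simps)
        also have "\<dots> \<le> - (\<kappa> * real D) + \<kappa> / 2 * real D"
        proof -
          have "2 * (m + \<kappa>) * f \<le> real D * \<kappa>" using DW(2) \<kappa> by (simp add: pos_divide_le_eq)
          moreover have "(m + \<kappa>) * (real f - 1) \<le> (m + \<kappa>) * f" using m_nonneg \<kappa> by (intro mult_left_mono) auto
          ultimately show ?thesis by (simp add: algebra_simps)
        qed
        finally show ?thesis by simp
      qed
      moreover have "0 < \<kappa> / 2 * real D" using \<kappa> D0 by simp
      ultimately have "measure_pmf.prob (sum_pmf qs) {0..} \<le> sum_list (map var qs) / (\<kappa> / 2 * real D)\<^sup>2"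
        by (intro sum_pmf_Chebyshev)
      also have "sum_list (map var qs) \<le> real D * (\<sigma>2 + 1 / (1 - b)\<^sup>2)"
      proof -
        have "var (neg_wait (hit n r)) \<le> 1 / (1 - b)\<^sup>2" if "r < Suc (T n)" for r
          unfolding var_wait[OF rg(4,5)[OF that]] using rg[OF that] b by (intro frac_le power_mono) auto
        then have "(\<Sum>r\<in>{s + f..<Suc (T n)}. var (neg_wait (hit n r))) \<le> real (card {s + f..<Suc (T n)}) * (1 / (1 - b)\<^sup>2)"
          by (intro sum_bounded_above) auto
        also have "\<dots> \<le> real D * (1 / (1 - b)\<^sup>2)"
          using f sT by (intro mult_right_mono) (auto simp: D_def)
        finally show ?thesis unfolding qs_def sum_list_walk K_moments by (simp add: algebra_simps)
      qed
      then have "sum_list (map var qs) / (\<kappa> / 2 * real D)\<^sup>2 \<le> real D * (\<sigma>2 + 1 / (1 - b)\<^sup>2) / (\<kappa> / 2 * real D)\<^sup>2"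
        by (rule divide_right_mono) simp
      also have "real D * (\<sigma>2 + 1 / (1 - b)\<^sup>2) / (\<kappa> / 2 * real D)\<^sup>2 = C / real D"
        using D0 by (simp add: C_def power_mult_distrib power2_eq_square)
      also have "C / real D \<le> e" using DW(3) D0 e by (simp add: divide_le_eq mult.commute)
      finally have "reach n K D (T n) (s + f) \<le> e" using reach_eq_walk[OF Tn] by (simp add: qs_def)
      moreover have "reach n K D (T n) c \<le> reach n K D (T n) (s + f)" using sc by (intro reach_mono) simp
      ultimately show "reach n K (T n - s) (T n) c \<le> e" by (simp add: D_def)
    qed
  qed
qed

definition threshold :: "real \<Rightarrow> nat \<Rightarrow> nat" where
  "threshold x n = nat \<lfloor>real n * q + x * sqrt (real n)\<rfloor>"

text \<open>The tail of the limit law: the position of the ideal process at time \<open>n q + x sqrt n\<close> relative to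
  the diagonal is governed by a Gaussian variable of variance \<open>V\<close>, and the mean of the walk
  decreases with slope \<open>1 / (1 - q) - m\<close> around \<open>q\<close>.\<close>

definition tail :: "real \<Rightarrow> real" where
  "tail x = 1 - cdf (gaussian V) (x * (1 / (1 - q) - m))"

lemma threshold_bounds:
  "\<forall>\<^sub>F n in sequentially. real (threshold x n) \<le> real n * q + x * sqrt (real n) \<and>
     real n * q + x * sqrt (real n) - 1 < real (threshold x n)"
proof -
  have "filterlim (\<lambda>n. real n * q + x * sqrt (real n)) at_top sequentially" using q_pos by real_asymp
  then have "\<forall>\<^sub>F n in sequentially. 0 \<le> real n * q + x * sqrt (real n)" by (simp add: filterlim_at_top)
  then show ?thesis
  proof eventually_elim
    case (elim n)
    then have "real (threshold x n) = of_int \<lfloor>real n * q + x * sqrt (real n)\<rfloor>" by (simp add: threshold_def)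
    then show ?case by linarith
  qed
qed

lemma threshold_at_top: "filterlim (threshold x) at_top sequentially"
proof -
  have "filterlim (\<lambda>n. real n * q + x * sqrt (real n)) at_top sequentially" using q_pos by real_asymp
  then show ?thesis unfolding threshold_def
    by (intro filterlim_compose[OF filterlim_nat_sequentially] filterlim_compose[OF filterlim_floor_sequentially])
qed

lemma threshold_limit:
  "(\<lambda>n. (real (threshold x n - k) - real n * q) / sqrt (real n)) \<longlonglongrightarrow> x"
proof (rule tendsto_sandwich)
  have up: "\<forall>\<^sub>F n in sequentially. k \<le> threshold x n" using threshold_at_top by (simp add: filterlim_at_top)
  show "\<forall>\<^sub>F n in sequentially. (real (threshold x n - k) - real n * q) / sqrt (real n) \<le> x"
    using threshold_bounds[of x] up eventually_gt_at_top[of 0]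
  proof eventually_elim
    case (elim n)
    then have "real (threshold x n - k) - real n * q \<le> x * sqrt (real n)" by (simp add: of_nat_diff)
    then show ?case using elim by (simp add: pos_divide_le_eq)
  qed
  show "\<forall>\<^sub>F n in sequentially. x - (real k + 1) / sqrt (real n) \<le> (real (threshold x n - k) - real n * q) / sqrt (real n)"
    using threshold_bounds[of x] up eventually_gt_at_top[of 0]
  proof eventually_elim
    case (elim n)
    then have "x * sqrt (real n) - (real k + 1) \<le> real (threshold x n - k) - real n * q" by (simp add: of_nat_diff)
    then have "(x * sqrt (real n) - (real k + 1)) / sqrt (real n) \<le> (real (threshold x n - k) - real n * q) / sqrt (real n)"
      by (rule divide_right_mono) simp
    then show ?case using elim by (simp add: diff_divide_distrib)
  qed
  show "(\<lambda>n. x - (real k + 1) / sqrt (real n)) \<longlonglongrightarrow> x" by real_asymp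
qed simp

lemma threshold_fraction: "(\<lambda>n. real (threshold x n) / real n) \<longlonglongrightarrow> q"
proof -
  have "(\<lambda>n. 1 / sqrt (real n)) \<longlonglongrightarrow> 0" by real_asymp
  then have "(\<lambda>n. q + (1 / sqrt (real n)) * ((real (threshold x n - 0) - real n * q) / sqrt (real n))) \<longlonglongrightarrow> q + 0 * x"
    by (intro tendsto_intros threshold_limit)
  moreover have "\<forall>\<^sub>F n in sequentially. q + (1 / sqrt (real n)) * ((real (threshold x n - 0) - real n * q) / sqrt (real n)) = real (threshold x n) / real n"
    by (rule eventually_sequentiallyI[of 1]) (simp add: field_simps)
  ultimately show ?thesis by (simp add: Lim_transform_eventually)
qed

lemma reach_limit:
  assumes "1 \<le> c"
  shows "(\<lambda>n. reach n K (threshold x n - k) (threshold x n - f) c) \<longlonglongrightarrow> tail x"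
proof -
  have "(\<lambda>n. measure_pmf.prob (sum_pmf (walk n K (threshold x n - k) c (threshold x n - f))) {0..}) \<longlonglongrightarrow> tail x"
    unfolding tail_def using assms by (intro walk_clt threshold_limit)
  moreover have "\<forall>\<^sub>F n in sequentially. real (threshold x n) / real n < 1"
    using threshold_fraction q_properties(2) by (rule order_tendstoD)
  then have "\<forall>\<^sub>F n in sequentially. measure_pmf.prob (sum_pmf (walk n K (threshold x n - k) c (threshold x n - f))) {0..}
     = reach n K (threshold x n - k) (threshold x n - f) c"
    using eventually_gt_at_top[of 0]
  proof eventually_elim
    case (elim n)
    then have "threshold x n < n" by simp
    then show ?case by (intro reach_eq_walk[symmetric]) simp
  qed
  ultimately show ?thesis by (rule Lim_transform_eventually)
qed

lemma tail_bounds: "0 \<le> tail x" "tail x \<le> 1"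
proof -
  interpret real_distribution "gaussian V" by (rule real_distribution_gaussian)
  show "0 \<le> tail x" "tail x \<le> 1" by (auto simp: tail_def cdf_bounded_prob cdf_nonneg)
qed

lemma isCont_tail: "isCont tail x"
  unfolding tail_def
  by (intro continuous_intros isCont_o2[OF _ isCont_cdf_gaussian[OF V_pos]])

lemma tail_near_1: assumes "0 < e" shows "\<exists>x. 1 - e < tail x"
proof -
  interpret real_distribution "gaussian V" by (rule real_distribution_gaussian)
  have "(cdf (gaussian V) \<longlongrightarrow> 0) at_bot" by (rule cdf_lim_at_bot)
  then have "\<forall>\<^sub>F z in at_bot. cdf (gaussian V) z < e" using assms by (rule order_tendstoD)
  then obtain z where z: "cdf (gaussian V) z < e" by (auto simp: eventually_at_bot_linorder)
  then show ?thesis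
    using drift_slope_pos by (intro exI[of _ "z / (1 / (1 - q) - m)"]) (simp add: tail_def)
qed

end

section \<open>The tail of the end of the transmission\<close>

context supercritical
begin

lemma comparison_error_eventually:
  assumes "0 < e" "ecost 1 0 0 / real f \<le> e"
  shows "\<forall>\<^sub>F n in sequentially. comparison_error n L f \<le> 2 * e"
proof -
  have "(\<lambda>n. ecost L 0 0 / real n) \<longlonglongrightarrow> 0" by (rule lim_const_over_n)
  then have "\<forall>\<^sub>F n in sequentially. ecost L 0 0 / real n < e" using assms by (intro order_tendstoD) auto
  then show ?thesis using assms by (auto simp: comparison_error_def elim!: eventually_mono)
qed

text \<open>After the first \<open>L\<close> bursts, the number of informed servers is at most a constant \<open>M\<close> with probability
  close to \<open>1\<close>. By monotonicity it suffices to apply \<open>reach_limit\<close> from \<open>M\<close> itself.\<close>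

lemma late_end_asymptotics:
  assumes adm: "\<And>n. admissible_rule (rule n)" and e: "0 < e" and f: "1 \<le> f" "ecost 1 0 0 / real f \<le> e"
  shows "\<forall>\<^sub>F n in sequentially. measure_pmf.prob (end_time_law n p K (rule n)) {s. threshold x n < s}
    \<le> tail x * surviving n K L 0 (\<lambda>_. 1) 1 + 4 * e"
proof -
  obtain M :: nat where M: "1 \<le> M" "(1 + L * m) / e \<le> real M"
    by (meson le_trans max.cobounded1 max.cobounded2 of_nat_mono order_trans real_arch_simple)
  have M0: "0 < real M" using M by simp
  have reach_ev: "\<forall>\<^sub>F n in sequentially. reach n K (threshold x n - L) (threshold x n - f) M < tail x + e"
    using reach_limit[OF M(1)] e by (intro order_tendstoD) auto
  have ev: "\<forall>\<^sub>F n in sequentially. L + f \<le> threshold x n" using threshold_at_top by (simp add: filterlim_at_top)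
  show ?thesis using comparison_error_eventually[OF e f(2), of L] reach_ev ev eventually_gt_at_top[of 0]
  proof eventually_elim
    case (elim n)
    let ?a = "surviving n K L 0 (\<lambda>_. 1) 1"
    define \<psi> where "\<psi> = reach n K (threshold x n - L) (threshold x n - f)"
    \<comment> \<open>Markov's inequality for the event that more than \<open>M\<close> servers are informed\<close>
    define g where "g c = min 1 (real c / real M)" for c :: nat
    have one: "(0::real) \<le> 1" "(1::real) \<le> 1" by auto
    have g: "0 \<le> g c" "g c \<le> 1" for c by (auto simp: g_def)
    have \<psi>: "0 \<le> \<psi> c" "\<psi> c \<le> 1" for c using reach_bounds by (auto simp: \<psi>_def)
    have a: "0 \<le> ?a" "?a \<le> 1" using surviving_bounds[of "\<lambda>_. 1" 1] by auto
    have "measure_pmf.prob (end_time_law n p K (rule n)) {s. threshold x n < s} \<le>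
      surviving n K L 0 \<psi> 1 + comparison_error n L f"
      unfolding \<psi>_def using elim f by (intro late_end_le adm) auto
    also have "surviving n K L 0 \<psi> 1 \<le> surviving n K L 0 (\<lambda>c. \<psi> M * 1 + 1 * g c) 1"
    proof (rule surviving_le[OF \<psi>, where B'="\<psi> M + 1"])
      show "0 \<le> \<psi> M * 1 + 1 * g c" "\<psi> M * 1 + 1 * g c \<le> \<psi> M + 1" for c using \<psi> g by auto
      show "\<psi> c \<le> \<psi> M * 1 + 1 * g c" for c
      proof (cases "c \<le> M")
        case True
        then show ?thesis using reach_mono[of c M] g[of c] by (simp add: \<psi>_def add_increasing2)
      next
        case False
        then have "g c = 1" using M0 by (simp add: g_def le_divide_eq)
        then show ?thesis using \<psi>[of c] \<psi>[of M] by simp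
      qed
    qed
    also have "\<dots> = \<psi> M * ?a + 1 * surviving n K L 0 g 1" by (rule surviving_linear[OF one g])
    also have "surviving n K L 0 g 1 \<le> (real 1 + L * m) / real M"
      using M0 by (intro surviving_linear_growth g) (auto simp: g_def)
    also have "(real 1 + L * m) / real M \<le> e" using M M0 e by (simp add: divide_le_eq mult.commute)
    also have "\<psi> M * ?a \<le> (tail x + e) * ?a" using elim(2) a by (intro mult_right_mono) (auto simp: \<psi>_def)
    also have "(tail x + e) * ?a \<le> tail x * ?a + e" using a e by (simp add: algebra_simps mult_left_le)
    finally show ?case using elim(1) by simp
  qed
qed

lemma late_end_le_survival:
  assumes adm: "\<And>n. admissible_rule (rule n)" and e: "0 < e" and f: "1 \<le> f" "ecost 1 0 0 / real f \<le> e" and \<epsilon>: "0 < \<epsilon>"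
  shows "\<forall>\<^sub>F n in sequentially. measure_pmf.prob (end_time_law n p K (rule n)) {s. real n * \<epsilon> < real s}
    \<le> surviving n K L 0 (\<lambda>_. 1) 1 + 2 * e"
proof -
  have "filterlim (\<lambda>n. real n * \<epsilon>) at_top sequentially" using \<epsilon> by real_asymp
  then have ev: "\<forall>\<^sub>F n in sequentially. real (L + f) \<le> real n * \<epsilon>" by (simp only: filterlim_at_top)
  show ?thesis using comparison_error_eventually[OF e f(2), of L] ev eventually_gt_at_top[of 0]
  proof eventually_elim
    case (elim n)
    define t where "t = nat \<lfloor>real n * \<epsilon>\<rfloor>"
    have t: "L + f \<le> t" using elim unfolding t_def by linarith
    have "measure_pmf.prob (end_time_law n p K (rule n)) {s. real n * \<epsilon> < real s} \<le>
      measure_pmf.prob (end_time_law n p K (rule n)) {s. t < s}"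
    proof (rule measure_pmf.finite_measure_mono)
      have "t < s" if "real n * \<epsilon> < real s" for s
      proof -
        have "0 \<le> real n * \<epsilon>" using \<epsilon> by simp
        then have "real t \<le> real n * \<epsilon>" by (simp add: t_def)
        then show ?thesis using that by linarith
      qed
      then show "{s. real n * \<epsilon> < real s} \<subseteq> {s. t < s}" by blast
    qed simp
    also have "\<dots> \<le> surviving n K L 0 (reach n K (t - L) (t - f)) 1 + comparison_error n L f"
      using t f elim by (intro late_end_le adm) auto
    also have "surviving n K L 0 (reach n K (t - L) (t - f)) 1 \<le> surviving n K L 0 (\<lambda>_. 1) 1"
      by (rule surviving_le[where B=1 and B'=1]) (auto simp: reach_bounds)
    finally show ?case using elim(1) by simp
  qed
qed

text \<open>The later time \<open>t'\<close> of \<open>early_end_le\<close> is taken at distance of order \<open>\<delta> sqrt n\<close>, large enough for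
  \<open>reach_from_diagonal\<close> and small enough not to change the limit.\<close>

lemma early_end_asymptotics:
  assumes br: "branching p K \<theta> \<pi>0 \<rho>" and adm: "\<And>n. admissible_rule (rule n)" and e: "0 < e"
    and f: "1 \<le> f" "ecost 1 0 0 / real f \<le> e" and L: "(1 / \<theta>) ^ f * \<rho> ^ L \<le> e"
  shows "\<forall>\<^sub>F n in sequentially. measure_pmf.prob (end_time_law n p K (rule n)) {s. s \<le> threshold x n}
    \<le> 1 - tail x * surviving n K L 0 (\<lambda>_. 1) 1 + 6 * e"
    and "\<forall>\<^sub>F n in sequentially. 1 - \<theta> \<le> surviving n K L 0 (\<lambda>_. 1) 1"
proof -
  interpret branching p K \<theta> \<pi>0 \<rho> by (rule br)
  define \<eta> where "\<eta> = min ((1 - \<pi>0) / 2) (q / 2)"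
  have "\<eta> \<le> (1 - \<pi>0) / 2" "\<eta> \<le> q / 2" unfolding \<eta>_def by (rule min.cobounded1, rule min.cobounded2)
  moreover have "0 < \<eta>" using pi0 q_pos by (simp add: \<eta>_def)
  ultimately have "\<eta> \<le> (1 - \<pi>0) / 2" "\<eta> \<le> q / 2" "0 < \<eta>" .
  then have \<eta>: "0 < \<eta>" "\<eta> < q" "2 * \<eta> \<le> 1 - \<pi>0" using q_pos by (simp_all add: field_simps)
  define N1 where "N1 n = nat \<lfloor>\<eta> * real n\<rfloor>" for n
  define c1 where "c1 n = nat \<lfloor>(1 - \<pi>0) * real n\<rfloor>" for n
  have hit: "\<pi>0 \<le> hit n d" if "0 < n" "d < c1 n" for n d
  proof -
    have "real d \<le> (1 - \<pi>0) * real n" using that unfolding c1_def by linarith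
    moreover have "(1 - \<pi>0) * real n \<le> 1 * real n" using pi0 by (intro mult_right_mono) auto
    ultimately have "d \<le> n" "\<pi>0 \<le> 1 - real d / real n" using that by (auto simp: field_simps)
    then show ?thesis using that by (simp add: hit_eq)
  qed
  have "filterlim (\<lambda>n. \<eta> * real n) at_top sequentially" using \<eta> by real_asymp
  then have ev_\<eta>: "\<forall>\<^sub>F n in sequentially. real (L + f + 2) \<le> \<eta> * real n" by (simp only: filterlim_at_top)
  have ev_N: "\<forall>\<^sub>F n in sequentially. L \<le> N1 n \<and> N1 n + f \<le> c1 n \<and> L < c1 n"
    using ev_\<eta>
  proof eventually_elim
    case (elim n)
    have "2 * \<eta> * real n \<le> (1 - \<pi>0) * real n" using \<eta> by (intro mult_right_mono) auto
    then have "\<eta> * real n + real (L + f + 2) \<le> (1 - \<pi>0) * real n" using elim by linarith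
    then show ?case using elim unfolding N1_def c1_def by linarith
  qed
  show "\<forall>\<^sub>F n in sequentially. 1 - \<theta> \<le> surviving n K L 0 (\<lambda>_. 1) 1"
    using ev_N eventually_gt_at_top[of 0]
  proof eventually_elim
    case (elim n)
    have "1 - (1 / \<theta>) ^ 0 * extinction (c1 n) 1 \<le> surviving n K L 0 (\<lambda>_. 1) 1"
      using elim by (intro surviving_ge[where ?c1.0="c1 n"] hit) auto
    then show ?case using th by (auto simp: extinction_def split: if_splits)
  qed
  obtain \<delta> where \<delta>: "0 < \<delta>" "tail x - e < tail (x + \<delta>)"
  proof -
    have "\<forall>\<^sub>F z in at x. tail x - e < tail z"
      using isCont_tail[of x] e unfolding isCont_def by (intro order_tendstoD) auto
    then obtain d where d: "0 < d" "\<And>z. z \<noteq> x \<Longrightarrow> dist z x < d \<Longrightarrow> tail x - e < tail z"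
      unfolding eventually_at by auto
    show ?thesis by (rule that[of "d / 2"]) (use d in \<open>auto simp: dist_real_def\<close>)
  qed
  define \<gamma> where "\<gamma> = 1 + e"
  define e' where "e' = e / (1 + e)"
  have \<gamma>: "0 < \<gamma>" "0 < e'" "\<gamma> * (1 - e') = 1" using e by (auto simp: \<gamma>_def e'_def field_simps)
  have gap: "\<forall>\<^sub>F n in sequentially. real (threshold x n) + \<delta> / 2 * sqrt (real n) \<le> real (threshold (x + \<delta>) n)"
  proof -
    have "filterlim (\<lambda>n. \<delta> / 2 * sqrt (real n)) at_top sequentially" using \<delta> by real_asymp
    then have "\<forall>\<^sub>F n in sequentially. 1 \<le> \<delta> / 2 * sqrt (real n)" by (simp only: filterlim_at_top)
    then show ?thesis using threshold_bounds[of x] threshold_bounds[of "x + \<delta>"]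
    proof eventually_elim
      case (elim n)
      then show ?case by (simp add: distrib_right)
    qed
  qed
  have stop: "\<forall>\<^sub>F n in sequentially. \<forall>s c. \<eta> * real n \<le> real s \<and> s \<le> threshold x n \<and> c < s + f \<longrightarrow>
      reach n K (threshold (x + \<delta>) n - s) (threshold (x + \<delta>) n) c \<le> e'"
    using \<delta> \<gamma> f by (intro reach_from_diagonal[OF \<eta>(1,2) threshold_fraction _ gap]) auto
  have lim: "\<forall>\<^sub>F n in sequentially. tail (x + \<delta>) - e < reach n K (threshold (x + \<delta>) n - L) (threshold (x + \<delta>) n) 1"
    using reach_limit[of 1 "x + \<delta>" L 0] e by (intro order_tendstoD) auto
  have ev_L: "\<forall>\<^sub>F n in sequentially. L \<le> threshold (x + \<delta>) n" using threshold_at_top by (simp add: filterlim_at_top)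
  show "\<forall>\<^sub>F n in sequentially. measure_pmf.prob (end_time_law n p K (rule n)) {s. s \<le> threshold x n}
    \<le> 1 - tail x * surviving n K L 0 (\<lambda>_. 1) 1 + 6 * e"
    using comparison_error_eventually[OF e f(2), of L] ev_N stop lim gap ev_L eventually_gt_at_top[of 0]
  proof eventually_elim
    case (elim n)
    let ?a = "surviving n K L 0 (\<lambda>_. 1) 1" and ?T = "threshold (x + \<delta>) n"
    let ?r = "reach n K (?T - L) ?T 1"
    have a: "0 \<le> ?a" "?a \<le> 1" using surviving_bounds[of "\<lambda>_. 1" 1] by auto
    have le: "threshold x n \<le> ?T"
    proof -
      have "0 \<le> \<delta> / 2 * sqrt (real n)" using \<delta> by simp
      then have "real (threshold x n) \<le> real ?T" using elim(5) by linarith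
      then show ?thesis by simp
    qed
    have "measure_pmf.prob (end_time_law n p K (rule n)) {s. s \<le> threshold x n} \<le>
      1 - ?a + \<gamma> * (1 - ?r) * ?a + (1 / \<theta>) ^ f * \<rho> ^ L + comparison_error n L f"
    proof (rule early_end_le[where ?c1.0="c1 n" and ?N1.0="N1 n"])
      fix s c assume sc: "N1 n < s" "s \<le> threshold x n" "c < s + f"
      have "\<eta> * real n \<le> real s" using sc(1) unfolding N1_def by linarith
      then have "reach n K (?T - s) ?T c \<le> e'" using elim(3) sc by blast
      then have "\<gamma> * (1 - e') \<le> \<gamma> * (1 - reach n K (?T - s) ?T c)" using \<gamma> by (intro mult_left_mono) auto
      then show "1 \<le> \<gamma> * (1 - reach n K (?T - s) ?T c)" using \<gamma> by simp
    qed (use adm elim f hit le \<gamma> in auto)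
    also have "\<gamma> * (1 - ?r) * ?a \<le> (1 - tail x + 3 * e) * ?a"
    proof (rule mult_right_mono[OF _ a(1)])
      have "?r \<le> 1" "0 \<le> ?r" by (auto simp: reach_bounds)
      then have "e * (1 - ?r) \<le> e * 1" using e by (intro mult_left_mono) auto
      moreover have "\<gamma> * (1 - ?r) = (1 - ?r) + e * (1 - ?r)" by (simp add: \<gamma>_def algebra_simps)
      ultimately show "\<gamma> * (1 - ?r) \<le> 1 - tail x + 3 * e" using elim(4) \<delta>(2) by linarith
    qed
    also have "(1 - tail x + 3 * e) * ?a \<le> ?a - tail x * ?a + 3 * e"
      using a e by (simp add: algebra_simps mult_left_le)
    finally show ?case using elim(1) L by linarith
  qed
qed

text \<open>For a given precision \<open>e\<close>, the tolerance \<open>f\<close> is chosen first, then the number \<open>L\<close> of initial bursts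
  and finally \<open>n\<close>. The survival probability \<open>a\<close> of the ideal process depends on \<open>L\<close>, but it is the same
  in the approximations of both probabilities.\<close>

lemma conditional_tail_limit:
  assumes adm: "\<And>n. admissible_rule (rule n)" and \<epsilon>: "0 < \<epsilon>" "\<epsilon> < q"
  defines "late \<equiv> \<lambda>n. measure_pmf.prob (end_time_law n p K (rule n)) {s. real n * \<epsilon> < real s}"
    and "exceed \<equiv> \<lambda>x n. measure_pmf.prob (end_time_law n p K (rule n)) {s. threshold x n < s}"
  shows "(\<lambda>n. exceed x n / late n) \<longlonglongrightarrow> tail x"
    and "\<forall>\<^sub>F n in sequentially. 0 < late n"
proof -
  obtain \<theta> \<pi>0 \<rho> where br: "branching p K \<theta> \<pi>0 \<rho>" using exists_branching by blast
  then interpret branching p K \<theta> \<pi>0 \<rho> .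
  have key: "\<forall>\<^sub>F n in sequentially. \<exists>a. 1 - \<theta> \<le> a \<and> a \<le> 1 \<and> \<bar>exceed x n - tail x * a\<bar> \<le> 6 * e \<and> \<bar>late n - a\<bar> \<le> 7 * e"
    if e: "0 < e" for e x
  proof -
    obtain f0 :: nat where f0: "ecost 1 0 0 / e \<le> real f0" using real_arch_simple by blast
    define f where "f = Suc f0"
    have f: "1 \<le> f" "ecost 1 0 0 / real f \<le> e"
    proof -
      have "ecost 1 0 0 / e \<le> real f" using f0 by (simp add: f_def)
      then show "ecost 1 0 0 / real f \<le> e" using e by (simp add: f_def divide_le_eq mult.commute)
    qed (simp add: f_def)
    have "(\<lambda>L. (1 / \<theta>) ^ f * \<rho> ^ L) \<longlonglongrightarrow> (1 / \<theta>) ^ f * 0"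
      using rho by (intro tendsto_intros LIMSEQ_power_zero) auto
    then have "\<forall>\<^sub>F L in sequentially. (1 / \<theta>) ^ f * \<rho> ^ L < e" using e by (intro order_tendstoD) auto
    then obtain L where L: "(1 / \<theta>) ^ f * \<rho> ^ L < e" by (auto simp: eventually_sequentially)
    \<comment> \<open>the probability of a late end is bounded below through a threshold \<open>n q + x0 sqrt n\<close> that is
      exceeded with probability close to \<open>1\<close> under the limit law\<close>
    obtain x0 where x0: "1 - e < tail x0" using tail_near_1[OF e] by blast
    note early = early_end_asymptotics[where rule=rule, OF br adm e f less_imp_le[OF L]]
    have ev_thr: "\<forall>\<^sub>F n in sequentially. real n * \<epsilon> < real (threshold x0 n)"
    proof -
      have "\<forall>\<^sub>F n in sequentially. \<epsilon> < real (threshold x0 n) / real n"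
        using threshold_fraction \<epsilon>(2) by (rule order_tendstoD)
      then show ?thesis using eventually_gt_at_top[of 0]
        by eventually_elim (simp add: pos_less_divide_eq mult.commute)
    qed
    show ?thesis
      using early(1)[where x=x] early(1)[where x=x0] early(2)
        late_end_asymptotics[where rule=rule and x=x and L=L, OF adm e f]
        late_end_le_survival[where rule=rule and L=L, OF adm e f \<epsilon>(1)] ev_thr
    proof eventually_elim
      case (elim n)
      let ?a = "surviving n K L 0 (\<lambda>_. 1) 1"
      have a: "0 \<le> ?a" "?a \<le> 1" using surviving_bounds[of "\<lambda>_. 1" 1] by auto
      have compl: "measure_pmf.prob (end_time_law n p K (rule n)) {s. s \<le> threshold z n} = 1 - exceed z n" for z
      proof -
        have "{s. s \<le> threshold z n} = space (measure_pmf (end_time_law n p K (rule n))) - {s. threshold z n < s}" by auto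
        then show ?thesis unfolding exceed_def
          using measure_pmf.prob_compl[of "{s. threshold z n < s}" "end_time_law n p K (rule n)"] by simp
      qed
      have "exceed x0 n \<le> late n"
        unfolding exceed_def late_def using elim(6) by (intro measure_pmf.finite_measure_mono) auto
      moreover have "?a - e \<le> tail x0 * ?a"
      proof -
        have "(1 - e) * ?a \<le> tail x0 * ?a" using x0 a by (intro mult_right_mono) auto
        moreover have "e * ?a \<le> e" using a e by (simp add: mult_left_le)
        ultimately show ?thesis by (simp add: algebra_simps)
      qed
      moreover have "exceed x n \<le> tail x * ?a + 4 * e" "late n \<le> ?a + 2 * e"
        using elim(4,5) by (simp_all add: exceed_def late_def)
      ultimately show ?case
        using elim(1,2,3) a e unfolding compl by (intro exI[of _ ?a] conjI abs_leI) linarith+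
    qed
  qed
  have th1: "0 < 1 - \<theta>" using th by simp
  then have half_pos: "0 < (1 - \<theta>) / 2" by simp
  have late_pos: "\<forall>\<^sub>F n in sequentially. (1 - \<theta>) / 2 \<le> late n"
  proof -
    have "0 < (1 - \<theta>) / 14" using th1 by simp
    from key[OF this, of 0] show ?thesis
    proof eventually_elim
      case (elim n)
      then obtain a where a1: "1 - \<theta> \<le> a" and a2: "\<bar>late n - a\<bar> \<le> 7 * ((1 - \<theta>) / 14)" by blast
      have "a - late n \<le> \<bar>late n - a\<bar>" using abs_ge_minus_self[of "late n - a"] by simp
      also note a2
      finally have "a - late n \<le> 7 * ((1 - \<theta>) / 14)" .
      then have "(a - late n) * 2 \<le> 1 - \<theta>" by simp
      then show ?case using a1 by (simp add: field_simps)
    qed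
  qed
  then show "\<forall>\<^sub>F n in sequentially. 0 < late n"
    by eventually_elim (rule less_le_trans[OF half_pos])
  show "(\<lambda>n. exceed x n / late n) \<longlonglongrightarrow> tail x"
  proof (rule LIMSEQ_I)
    fix r :: real assume r: "0 < r"
    define e where "e = r * ((1 - \<theta>) / 2) / 14"
    have e: "0 < e" using r th1 by (simp add: e_def)
    have "\<forall>\<^sub>F n in sequentially. norm (exceed x n / late n - tail x) < r"
      using key[OF e, of x] late_pos
    proof eventually_elim
      case (elim n)
      then obtain a where a: "\<bar>exceed x n - tail x * a\<bar> \<le> 6 * e" "\<bar>late n - a\<bar> \<le> 7 * e" by blast
      have l: "0 < late n" by (rule less_le_trans[OF half_pos elim(2)])
      have "exceed x n - tail x * late n = (exceed x n - tail x * a) - tail x * (late n - a)" by (simp add: algebra_simps)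
      then have "\<bar>exceed x n - tail x * late n\<bar> \<le> \<bar>exceed x n - tail x * a\<bar> + tail x * \<bar>late n - a\<bar>"
        using abs_triangle_ineq4[of "exceed x n - tail x * a" "tail x * (late n - a)"] tail_bounds(1)[of x] by (simp add: abs_mult)
      also have "tail x * \<bar>late n - a\<bar> \<le> 1 * (7 * e)" using a tail_bounds by (intro mult_mono) auto
      finally have "\<bar>exceed x n - tail x * late n\<bar> \<le> 13 * e" using a by simp
      also have "\<dots> < 14 * e" using e by simp
      also have "14 * e = r * ((1 - \<theta>) / 2)" by (simp add: e_def)
      also have "\<dots> \<le> r * late n" using elim(2) r by (intro mult_left_mono) auto
      finally have "\<bar>exceed x n - tail x * late n\<bar> / late n < r" using l by (simp add: pos_divide_less_eq)
      moreover have "exceed x n / late n - tail x = (exceed x n - tail x * late n) / late n" using l by (simp add: field_simps)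
      ultimately show ?case using l by (simp add: abs_divide)
    qed
    then show "\<exists>no. \<forall>n\<ge>no. norm (exceed x n / late n - tail x) < r" by (simp add: eventually_sequentially)
  qed
qed

lemma limit_variance_eq: "limit_variance K = V / (1 / (1 - q) - m)\<^sup>2"
proof -
  have q1: "1 - q \<noteq> 0" using q_properties(2) by simp
  have var: "measure_pmf.variance K real = \<sigma>2"
    unfolding \<sigma>2_def m_def m2_def using K1 K2 by (rule measure_pmf.variance_eq)
  have "limit_variance K = (q * \<sigma>2 * (1 - q)\<^sup>2 + q * (1 - q) + (1 - q)\<^sup>2 * ln (1 - q)) / ((1 - q) * m - 1)\<^sup>2"
    unfolding limit_variance_def Let_def q_def[symmetric] m_def[symmetric] var[unfolded m_def[symmetric]] ..
  also have "q * \<sigma>2 * (1 - q)\<^sup>2 + q * (1 - q) + (1 - q)\<^sup>2 * ln (1 - q) = (1 - q)\<^sup>2 * V"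
    using q1 by (simp add: V_def field_simps power2_eq_square)
  also have "((1 - q) * m - 1)\<^sup>2 = (1 - q)\<^sup>2 * (1 / (1 - q) - m)\<^sup>2"
  proof -
    have "(1 - q) * m - 1 = - ((1 - q) * (1 / (1 - q) - m))" using q1 by (simp add: field_simps)
    then show ?thesis by (simp only: power2_minus power_mult_distrib)
  qed
  finally show ?thesis using q1 by simp
qed

lemma cdf_limit_law:
  "cdf (density lborel (normal_density 0 (sqrt (limit_variance K)))) x = 1 - tail x"
proof -
  define \<beta> where "\<beta> = 1 / (1 - q) - m"
  have \<beta>: "0 < \<beta>" using drift_slope_pos by (simp add: \<beta>_def)
  have s: "sqrt (limit_variance K) = sqrt V / \<beta>"
    unfolding limit_variance_eq \<beta>_def[symmetric] using \<beta> by (simp add: real_sqrt_divide)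
  have pos: "0 < sqrt V / \<beta>" using V_pos \<beta> by simp
  have "0 < (sqrt V / \<beta>)\<^sup>2" using pos by (rule zero_less_power)
  then have "cdf (density lborel (normal_density 0 (sqrt (limit_variance K)))) x = cdf std_normal_distribution (x / (sqrt V / \<beta>))"
    unfolding s density_normal_eq_gaussian[OF pos] using pos V_pos \<beta>
    by (simp add: cdf_gaussian real_sqrt_power del: power_divide)
  also have "\<dots> = cdf (gaussian V) (x * \<beta>)" using cdf_gaussian[OF V_pos] \<beta> by simp
  finally show ?thesis by (simp add: tail_def \<beta>_def)
qed

end

theorem theorem2p4:
  fixes p \<epsilon> :: real and K :: "nat pmf" and rule :: "nat \<Rightarrow> selection_rule"
  assumes "0 < p" and "p \<le> 1"
    and "integrable (measure_pmf K) (\<lambda>k. (real k)\<^sup>2)"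
    and "measure_pmf.expectation K real > 1"
    and "0 < \<epsilon>" and "\<epsilon> < limit_fraction K"
    and "\<And>n. admissible_rule (rule n)"
  shows "weak_conv_m
    (\<lambda>n. distr
      (uniform_measure (measure_pmf (end_time_law n p K (rule n))) {\<tau>. real \<tau> > real n * \<epsilon>})
      borel
      (\<lambda>\<tau>. (real \<tau> - real n * limit_fraction K) / sqrt (real n)))
    (density lborel (normal_density 0 (sqrt (limit_variance K))))"
proof -
  interpret spreading p K using assms(1-3) by unfold_locales
  interpret supercritical p K using assms(4) by unfold_locales (simp add: m_def)
  let ?M = "\<lambda>n. measure_pmf (end_time_law n p K (rule n))"
  let ?A = "\<lambda>n. {\<tau>. real \<tau> > real n * \<epsilon>}"
  have \<epsilon>q: "\<epsilon> < q" using assms(6) by (simp add: q_def)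
  note cond = conditional_tail_limit[where rule=rule, OF assms(7,5) \<epsilon>q]
  have "(\<lambda>n. cdf (distr (uniform_measure (?M n) (?A n)) borel (\<lambda>\<tau>. (real \<tau> - real n * q) / sqrt (real n))) x) \<longlonglongrightarrow> 1 - tail x" for x
  proof -
    have "(\<lambda>n. 1 - measure (?M n) {s. threshold x n < s} / measure (?M n) (?A n)) \<longlonglongrightarrow> 1 - tail x"
      by (intro tendsto_intros cond(1))
    moreover have "\<forall>\<^sub>F n in sequentially. 1 - measure (?M n) {s. threshold x n < s} / measure (?M n) (?A n) =
      cdf (distr (uniform_measure (?M n) (?A n)) borel (\<lambda>\<tau>. (real \<tau> - real n * q) / sqrt (real n))) x"
    proof -
      have "\<forall>\<^sub>F n in sequentially. \<epsilon> < real (threshold x n) / real n"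
        using threshold_fraction \<epsilon>q by (rule order_tendstoD)
      then show ?thesis using cond(2) threshold_bounds[of x] eventually_gt_at_top[of 0]
      proof eventually_elim
        case (elim n)
        let ?T = "{s. threshold x n < s}"
        have n: "0 < sqrt (real n)" using elim by simp
        have sub: "?T \<subseteq> ?A n"
        proof
          fix s assume "s \<in> ?T"
          moreover have "real n * \<epsilon> < real (threshold x n)" using elim by (simp add: pos_less_divide_eq mult.commute)
          ultimately show "s \<in> ?A n" by simp
        qed
        have iff: "(real \<tau> - real n * q) / sqrt (real n) \<le> x \<longleftrightarrow> \<not> threshold x n < \<tau>" for \<tau>
        proof -
          have "(real \<tau> - real n * q) / sqrt (real n) \<le> x \<longleftrightarrow> real \<tau> \<le> real n * q + x * sqrt (real n)"
            using n by (simp add: pos_divide_le_eq algebra_simps)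
          also have "\<dots> \<longleftrightarrow> \<not> threshold x n < \<tau>"
          proof
            assume le: "real \<tau> \<le> real n * q + x * sqrt (real n)"
            show "\<not> threshold x n < \<tau>"
            proof
              assume "threshold x n < \<tau>"
              then have "real (threshold x n) + 1 \<le> real \<tau>" by linarith
              then show False using le elim(3) by linarith
            qed
          next
            assume "\<not> threshold x n < \<tau>"
            then have "real \<tau> \<le> real (threshold x n)" by simp
            then show "real \<tau> \<le> real n * q + x * sqrt (real n)" using elim(3) by linarith
          qed
          finally show ?thesis .
        qed
        have "cdf (distr (uniform_measure (?M n) (?A n)) borel (\<lambda>\<tau>. (real \<tau> - real n * q) / sqrt (real n))) x =
          measure (uniform_measure (?M n) (?A n)) (- ?T)"
          unfolding cdf_def by (subst measure_distr) (auto simp: iff intro!: arg_cong[where f="measure _"])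
        also have "\<dots> = measure (?M n) (?A n \<inter> - ?T) / measure (?M n) (?A n)"
          using elim(2) by (intro measure_uniform_measure) (auto simp: measure_pmf.emeasure_eq_measure)
        also have "?A n \<inter> - ?T = ?A n - ?T" by auto
        also have "measure (?M n) (?A n - ?T) = measure (?M n) (?A n) - measure (?M n) ?T"
          using sub by (intro measure_pmf.finite_measure_Diff) auto
        finally show ?case using elim(2) by (simp add: diff_divide_distrib)
      qed
    qed
    ultimately show ?thesis by (rule Lim_transform_eventually)
  qed
  then show ?thesis
    unfolding weak_conv_m_def weak_conv_def cdf_limit_law q_def by blast
qed

end
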